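(* Let $\phi\in H^{s}(\mathbb{R}^{d})$ be a nonnegative refinable function with $\nu_{2}(\phi)>\varsigma>s>d/2$ and $\operatorname{supp}(\phi)\subseteq[0,M_{1}]\times\cdots\times[0,M_{d}]$, whose mask symbol has $\kappa+1$ sum rules with $\kappa+1>\varsigma$. Let $\Omega\subseteq\mathbb{R}^{d}$ be a bounded region of interest, let $j_0\in\{1,\dots,d\}$ be fixed, and for $N\ge1$ let $\Xi_{\Omega,N}=\{(\mathbf k,\mathbf k',\mathbf k''):\mathbf k\in\Lambda_{\Omega,N},\ \mathbf k'=\mathbf k+\mathbf e_{j_0},\ \mathbf k''=\mathbf k-\mathbf e_{j_0}\}$. Let $\{g_N\}_{N=1}^\infty$ be a sequence of uniformly $\gamma$-admissible plane reference waves on $\{\Xi_{\Omega,N}\}_{N=1}^\infty$. Then there exist constants $C(s,\varsigma),C_1(s,\varsigma,\Omega)>0$ such that for any $f\in H^{s}(\mathbb{R}^{d})$ satisfying $\nu_2(f)>\varsigma>s$ and any level $N\ge1$, $$\Big\|f|_{\Omega}-\Big(\sum_{\mathbf k\in\Lambda_{\Omega,N}}\mathring f(2^{-N}\mathbf k)\phi(2^N\cdot-\mathbf k)\Big)\Big|_{\Omega}\Big\|_{L^2(\mathbb R^d)}\le\|f\|_{H^{\varsigma}(\mathbb{R}^{d})}\Big[C(s,\varsigma)2^{-N(\varsigma-s)/2}+\gamma C_1(s,\varsigma,\Omega)\big(\|f\|_{H^{\varsigma}(\mathbb{R}^{d})}+\sup_{l\ge1}\sup_{\mathbf x\in\Omega}|g_l(\mathbf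 x)|\big)2^{-(N+1)\zeta}\Big],$$ where $\zeta=\min\{1,\varsigma-s\}$ and $\mathring f(2^{-N}\mathbf k)$ is the value reconstructed from the single-shot intensities.
   Context: **Sobolev spaces.** $\widehat f(\xi)=\int_{\mathbb R^d}f(\mathbf x)e^{-\mathbf i\mathbf x\cdot\xi}d\mathbf x$; $H^{s}(\mathbb R^d)$ is the space of $f:\mathbb R^d\to\mathbb C$ with $\int|\widehat f(\xi)|^2(1+\|\xi\|_2^2)^sd\xi<\infty$, with norm $\|f\|_{H^s(\mathbb R^d)}=(2\pi)^{-d/2}(\int|\widehat f(\xi)|^2(1+\|\xi\|_2^2)^sd\xi)^{1/2}$; $\nu_2(f)=\sup\{s\in\mathbb R:f\in H^s(\mathbb R^d)\}$. For $s>d/2$ functions in $H^s(\mathbb R^d)$ are identified with their continuous representatives. $f|_\Omega$ is the restriction of $f$ to $\Omega$ (its $L^2$ norm is computed over $\Omega$). **Refinable functions.** $\phi$ is refinable if $\widehat\phi(2\xi)=\widehat a(\xi)\widehat\phi(\xi)$ for a $2\pi\mathbb Z^d$-periodic function $\widehat a$ (the mask symbol), normalized by $\widehat\phi(\mathbf 0)=1$. The mask symbol has $\kappa+1$ sum rules if $\widehat a(\xi+2\pi\gamma')=O(\|\xi\|_2^{\kappa+1})$ as $\xi\to\mathbf 0$ for every representative $\gamma'$ of a nonzero coset of $[2^{-1}\mathbb Z^d]/\mathbb Z^d$. **Index sets.** $\Omega$ is bounded and $\mathbb Z_\Omega^d:=\Omega\cap\mathbb Z^d\ne\emptyset$. $L_{l,\min}=\min\{k_l:(k_1,\dots,k_d)\in\mathbb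 Z^d_\Omega\}$, $L_{l,\max}=\max\{k_l:(k_1,\dots,k_d)\in\mathbb Z^d_\Omega\}$, and $\Lambda_{\Omega,N}=\{(k_1,\dots,k_d)\in\mathbb Z^d:2^NL_{l,\min}-M_l\le k_l\le2^NL_{l,\max},\ l=1,\dots,d\}$, with $M_l>0$. $\mathbf e_{j}$ is the $j$th standard basis vector. **Plane waves and admissibility.** A plane wave is $g(\mathbf x)=ae^{\mathbf i\mathcal K\cdot\mathbf x}$ with $a>0$, $\mathcal K\in\mathbb R^d$. $g_N$ is $\gamma$-admissible ($0<\gamma<\infty$) on $\Xi_{\Omega,N}$ w.r.t. level $N$ if (i) for all $(\mathbf k,\mathbf k',\mathbf k'')\in\Xi_{\Omega,N}$, $g_N(2^{-N}\mathbf k)\ne g_N(2^{-N}\mathbf k')$ and $g_N(2^{-N}\mathbf k)\ne g_N(2^{-N}\mathbf k'')$; and (ii) $$\max_{(\mathbf k,\mathbf k',\mathbf k'')\in\Xi_{\Omega,N}}\frac{\max\{|g_N(2^{-N}\mathbf k)-g_N(2^{-N}\mathbf k')|,\ |\overline{g_N}(2^{-N}\mathbf k)-\overline{g_N}(2^{-N}\mathbf k'')|\}}{|\Im[(g_N(2^{-N}\mathbf k)-g_N(2^{-N}\mathbf k'))(\overline{g_N}(2^{-N}\mathbf k)-\overline{g_N}(2^{-N}\mathbf k''))]|}\le\gamma$$ (the quotient being $+\infty$ if its denominator is $0$). $\{g_N\}_{N\ge1}$ is uniformly $\gamma$-admissible on $\{\Xi_{\Omega,N}\}_{N\ge1}$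 if every $g_N$ is $\gamma$-admissible on $\Xi_{\Omega,N}$ w.r.t. level $N$ and $\sup_{N\ge1}\sup_{(\mathbf k,\mathbf k',\mathbf k'')\in\Xi_{\Omega,N}}\{|g_N(2^{-N}\mathbf k)|,|g_N(2^{-N}\mathbf k')|,|g_N(2^{-N}\mathbf k'')|\}<\infty$. **Reconstructed samples.** For $\mathbf k\in\Lambda_{\Omega,N}$ with triple $(\mathbf k,\mathbf k',\mathbf k'')\in\Xi_{\Omega,N}$, put $I_{N,\mathbf m}=|f(2^{-N}\mathbf m)+g_N(2^{-N}\mathbf m)|^2$ for $\mathbf m\in\{\mathbf k,\mathbf k',\mathbf k''\}$, $c+\mathbf i\,\delta=g_N(2^{-N}\mathbf k)-g_N(2^{-N}\mathbf k')$, $h+\mathbf i\,e=g_N(2^{-N}\mathbf k)-g_N(2^{-N}\mathbf k'')$ with $c,\delta,h,e$ real, and $\mu=-\Im[(g_N(2^{-N}\mathbf k)-g_N(2^{-N}\mathbf k'))(\overline{g_N}(2^{-N}\mathbf k)-\overline{g_N}(2^{-N}\mathbf k''))]$ (nonzero by admissibility). Then $\mathring f(2^{-N}\mathbf k)=u+\mathbf i v$ where $$\begin{bmatrix} u \\ v \end{bmatrix}=\frac{1}{2\mu}\begin{bmatrix} e & -\delta \\ -h & c \end{bmatrix}\begin{bmatrix} I_{N,\mathbf k}-I_{N,\mathbf k'} \\ I_{N,\mathbf k}-I_{N,\mathbf k''} \end{bmatrix}.$$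
   Formalization: The formal theorem also assumes that Ω is Lebesgue measurable and lies, up to a null set, in the box ∏[L_{l,min}, L_{l,max}] spanned by its lattice points; without the box condition the estimate is false (e.g. Ω=[-0.9,0.9], f a bump supported in [0.5,0.8]). *)

theory Defs
  imports "HOL-Analysis.Analysis" "HOL-Library.Landau_Symbols" "HOL-Library.Nonpos_Ints"
begin

section \<open>Fourier transform and Sobolev spaces\<close>

text \<open>
  The integral formula is meaningful for integrable functions only (the Bochner integral of a
  non-integrable function is 0). Elements of a Sobolev space are merely square integrable, so
  their Fourier transform is the usual \<open>L\<^sup>2\<close> extension: the \<open>L\<^sup>2\<close> limit of the transforms of
  the truncations to balls.
\<close>

definition fourier :: "(real^'d \<Rightarrow> complex) \<Rightarrow> real^'d \<Rightarrow> complex" where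
  "fourier f \<xi> = (LINT x|lborel. f x * exp (- \<i> * of_real (x \<bullet> \<xi>)))"

definition square_integrable :: "(real^'d \<Rightarrow> complex) \<Rightarrow> bool" where
  "square_integrable f \<longleftrightarrow>
     f \<in> borel_measurable lborel \<and> integrable lborel (\<lambda>x. (norm (f x))\<^sup>2)"

definition is_L2_fourier :: "(real^'d \<Rightarrow> complex) \<Rightarrow> (real^'d \<Rightarrow> complex) \<Rightarrow> bool" where
  "is_L2_fourier f F \<longleftrightarrow> square_integrable F \<and>
     ((\<lambda>R. \<integral>\<^sup>+ \<xi>. ennreal ((norm (F \<xi> - fourier (\<lambda>x. indicator (ball 0 R) x *\<^sub>R f x) \<xi>))\<^sup>2) \<partial>lborel)
        \<longlongrightarrow> 0) at_top"

text \<open>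
  By Plancherel's theorem such an \<open>F\<close> exists for every square integrable \<open>f\<close>; it is unique up to
  a null set, so the choice below does not affect any integral formed with it.
\<close>

definition L2_fourier :: "(real^'d \<Rightarrow> complex) \<Rightarrow> real^'d \<Rightarrow> complex" where
  "L2_fourier f = (SOME F. is_L2_fourier f F)"

text \<open>
  Square integrability is automatic for exponents \<open>s \<ge> 0\<close>. Negative exponents only enter
  through the supremum \<open>nu2\<close>; a square integrable function satisfies the integrability condition
  for all of them, so \<open>nu2\<close> has its usual value on square integrable functions.
\<close>

definition in_sobolev :: "real \<Rightarrow> (real^'d \<Rightarrow> complex) \<Rightarrow> bool" where
  "in_sobolev s f \<longleftrightarrow> square_integrable f \<and>
     integrable lborel (\<lambda>\<xi>. (norm (L2_fourier f \<xi>))\<^sup>2 * (1 + (norm \<xi>)\<^sup>2) powr s)"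

definition sobolev_norm :: "real \<Rightarrow> (real^'d \<Rightarrow> complex) \<Rightarrow> real" where
  "sobolev_norm s f = (2 * pi) powr (- real CARD('d) / 2) *
     sqrt (LINT \<xi>|lborel. (norm (L2_fourier f \<xi>))\<^sup>2 * (1 + (norm \<xi>)\<^sup>2) powr s)"

definition nu2 :: "(real^'d \<Rightarrow> complex) \<Rightarrow> ereal" where
  "nu2 f = (SUP s\<in>{s. in_sobolev s f}. ereal s)"

definition L2_norm_on :: "(real^'d) set \<Rightarrow> (real^'d \<Rightarrow> complex) \<Rightarrow> real" where
  "L2_norm_on \<Omega> f = sqrt (set_lebesgue_integral lebesgue \<Omega> (\<lambda>x. (norm (f x))\<^sup>2))"


section \<open>Refinable functions\<close>

definition of_lattice :: "int^'d \<Rightarrow> real^'d" where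
  "of_lattice k = (\<chi> l. real_of_int (k $ l))"

text \<open>
  Used only for integrable \<open>\<phi>\<close> (continuous with compact support), for which \<open>fourier \<phi>\<close> is the
  classical transform, defined at every point.
\<close>

definition refinable :: "(real^'d \<Rightarrow> complex) \<Rightarrow> (real^'d \<Rightarrow> complex) \<Rightarrow> bool" where
  "refinable ahat \<phi> \<longleftrightarrow>
     (\<forall>\<xi> k. ahat (\<xi> + (2 * pi) *\<^sub>R of_lattice k) = ahat \<xi>) \<and>
     (\<forall>\<xi>. fourier \<phi> (2 *\<^sub>R \<xi>) = ahat \<xi> * fourier \<phi> \<xi>) \<and>
     fourier \<phi> 0 = 1"

text \<open>\<open>of_lattice k / 2\<close> represents the zero coset iff all components of \<open>k\<close> are even.\<close>

definition has_sum_rules :: "nat \<Rightarrow> (real^'d \<Rightarrow> complex) \<Rightarrow> bool" where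
  "has_sum_rules m ahat \<longleftrightarrow>
     (\<forall>\<gamma>'. \<gamma>' \<in> range (\<lambda>k. (1/2) *\<^sub>R of_lattice k) - range of_lattice \<longrightarrow>
        (\<lambda>\<xi>. norm (ahat (\<xi> + (2 * pi) *\<^sub>R \<gamma>'))) \<in> O[at 0](\<lambda>\<xi>. norm \<xi> ^ m))"


section \<open>Index sets\<close>

definition lattice_points :: "(real^'d) set \<Rightarrow> (int^'d) set" where
  "lattice_points \<Omega> = {k. of_lattice k \<in> \<Omega>}"

definition L_min :: "(real^'d) set \<Rightarrow> 'd \<Rightarrow> int" where
  "L_min \<Omega> l = Min ((\<lambda>k. k $ l) ` lattice_points \<Omega>)"

definition L_max :: "(real^'d) set \<Rightarrow> 'd \<Rightarrow> int" where
  "L_max \<Omega> l = Max ((\<lambda>k. k $ l) ` lattice_points \<Omega>)"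

text \<open>
  \<open>Lam M \<Omega> N\<close> below contains all shifts \<open>k\<close> for which \<open>\<phi> (2 ^ N *\<^sub>R x - of_lattice k)\<close> is nonzero
  for some \<open>x\<close> in this box. Points of \<open>\<Omega>\<close> outside the box (for instance \<open>\<Omega> = [-0.9, 0.9]\<close>, with
  box \<open>{0}\<close>) are not covered by these shifts, whatever the level \<open>N\<close>, so an approximation on
  \<open>\<Omega>\<close> needs \<open>\<Omega>\<close> to lie in the box up to a null set.
\<close>

definition lattice_box :: "(real^'d) set \<Rightarrow> (real^'d) set" where
  "lattice_box \<Omega> = {x. \<forall>l. real_of_int (L_min \<Omega> l) \<le> x $ l \<and> x $ l \<le> real_of_int (L_max \<Omega> l)}"

definition Lam :: "real^'d \<Rightarrow> (real^'d) set \<Rightarrow> nat \<Rightarrow> (int^'d) set" where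
  "Lam M \<Omega> N = {k. \<forall>l. 2 ^ N * real_of_int (L_min \<Omega> l) - M $ l \<le> real_of_int (k $ l) \<and>
                        real_of_int (k $ l) \<le> 2 ^ N * real_of_int (L_max \<Omega> l)}"

type_synonym 'd triple = "(int^'d) \<times> (int^'d) \<times> (int^'d)"

definition triple_at :: "'d \<Rightarrow> int^'d \<Rightarrow> 'd triple" where
  "triple_at j k = (k, k + axis j 1, k - axis j 1)"

definition Xi :: "real^'d \<Rightarrow> 'd \<Rightarrow> (real^'d) set \<Rightarrow> nat \<Rightarrow> 'd triple set" where
  "Xi M j \<Omega> N = triple_at j ` Lam M \<Omega> N"


section \<open>Plane waves and admissibility\<close>

definition grid_point :: "nat \<Rightarrow> int^'d \<Rightarrow> real^'d" where
  "grid_point N k = (1 / 2 ^ N) *\<^sub>R of_lattice k"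

definition plane_wave :: "(real^'d \<Rightarrow> complex) \<Rightarrow> bool" where
  "plane_wave g \<longleftrightarrow> (\<exists>a>0. \<exists>K. \<forall>x. g x = complex_of_real a * exp (\<i> * of_real (K \<bullet> x)))"

definition adm_quotient :: "(real^'d \<Rightarrow> complex) \<Rightarrow> nat \<Rightarrow> 'd triple \<Rightarrow> ereal" where
  "adm_quotient g N = (\<lambda>(k, k', k'').
     let p  = g (grid_point N k) - g (grid_point N k');
         q  = cnj (g (grid_point N k)) - cnj (g (grid_point N k''))
     in if \<bar>Im (p * q)\<bar> = 0 then \<infinity>
        else ereal (max (norm p) (norm q) / \<bar>Im (p * q)\<bar>))"

definition admissible :: "real \<Rightarrow> (real^'d \<Rightarrow> complex) \<Rightarrow> nat \<Rightarrow> 'd triple set \<Rightarrow> bool" where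
  "admissible \<gamma> g N T \<longleftrightarrow> 0 < \<gamma> \<and>
     (\<forall>(k, k', k'')\<in>T. g (grid_point N k) \<noteq> g (grid_point N k') \<and>
                        g (grid_point N k) \<noteq> g (grid_point N k'')) \<and>
     (SUP t\<in>T. adm_quotient g N t) \<le> ereal \<gamma>"

definition uniformly_admissible ::
    "real \<Rightarrow> (nat \<Rightarrow> real^'d \<Rightarrow> complex) \<Rightarrow> (nat \<Rightarrow> 'd triple set) \<Rightarrow> bool" where
  "uniformly_admissible \<gamma> g T \<longleftrightarrow>
     (\<forall>N\<ge>1. admissible \<gamma> (g N) N (T N)) \<and>
     bdd_above (\<Union>N\<in>{1..}. \<Union>(k, k', k'')\<in>T N.
       {norm (g N (grid_point N k)), norm (g N (grid_point N k')), norm (g N (grid_point N k''))})"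


section \<open>Reconstruction from intensities\<close>

definition intensity :: "(real^'d \<Rightarrow> complex) \<Rightarrow> (real^'d \<Rightarrow> complex) \<Rightarrow> nat \<Rightarrow> int^'d \<Rightarrow> real" where
  "intensity f g N m = (norm (f (grid_point N m) + g (grid_point N m)))\<^sup>2"

text \<open>The two components of the \<open>2 \<times> 2\<close> matrix-vector product are written out.\<close>

definition reconstruct ::
    "(real^'d \<Rightarrow> complex) \<Rightarrow> (real^'d \<Rightarrow> complex) \<Rightarrow> nat \<Rightarrow> 'd triple \<Rightarrow> complex" where
  "reconstruct f g N = (\<lambda>(k, k', k'').
     let p  = g (grid_point N k) - g (grid_point N k');
         r  = g (grid_point N k) - g (grid_point N k'');
         c = Re p; \<delta> = Im p; h = Re r; e = Im r;
         \<mu> = - Im (p * cnj r);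
         D' = intensity f g N k - intensity f g N k';
         D'' = intensity f g N k - intensity f g N k''
     in Complex ((e * D' - \<delta> * D'') / (2 * \<mu>)) ((- h * D' + c * D'') / (2 * \<mu>)))"

end

theory Submission
  imports Defs "HOL-Probability.Characteristic_Functions" "HOL-Real_Asymp.Real_Asymp"
begin

text \<open>
  The Fourier inversion formula and the Cauchy-Schwarz inequality against the integrable weight
  \<open>(1 + \<bar>\<xi>\<bar>\<^sup>2) powr (- s)\<close>, \<open>s > d / 2\<close>, bound the supremum of \<open>f\<close> and its Hoelder seminorm of
  exponent \<open>\<zeta> = min 1 (\<sigma> - s)\<close> by the Sobolev norm \<open>\<parallel>f\<parallel>\<close>. The sum rules make the Fourier transform
  of \<open>\<phi>\<close> vanish at \<open>2 \<pi> k\<close> for \<open>k \<noteq> 0\<close>, so the integer shifts of \<open>\<phi>\<close> form a partition of unity.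
  Hence on the lattice box the error at \<open>x\<close> is at most the largest error of the reconstructed
  samples at grid points within \<open>O(2\<^sup>-\<^sup>N)\<close> of \<open>x\<close>, plus the oscillation \<open>O(\<parallel>f\<parallel> 2 powr (- N \<zeta>))\<close>
  of \<open>f\<close> at this scale. The former is \<open>O(\<gamma> \<parallel>f\<parallel> (\<parallel>f\<parallel> + a) 2 powr (- N \<zeta>))\<close>, where \<open>a\<close> is the
  modulus of the plane wave. The latter is of the same size, because admissibility forces
  \<open>2 \<gamma> a \<ge> 1\<close>; so the whole error fits into the second term of the bound, and no higher
  approximation order of \<open>\<phi>\<close> is needed for the first.
\<close>

section \<open>Gaussian kernels\<close>

text \<open>The transform of a Sobolev function is only a chosen \<open>L\<^sup>2\<close> limit of
  transforms of truncations, so inversion cannot be read off an integral. Gaussians give access to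
  it: their transforms are explicit, and Fubini moves a transform from one factor of a product to
  the other. The inequality half of Plancherel's theorem then suffices for the existence of the
  limit. Inversion takes two limits in a fixed order: first the truncation radius tends to infinity
  at a fixed Gaussian width, where \<open>L\<^sup>2\<close> convergence is enough, then the width
  tends to 0, where integrability of the transform and continuity of \<open>f\<close> enter.

  For the partition of unity the obstacle is that Fourier coefficients determine a periodic function
  pointwise only through some summation argument. The periodised function minus 1 is therefore
  integrated against powers of a nonnegative trigonometric polynomial equal to 1 only on the
  lattice. All these integrals vanish, while the powers concentrate at 0 and so detect the value
  there.\<close>

lemma Basis_vec_eq_range: "(Basis :: (real^'d) set) = range (\<lambda>l. axis l 1)"
  by (auto simp: Basis_vec_def)

text \<open>Fubini for products of one-variable functions. Lebesgue measure on
  \<open>real^'d\<close> is the image of a product measure indexed by \<open>Basis\<close>, not by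
  \<open>'d\<close>, so the factors are reindexed through \<open>axis_index\<close>.\<close>

lemma
  fixes h :: "'d::finite \<Rightarrow> real \<Rightarrow> 'a::{real_normed_field,banach,second_countable_topology}"
  assumes h: "\<And>l. integrable lborel (h l)"
  shows integrable_prod_components: "integrable lborel (\<lambda>x::real^'d. \<Prod>l\<in>UNIV. h l (x $ l))"
    and integral_prod_components:
      "(LINT x|lborel. (\<Prod>l\<in>UNIV. h l ((x::real^'d) $ l))) = (\<Prod>l\<in>UNIV. (LINT t|lborel. h l t))"
proof -
  interpret product_sigma_finite "\<lambda>_::real^'d. lborel :: real measure" ..
  let ?H = "\<lambda>b::real^'d. h (axis_index b)"
  let ?T = "\<lambda>f. \<Sum>b\<in>Basis. f b *\<^sub>R (b::real^'d)"
  have inj: "inj (\<lambda>l::'d. axis l (1::real))"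
    by (auto simp: inj_on_def axis_eq_axis)
  have prod_eq: "(\<Prod>l\<in>UNIV. F (axis l (1::real)) l) = (\<Prod>b\<in>Basis. F b (axis_index b))"
    for F :: "real^'d \<Rightarrow> 'd \<Rightarrow> 'a"
    unfolding Basis_vec_eq_range by (subst prod.reindex[OF inj]) simp
  have eq: "(\<Prod>l\<in>UNIV. h l (x $ l)) = (\<Prod>b\<in>Basis. ?H b (x \<bullet> b))" for x :: "real^'d"
    using prod_eq[of "\<lambda>b l. h l (x \<bullet> b)"] by (simp add: cart_eq_inner_axis)
  have meas [measurable]: "h l \<in> borel_measurable borel" for l
    using borel_measurable_integrable[OF h, of l] by simp
  have T: "?T \<in> measurable (Pi\<^sub>M Basis (\<lambda>_. lborel)) borel"
    by measurable
  have m: "(\<lambda>x::real^'d. \<Prod>b\<in>Basis. ?H b (x \<bullet> b)) \<in> borel_measurable borel"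
    by measurable
  have inner: "(\<Prod>b\<in>Basis. ?H b (?T f \<bullet> b)) = (\<Prod>b\<in>Basis. ?H b (f b))" for f :: "real^'d \<Rightarrow> real"
    by (rule prod.cong) (auto simp: inner_sum_left_Basis)
  have "integrable (Pi\<^sub>M Basis (\<lambda>_::real^'d. lborel)) (\<lambda>x. \<Prod>b\<in>Basis. ?H b (x b))"
    by (rule product_integrable_prod) (use h in auto)
  then show "integrable lborel (\<lambda>x::real^'d. \<Prod>l\<in>UNIV. h l (x $ l))"
    unfolding eq lborel_eq[where 'a="real^'d"] by (subst integrable_distr_eq[OF T m]) (simp add: inner)
  have "(LINT x|lborel. (\<Prod>l\<in>UNIV. h l ((x::real^'d) $ l))) =
      (LINT f|Pi\<^sub>M Basis (\<lambda>_::real^'d. lborel). (\<Prod>b\<in>Basis. ?H b (f b)))"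
    unfolding eq lborel_eq[where 'a="real^'d"] by (subst integral_distr[OF T m]) (simp add: inner)
  also have "\<dots> = (\<Prod>b\<in>Basis. (LINT t|lborel. ?H b t))"
    by (rule product_integral_prod) (use h in auto)
  also have "\<dots> = (\<Prod>l\<in>UNIV. (LINT t|lborel. h l t))"
    using prod_eq[of "\<lambda>b l. LINT t|lborel. h l t"] by simp
  finally show "(LINT x|lborel. (\<Prod>l\<in>UNIV. h l ((x::real^'d) $ l))) = (\<Prod>l\<in>UNIV. (LINT t|lborel. h l t))" .
qed

lemma
  fixes c :: "'a::euclidean_space" and f :: "'a \<Rightarrow> 'b::{banach,second_countable_topology}"
  shows integrable_lborel_shift: "integrable lborel f \<Longrightarrow> integrable lborel (\<lambda>x. f (c + x))"
    and integral_lborel_shift: "f \<in> borel_measurable borel \<Longrightarrow> (LINT x|lborel. f (c + x)) = (LINT x|lborel. f x)"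
proof -
  show "integrable lborel (\<lambda>x. f (c + x))" if "integrable lborel f"
  proof -
    have "integrable (distr lborel borel ((+) c)) f"
      using that by (simp add: lborel_distr_plus)
    then show ?thesis by (subst (asm) integrable_distr_eq) (use that in auto)
  qed
  show "(LINT x|lborel. f (c + x)) = (LINT x|lborel. f x)" if "f \<in> borel_measurable borel"
  proof -
    have "(LINT x|lborel. f x) = (LINT x|distr lborel borel ((+) c). f x)"
      by (simp add: lborel_distr_plus)
    also have "\<dots> = (LINT x|lborel. f (c + x))"
      by (rule integral_distr) (use that in auto)
    finally show ?thesis by simp
  qed
qed

definition gauss_kernel :: "real \<Rightarrow> real^'d \<Rightarrow> real" where
  "gauss_kernel \<tau> x = (\<Prod>l\<in>UNIV. normal_density 0 \<tau> (x $ l))"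

text \<open>The characteristic function of the density \<open>gauss_kernel \<tau>\<close>. As \<tau>
  tends to 0 the weight tends to 1 while the kernel becomes an approximate identity, so one
  parameter regularises both sides of the transform.\<close>

definition gauss_weight :: "real \<Rightarrow> real^'d \<Rightarrow> real" where
  "gauss_weight \<tau> \<xi> = exp (- (\<tau> * norm \<xi>)\<^sup>2 / 2)"

lemma gauss_weight_prod: "gauss_weight \<tau> \<xi> = (\<Prod>l\<in>UNIV. exp (- (\<tau> * \<xi> $ l)\<^sup>2 / 2))"
  by (simp add: gauss_weight_def norm_vec_def L2_set_def exp_sum[symmetric] power_mult_distrib
      sum_nonneg sum_distrib_left sum_negf sum_divide_distrib)

lemma gauss_kernel_nonneg [simp]: "gauss_kernel \<tau> x \<ge> 0"
  by (simp add: gauss_kernel_def prod_nonneg)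

lemma gauss_weight_pos [simp]: "gauss_weight \<tau> x > 0" "gauss_weight \<tau> x \<ge> 0"
  and gauss_weight_le_1: "gauss_weight \<tau> x \<le> 1"
  by (simp_all add: gauss_weight_def)

lemma borel_measurable_gauss_kernel [measurable]: "gauss_kernel \<tau> \<in> borel_measurable borel"
  unfolding gauss_kernel_def[abs_def] by measurable

lemma borel_measurable_gauss_weight [measurable]: "gauss_weight \<tau> \<in> borel_measurable borel"
  unfolding gauss_weight_def[abs_def] by measurable

lemma gauss_kernel_eq:
  assumes "\<tau> > 0"
  shows "gauss_kernel \<tau> (x::real^'d) = (1 / sqrt (2 * pi * \<tau>\<^sup>2)) ^ CARD('d) * exp (- (norm x)\<^sup>2 / (2 * \<tau>\<^sup>2))"
  by (simp add: gauss_kernel_def normal_density_def prod_dividef prod.distrib norm_vec_def L2_set_def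
      exp_sum[symmetric] sum_nonneg sum_divide_distrib sum_negf power_divide power_one_over)

lemma gauss_kernel_le:
  "\<tau> > 0 \<Longrightarrow> gauss_kernel \<tau> (x::real^'d) \<le> (1 / sqrt (2 * pi * \<tau>\<^sup>2)) ^ CARD('d)"
  by (subst gauss_kernel_eq) (auto intro!: mult_left_le)

lemma gauss_kernel_minus [simp]: "gauss_kernel \<tau> (- x) = gauss_kernel \<tau> x"
  by (simp add: gauss_kernel_def normal_density_def)

lemma gauss_kernel_diff_commute: "gauss_kernel \<tau> (x - y) = gauss_kernel \<tau> (y - x)"
  using gauss_kernel_minus[of \<tau> "x - y"] by simp

lemma
  assumes "\<tau> > 0"
  shows integrable_gauss_kernel: "integrable lborel (gauss_kernel \<tau> :: real^'d \<Rightarrow> real)"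
    and integral_gauss_kernel: "(LINT x|lborel. gauss_kernel \<tau> (x::real^'d)) = 1"
  unfolding gauss_kernel_def[abs_def]
  by (rule integrable_prod_components integral_prod_components[THEN trans];
      use assms in \<open>simp add: integrable_normal_density integral_normal_density\<close>)+

lemma
  fixes y :: "real^'d"
  assumes "\<tau> > 0"
  shows integrable_gauss_kernel_shift: "integrable lborel (\<lambda>x. gauss_kernel \<tau> (y - x))"
    and nn_integral_gauss_kernel_shift: "(\<integral>\<^sup>+x. gauss_kernel \<tau> (y - x) \<partial>lborel) = 1"
    and nn_integral_gauss_kernel_shift': "(\<integral>\<^sup>+x. gauss_kernel \<tau> (x - y) \<partial>lborel) = 1"
    and integral_gauss_kernel_shift: "(LINT x|lborel. gauss_kernel \<tau> (y - x)) = 1"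
proof -
  have eq: "gauss_kernel \<tau> (y - x) = gauss_kernel \<tau> (- y + x)" for x
    using gauss_kernel_diff_commute[of \<tau> y x] by (simp add: algebra_simps)
  show int: "integrable lborel (\<lambda>x. gauss_kernel \<tau> (y - x))"
    unfolding eq by (rule integrable_lborel_shift[OF integrable_gauss_kernel[OF assms]])
  show i1: "(LINT x|lborel. gauss_kernel \<tau> (y - x)) = 1"
    unfolding eq by (subst integral_lborel_shift) (auto simp: integral_gauss_kernel[OF assms])
  show n1: "(\<integral>\<^sup>+x. gauss_kernel \<tau> (y - x) \<partial>lborel) = 1"
    using nn_integral_eq_integral[OF int] i1 by simp
  then show "(\<integral>\<^sup>+x. gauss_kernel \<tau> (x - y) \<partial>lborel) = 1"
    by (subst gauss_kernel_diff_commute)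
qed

lemma integrable_gauss_exp_real:
  assumes "\<tau> > 0"
  shows "integrable lborel (\<lambda>t::real. of_real (exp (- (\<tau> * t)\<^sup>2 / 2)) * exp (\<i> * of_real (x * t)) :: complex)"
proof -
  have "integrable lborel (\<lambda>t. sqrt (2 * pi * (1 / \<tau>)\<^sup>2) * normal_density 0 (1 / \<tau>) t)"
    using integrable_normal_density[of "1/\<tau>" 0] assms by simp
  also have "(\<lambda>t. sqrt (2 * pi * (1 / \<tau>)\<^sup>2) * normal_density 0 (1 / \<tau>) t) = (\<lambda>t. exp (- (\<tau> * t)\<^sup>2 / 2))"
    using assms by (auto simp: normal_density_def field_simps)
  finally have "integrable lborel (\<lambda>t. exp (- (\<tau> * t)\<^sup>2 / 2))" .
  then show ?thesis
    by (rule Bochner_Integration.integrable_bound) (auto simp: norm_mult)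
qed

text \<open>The known characteristic function of the standard normal distribution, evaluated at
  \<open>x / \<tau>\<close> and rescaled by t -> \<tau> t: up to constants the Gaussian is its own
  transform.\<close>

lemma integral_gauss_exp_real:
  assumes "\<tau> > 0"
  shows "(LINT t|lborel. of_real (exp (- (\<tau> * t)\<^sup>2 / 2)) * exp (\<i> * of_real (x * t)) :: complex)
    = of_real (2 * pi * normal_density 0 \<tau> x)"
proof -
  let ?f = "\<lambda>t. std_normal_density t *\<^sub>R iexp (x / \<tau> * t)"
  have "complex_of_real (exp (- (x / \<tau>)\<^sup>2 / 2)) = char std_normal_distribution (x / \<tau>)"
    by (simp add: char_std_normal_distribution)
  also have "\<dots> = (LINT t|lborel. ?f t)"
    unfolding char_def by (subst integral_density) (auto simp: normal_density_nonneg)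
  also have "\<dots> = \<tau> *\<^sub>R (LINT t|lborel. ?f (0 + \<tau> * t))"
    using lborel_integral_real_affine[of \<tau> ?f 0] assms by simp
  also have "(\<lambda>t. ?f (0 + \<tau> * t)) =
      (\<lambda>t. of_real (1 / sqrt (2 * pi)) * (of_real (exp (- (\<tau> * t)\<^sup>2 / 2)) * exp (\<i> * of_real (x * t))))"
    using assms by (auto simp: std_normal_density_def scaleR_conv_of_real field_simps)
  also have "(LINT t|lborel. \<dots> t) = of_real (1 / sqrt (2 * pi)) *
      (LINT t|lborel. of_real (exp (- (\<tau> * t)\<^sup>2 / 2)) * exp (\<i> * of_real (x * t)))"
    by simp
  finally have *: "complex_of_real (exp (- (x / \<tau>)\<^sup>2 / 2)) = of_real (\<tau> / sqrt (2 * pi)) *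
      (LINT t|lborel. of_real (exp (- (\<tau> * t)\<^sup>2 / 2)) * exp (\<i> * of_real (x * t)))"
    by (simp add: scaleR_conv_of_real)
  have "2 * pi * normal_density 0 \<tau> x = sqrt (2 * pi) / \<tau> * exp (- (x / \<tau>)\<^sup>2 / 2)"
    using assms by (simp add: normal_density_def real_sqrt_mult field_simps)
  then show ?thesis
    unfolding of_real_mult[symmetric] 
    by (simp only: of_real_mult *) (use assms in simp)
qed

lemma
  fixes x :: "real^'d"
  assumes "\<tau> > 0"
  shows integrable_gauss_exp: "integrable lborel (\<lambda>\<xi>. of_real (gauss_weight \<tau> \<xi>) * exp (\<i> * of_real (x \<bullet> \<xi>)) :: complex)"
    and integral_gauss_exp: "(LINT \<xi>|lborel. of_real (gauss_weight \<tau> \<xi>) * exp (\<i> * of_real (x \<bullet> \<xi>)) :: complex)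
      = of_real ((2 * pi) ^ CARD('d) * gauss_kernel \<tau> x)"
proof -
  let ?h = "\<lambda>l t. of_real (exp (- (\<tau> * t)\<^sup>2 / 2)) * exp (\<i> * of_real (x $ l * t)) :: complex"
  have eq: "of_real (gauss_weight \<tau> \<xi>) * exp (\<i> * of_real (x \<bullet> \<xi>)) = (\<Prod>l\<in>UNIV. ?h l (\<xi> $ l))" for \<xi>
    by (simp add: gauss_weight_prod inner_vec_def prod.distrib exp_sum sum_distrib_left)
  show "integrable lborel (\<lambda>\<xi>. of_real (gauss_weight \<tau> \<xi>) * exp (\<i> * of_real (x \<bullet> \<xi>)) :: complex)"
    unfolding eq by (rule integrable_prod_components) (rule integrable_gauss_exp_real[OF assms])
  show "(LINT \<xi>|lborel. of_real (gauss_weight \<tau> \<xi>) * exp (\<i> * of_real (x \<bullet> \<xi>)) :: complex)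
      = of_real ((2 * pi) ^ CARD('d) * gauss_kernel \<tau> x)"
    unfolding eq
    by (subst integral_prod_components)
      (simp_all only: integrable_gauss_exp_real[OF assms] integral_gauss_exp_real[OF assms],
        simp add: prod.distrib gauss_kernel_def)
qed

lemma integrable_gauss_weight:
  assumes "\<tau> > 0"
  shows "integrable lborel (gauss_weight \<tau> :: real^'d \<Rightarrow> real)"
  using integrable_norm[OF integrable_gauss_exp[OF assms, of 0]] by simp

section \<open>The Plancherel inequality\<close>

text \<open>Modulation becomes translation. With y as the centre, the multiplication formula below
  turns an inversion integral into a Gaussian average around y.\<close>

lemma fourier_shift_weight:
  fixes y :: "real^'d"
  assumes "\<tau> > 0"
  shows "fourier (\<lambda>\<xi>. of_real (gauss_weight \<tau> \<xi>) * exp (\<i> * of_real (y \<bullet> \<xi>))) x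
    = of_real ((2 * pi) ^ CARD('d) * gauss_kernel \<tau> (y - x))"
proof -
  have "exp (\<i> * of_real (y \<bullet> \<xi>)) * exp (- \<i> * of_real (\<xi> \<bullet> x)) = exp (\<i> * of_real ((y - x) \<bullet> \<xi>))" for \<xi>
    by (simp add: exp_add[symmetric] algebra_simps inner_diff_left inner_commute)
  then show ?thesis
    unfolding fourier_def integral_gauss_exp[OF assms, symmetric] by (simp add: mult.assoc)
qed

lemma integrable_fourier_integrand:
  assumes "integrable lborel h"
  shows "integrable lborel (\<lambda>x. h x * exp (- \<i> * of_real (x \<bullet> \<xi>)))"
  by (rule Bochner_Integration.integrable_bound[OF assms]) (use assms in \<open>auto simp: norm_mult\<close>)

lemma borel_measurable_fourier [measurable]:
  assumes [measurable]: "h \<in> borel_measurable borel"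
  shows "fourier h \<in> borel_measurable borel"
  unfolding fourier_def[abs_def] by measurable

lemma borel_measurable_cnj [measurable]: "cnj \<in> borel_measurable borel"
  by (intro borel_measurable_continuous_onI continuous_intros)

lemma norm_fourier_le: "norm (fourier h \<xi>) \<le> (LINT x|lborel. norm (h x))"
  unfolding fourier_def by (rule order_trans[OF integral_norm_bound]) (simp add: norm_mult)

text \<open>Fubini together with the symmetry of the kernel
  \<open>exp (- \<i> * of_real (x \<bullet> \<xi>))\<close> in its two variables. Integrability of
  both factors makes the double integral absolutely convergent.\<close>

lemma fourier_mult_formula:
  fixes h u :: "real^'d \<Rightarrow> complex"
  assumes h: "integrable lborel h" and u: "integrable lborel u"
  shows "(LINT \<xi>|lborel. fourier h \<xi> * u \<xi>) = (LINT x|lborel. h x * fourier u x)"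
proof -
  have [measurable]: "h \<in> borel_measurable borel" "u \<in> borel_measurable borel"
    using h u by auto
  let ?k = "\<lambda>\<xi> x. h x * exp (- \<i> * of_real (x \<bullet> \<xi>)) * u \<xi>"
  have "integrable (lborel \<Otimes>\<^sub>M lborel) (\<lambda>(\<xi>, x). u \<xi> * h x)"
    using u h by (intro lborel_pair.Fubini_integrable) (auto simp: norm_mult)
  then have int: "integrable (lborel \<Otimes>\<^sub>M lborel) (\<lambda>(\<xi>, x). ?k \<xi> x)"
    by (rule Bochner_Integration.integrable_bound) (auto simp: norm_mult mult.commute)
  have "(LINT \<xi>|lborel. fourier h \<xi> * u \<xi>) = (LINT \<xi>|lborel. (LINT x|lborel. ?k \<xi> x))"
    by (simp add: fourier_def)
  also have "\<dots> = (LINT x|lborel. (LINT \<xi>|lborel. ?k \<xi> x))"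
    by (rule lborel_pair.Fubini_integral[OF int, symmetric])
  also have "\<dots> = (LINT x|lborel. h x * fourier u x)"
    unfolding fourier_def integral_mult_right_zero[symmetric]
    by (rule Bochner_Integration.integral_cong)
      (auto simp: inner_commute mult_ac intro!: Bochner_Integration.integral_cong)
  finally show ?thesis .
qed

lemma fourier_gauss_inversion:
  fixes h :: "real^'d \<Rightarrow> complex"
  assumes "integrable lborel h" "\<tau> > 0"
  shows "(LINT \<xi>|lborel. fourier h \<xi> * (of_real (gauss_weight \<tau> \<xi>) * exp (\<i> * of_real (y \<bullet> \<xi>))))
    = (2 * pi) ^ CARD('d) * (LINT x|lborel. h x * of_real (gauss_kernel \<tau> (y - x)))"
  unfolding fourier_mult_formula[OF assms(1) integrable_gauss_exp[OF assms(2)]]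
    fourier_shift_weight[OF assms(2)] of_real_mult mult.left_commute[of "h _"]
  by simp

lemma integrable_mult_gauss_kernel:
  fixes h :: "real^'d \<Rightarrow> complex"
  assumes h: "integrable lborel h" and \<tau>: "\<tau> > 0"
  shows "integrable lborel (\<lambda>x. h x * of_real (gauss_kernel \<tau> (y - x)))"
proof (rule Bochner_Integration.integrable_bound)
  let ?K = "(1 / sqrt (2 * pi * \<tau>\<^sup>2)) ^ CARD('d)"
  show "integrable lborel (\<lambda>x. norm (h x) * ?K)"
    by (intro integrable_mult_left integrable_norm h)
  have "norm (h x * of_real (gauss_kernel \<tau> (y - x))) \<le> norm (norm (h x) * ?K)" for x
    unfolding norm_mult[of "h x"] norm_of_real real_norm_def
    by (intro order_trans[OF mult_left_mono[OF _ norm_ge_zero] abs_ge_self])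
      (use gauss_kernel_le[OF \<tau>, of "y - x"] in simp)
  then show "AE x in lborel. norm (h x * of_real (gauss_kernel \<tau> (y - x))) \<le> norm (norm (h x) * ?K)"
    by blast
qed (use h in measurable)

text \<open>A Schur test: the product of the two norms is at most the mean of their squares, and the
  kernel has total mass 1 in either variable, so each half contributes half of the right-hand
  side.\<close>

lemma norm_gauss_convolution_pairing_le:
  fixes h :: "real^'d \<Rightarrow> complex"
  assumes \<tau>: "\<tau> > 0" and [measurable]: "h \<in> borel_measurable borel"
  shows "(\<integral>\<^sup>+y. \<integral>\<^sup>+x. ennreal (norm (h y) * norm (h x) * gauss_kernel \<tau> (y - x)) \<partial>lborel \<partial>lborel)
    \<le> (\<integral>\<^sup>+x. ennreal ((norm (h x))\<^sup>2) \<partial>lborel)"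
proof -
  let ?a = "\<lambda>x. ennreal ((norm (h x))\<^sup>2)" and ?k = "\<lambda>x y. ennreal (gauss_kernel \<tau> (y - x))"
  have "norm (h y) * norm (h x) * k \<le> ((norm (h y))\<^sup>2 * k + (norm (h x))\<^sup>2 * k) / 2" if "k \<ge> 0" for k x y
  proof -
    have "2 * (norm (h y) * norm (h x)) * k \<le> ((norm (h y))\<^sup>2 + (norm (h x))\<^sup>2) * k"
      using sum_squares_bound[of "norm (h y)" "norm (h x)"] that by (intro mult_right_mono) auto
    then show ?thesis by (simp add: algebra_simps)
  qed
  then have *: "ennreal (norm (h y) * norm (h x) * gauss_kernel \<tau> (y - x)) \<le> (?a y * ?k x y + ?a x * ?k x y) / 2" for x y
    by (simp add: ennreal_mult[symmetric] ennreal_plus[symmetric] ennreal_divide_numeral ennreal_leI del: ennreal_plus)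
  have "(\<integral>\<^sup>+y. \<integral>\<^sup>+x. ?a y * ?k x y \<partial>lborel \<partial>lborel) = (\<integral>\<^sup>+y. ?a y \<partial>lborel)"
    by (simp add: nn_integral_cmult nn_integral_gauss_kernel_shift[OF \<tau>])
  moreover have "(\<integral>\<^sup>+y. \<integral>\<^sup>+x. ?a x * ?k x y \<partial>lborel \<partial>lborel) = (\<integral>\<^sup>+x. \<integral>\<^sup>+y. ?a x * ?k x y \<partial>lborel \<partial>lborel)"
    by (rule lborel_pair.Fubini') measurable
  then have "(\<integral>\<^sup>+y. \<integral>\<^sup>+x. ?a x * ?k x y \<partial>lborel \<partial>lborel) = (\<integral>\<^sup>+y. ?a y \<partial>lborel)"
    by (simp add: nn_integral_cmult nn_integral_gauss_kernel_shift'[OF \<tau>])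
  ultimately have "(\<integral>\<^sup>+y. \<integral>\<^sup>+x. (?a y * ?k x y + ?a x * ?k x y) / 2 \<partial>lborel \<partial>lborel)
      = ((\<integral>\<^sup>+y. ?a y \<partial>lborel) + (\<integral>\<^sup>+y. ?a y \<partial>lborel)) / 2"
    by (simp add: nn_integral_divide nn_integral_add)
  also have "\<dots> = (\<integral>\<^sup>+y. ?a y \<partial>lborel)"
    by (simp add: mult_2[symmetric] ennreal_mult_divide_eq mult.commute[of 2])
  finally show ?thesis
    by (intro order_trans[OF nn_integral_mono[OF nn_integral_mono[OF *]]]) auto
qed

text \<open>Writing the squared norm as \<open>fourier h\<close> times its conjugate and absorbing
  the weight into the conjugate factor \<open>?u\<close>, the multiplication formula replaces the
  integral by one of \<open>h\<close> times \<open>fourier ?u\<close>. The latter is, up to a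
  constant, the conjugate of the Gaussian smoothing of \<open>h\<close>, and the preceding lemma
  applies.\<close>

lemma plancherel_gauss_le:
  fixes h :: "real^'d \<Rightarrow> complex"
  assumes h: "integrable lborel h" and \<tau>: "\<tau> > 0"
  shows "(\<integral>\<^sup>+\<xi>. ennreal ((norm (fourier h \<xi>))\<^sup>2 * gauss_weight \<tau> \<xi>) \<partial>lborel)
    \<le> ennreal ((2 * pi) ^ CARD('d)) * (\<integral>\<^sup>+x. ennreal ((norm (h x))\<^sup>2) \<partial>lborel)"
proof -
  have [measurable]: "h \<in> borel_measurable borel" using h by auto
  let ?B = "LINT x|lborel. norm (h x)"
  let ?u = "\<lambda>\<xi>. cnj (fourier h \<xi>) * of_real (gauss_weight \<tau> \<xi>)"
  have gw: "integrable lborel (\<lambda>\<xi>::real^'d. c * gauss_weight \<tau> \<xi>)" for c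
    by (intro integrable_mult_right integrable_gauss_weight \<tau>)
  have u: "integrable lborel ?u"
    by (rule Bochner_Integration.integrable_bound[OF gw[of ?B]])
      (auto simp: norm_mult intro!: mult_right_mono order_trans[OF norm_fourier_le] abs_ge_self)
  have "(norm (fourier h \<xi>))\<^sup>2 \<le> ?B\<^sup>2" for \<xi>
    by (intro power_mono norm_fourier_le) auto
  then have int: "integrable lborel (\<lambda>\<xi>. (norm (fourier h \<xi>))\<^sup>2 * gauss_weight \<tau> \<xi>)"
    by (intro Bochner_Integration.integrable_bound[OF gw[of "?B\<^sup>2"]]) (auto intro!: mult_right_mono)
  have fu: "fourier ?u y = (2 * pi) ^ CARD('d) * cnj (LINT x|lborel. h x * of_real (gauss_kernel \<tau> (y - x)))" for y
  proof -
    let ?w = "\<lambda>\<xi>. fourier h \<xi> * (of_real (gauss_weight \<tau> \<xi>) * exp (\<i> * of_real (y \<bullet> \<xi>)))"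
    have "fourier ?u y = (LINT \<xi>|lborel. cnj (?w \<xi>))"
      unfolding fourier_def[of ?u]
      by (rule Bochner_Integration.integral_cong) (auto simp: exp_cnj inner_commute mult_ac)
    also have "\<dots> = cnj (LINT \<xi>|lborel. ?w \<xi>)"
      by (rule Bochner_Integration.integral_cnj)
    finally have "fourier ?u y = cnj (LINT \<xi>|lborel. ?w \<xi>)" .
    then show ?thesis
      by (simp add: fourier_gauss_inversion[OF h \<tau>])
  qed
  let ?I = "LINT \<xi>|lborel. (norm (fourier h \<xi>))\<^sup>2 * gauss_weight \<tau> \<xi>"
  have I0: "?I \<ge> 0" by (simp add: integral_nonneg_AE)
  have "complex_of_real ?I = (LINT \<xi>|lborel. fourier h \<xi> * ?u \<xi>)"
    unfolding integral_complex_of_real[symmetric]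
    by (rule Bochner_Integration.integral_cong) (simp_all only: of_real_mult complex_norm_square mult.assoc)
  also have "\<dots> = (LINT y|lborel. h y * fourier ?u y)"
    by (rule fourier_mult_formula[OF h u])
  finally have J: "complex_of_real ?I = (LINT y|lborel. h y * fourier ?u y)" .
  have "ennreal ?I = ennreal (norm (LINT y|lborel. h y * fourier ?u y))"
    unfolding J[symmetric] by (simp only: norm_of_real abs_of_nonneg[OF I0])
  also have "\<dots> \<le> (\<integral>\<^sup>+y. norm (h y * fourier ?u y) \<partial>lborel)"
  proof (rule integral_norm_bound_ennreal, rule Bochner_Integration.integrable_bound)
    let ?U = "LINT x|lborel. norm (?u x)"
    show "integrable lborel (\<lambda>y. norm (h y) * ?U)"
      by (intro integrable_mult_left integrable_norm h)
    have "norm (h y * fourier ?u y) \<le> norm (norm (h y) * ?U)" for y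
      unfolding norm_mult[of "h y"] real_norm_def
      by (intro order_trans[OF mult_left_mono[OF norm_fourier_le] abs_ge_self]) auto
    then show "AE y in lborel. norm (h y * fourier ?u y) \<le> norm (norm (h y) * ?U)"
      by blast
  qed measurable
  also have "\<dots> \<le> (\<integral>\<^sup>+y. ennreal ((2 * pi) ^ CARD('d)) *
      (\<integral>\<^sup>+x. ennreal (norm (h y) * norm (h x) * gauss_kernel \<tau> (y - x)) \<partial>lborel) \<partial>lborel)"
  proof (rule nn_integral_mono)
    fix y
    have [simp]: "integrable lborel (\<lambda>x. h x * of_real (gauss_kernel \<tau> (y - x)))"
      by (rule integrable_mult_gauss_kernel[OF h \<tau>])
    have "ennreal (norm (h y * fourier ?u y)) = ennreal ((2 * pi) ^ CARD('d)) * (ennreal (norm (h y)) *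
         ennreal (norm (LINT x|lborel. h x * of_real (gauss_kernel \<tau> (y - x)))))"
      by (simp add: fu norm_mult ennreal_mult[symmetric] norm_power mult_ac)
    also have "\<dots> \<le> ennreal ((2 * pi) ^ CARD('d)) * (ennreal (norm (h y)) *
         (\<integral>\<^sup>+x. ennreal (norm (h x * of_real (gauss_kernel \<tau> (y - x)))) \<partial>lborel))"
      by (intro mult_left_mono integral_norm_bound_ennreal) auto
    also have "\<dots> = ennreal ((2 * pi) ^ CARD('d)) *
      (\<integral>\<^sup>+x. ennreal (norm (h y) * norm (h x) * gauss_kernel \<tau> (y - x)) \<partial>lborel)"
      by (simp add: nn_integral_cmult[symmetric] ennreal_mult[symmetric] norm_mult mult.assoc)
    finally show "ennreal (norm (h y * fourier ?u y)) \<le> \<dots>" .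
  qed
  also have "\<dots> = ennreal ((2 * pi) ^ CARD('d)) *
      (\<integral>\<^sup>+y. \<integral>\<^sup>+x. ennreal (norm (h y) * norm (h x) * gauss_kernel \<tau> (y - x)) \<partial>lborel \<partial>lborel)"
    by (rule nn_integral_cmult) measurable
  also have "\<dots> \<le> ennreal ((2 * pi) ^ CARD('d)) * (\<integral>\<^sup>+x. ennreal ((norm (h x))\<^sup>2) \<partial>lborel)"
    by (intro mult_left_mono norm_gauss_convolution_pairing_le[OF \<tau>]) auto
  finally show ?thesis
    using nn_integral_eq_integral[OF int] by simp
qed

lemma tendsto_gauss_weight: "(\<lambda>n. gauss_weight (1 / real (Suc n)) \<xi>) \<longlonglongrightarrow> 1"
proof -
  have "(\<lambda>n. exp (- (1 / real (Suc n) * norm \<xi>)\<^sup>2 / 2)) \<longlonglongrightarrow> exp (- (0 * norm \<xi>)\<^sup>2 / 2)"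
    by (intro tendsto_intros LIMSEQ_Suc[OF lim_1_over_n]) auto
  then show ?thesis by (simp add: gauss_weight_def)
qed

text \<open>The Gaussian bound does not depend on \<tau>, so Fatou's lemma carries it to \<tau> ->
  0.\<close>

lemma plancherel_le:
  fixes h :: "real^'d \<Rightarrow> complex"
  assumes h: "integrable lborel h"
  shows "(\<integral>\<^sup>+\<xi>. ennreal ((norm (fourier h \<xi>))\<^sup>2) \<partial>lborel)
    \<le> ennreal ((2 * pi) ^ CARD('d)) * (\<integral>\<^sup>+x. ennreal ((norm (h x))\<^sup>2) \<partial>lborel)"
proof -
  have [measurable]: "h \<in> borel_measurable borel" using h by auto
  let ?w = "\<lambda>n \<xi>. ennreal ((norm (fourier h \<xi>))\<^sup>2 * gauss_weight (1 / real (Suc n)) \<xi>)"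
  have "(\<lambda>n. ?w n \<xi>) \<longlonglongrightarrow> ennreal ((norm (fourier h \<xi>))\<^sup>2 * 1)" for \<xi>
    by (intro tendsto_ennrealI tendsto_mult tendsto_const tendsto_gauss_weight)
  then have "(\<integral>\<^sup>+\<xi>. ennreal ((norm (fourier h \<xi>))\<^sup>2) \<partial>lborel) = (\<integral>\<^sup>+\<xi>. liminf (\<lambda>n. ?w n \<xi>) \<partial>lborel)"
    by (intro nn_integral_cong) (metis lim_imp_Liminf mult.right_neutral sequentially_bot)
  also have "\<dots> \<le> liminf (\<lambda>n. \<integral>\<^sup>+\<xi>. ?w n \<xi> \<partial>lborel)"
    by (rule nn_integral_liminf) measurable
  also have "\<dots> \<le> liminf (\<lambda>n::nat. ennreal ((2 * pi) ^ CARD('d)) * (\<integral>\<^sup>+x. ennreal ((norm (h x))\<^sup>2) \<partial>lborel))"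
    by (intro Liminf_mono always_eventually allI plancherel_gauss_le[OF h]) simp
  also have "\<dots> = ennreal ((2 * pi) ^ CARD('d)) * (\<integral>\<^sup>+x. ennreal ((norm (h x))\<^sup>2) \<partial>lborel)"
    by (rule Liminf_const) simp
  finally show ?thesis .
qed

section \<open>Existence of the \<open>L\<^sup>2\<close> Fourier transform\<close>

text \<open>The squared increments have integrals at most \<open>(1/4) ^ n\<close>, so they stay
  summable after multiplication by \<open>2 ^ n\<close>. Almost everywhere this series has a finite
  sum C, which forces the n-th increment below \<open>sqrt C * (1 / sqrt 2) ^ n\<close>, a geometric
  bound.\<close>

lemma AE_convergent_of_rapid_L2:
  fixes F :: "nat \<Rightarrow> 'a \<Rightarrow> complex"
  assumes [measurable]: "\<And>n. F n \<in> borel_measurable M"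
    and rapid: "\<And>n. (\<integral>\<^sup>+x. ennreal ((norm (F (Suc n) x - F n x))\<^sup>2) \<partial>M) \<le> ennreal ((1/4) ^ n)"
  shows "AE x in M. convergent (\<lambda>n. F n x)"
proof -
  let ?\<Delta> = "\<lambda>n x. norm (F (Suc n) x - F n x)"
  have "(\<integral>\<^sup>+x. (\<Sum>n. ennreal (2 ^ n * (?\<Delta> n x)\<^sup>2)) \<partial>M) = (\<Sum>n. \<integral>\<^sup>+x. ennreal (2 ^ n * (?\<Delta> n x)\<^sup>2) \<partial>M)"
    by (rule nn_integral_suminf) measurable
  also have "\<dots> \<le> (\<Sum>n. ennreal ((1/2) ^ n))"
  proof (rule suminf_le)
    fix n
    have "(\<integral>\<^sup>+x. ennreal (2 ^ n * (?\<Delta> n x)\<^sup>2) \<partial>M) = ennreal (2 ^ n) * (\<integral>\<^sup>+x. ennreal ((?\<Delta> n x)\<^sup>2) \<partial>M)"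
      by (subst nn_integral_cmult[symmetric]) (auto simp: ennreal_mult)
    also have "\<dots> \<le> ennreal (2 ^ n) * ennreal ((1/4) ^ n)"
      by (intro mult_left_mono rapid) auto
    also have "\<dots> = ennreal ((1/2) ^ n)"
      by (simp add: ennreal_mult[symmetric] power_mult_distrib[symmetric])
    finally show "(\<integral>\<^sup>+x. ennreal (2 ^ n * (?\<Delta> n x)\<^sup>2) \<partial>M) \<le> ennreal ((1/2) ^ n)" .
  qed auto
  also have "\<dots> < \<infinity>"
    by (subst suminf_ennreal2) (auto intro!: summable_geometric)
  finally have "AE x in M. (\<Sum>n. ennreal (2 ^ n * (?\<Delta> n x)\<^sup>2)) \<noteq> \<infinity>"
    by (intro nn_integral_PInf_AE) auto
  then show ?thesis
  proof (rule AE_mp, intro AE_I2 impI)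
    fix x assume fin: "(\<Sum>n. ennreal (2 ^ n * (?\<Delta> n x)\<^sup>2)) \<noteq> \<infinity>"
    define q where "q n = ennreal (2 ^ n * (?\<Delta> n x)\<^sup>2)" for n
    obtain C where C: "C \<ge> 0" "(\<Sum>n. q n) = ennreal C"
      using fin unfolding q_def[symmetric] by (cases "\<Sum>n. q n") auto
    have "?\<Delta> n x \<le> sqrt C * (1 / sqrt 2) ^ n" for n
    proof -
      have "q n \<le> ennreal C"
        using sum_le_suminf[of q "{n}"] C by simp
      then have "ennreal (2 ^ n * (?\<Delta> n x)\<^sup>2) \<le> ennreal C"
        by (simp only: q_def)
      then have "2 ^ n * (?\<Delta> n x)\<^sup>2 \<le> C" by (simp only: ennreal_le_iff[OF C(1)])
      then have "sqrt (2 ^ n * (?\<Delta> n x)\<^sup>2) \<le> sqrt C" by simp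
      then show ?thesis by (simp add: real_sqrt_mult real_sqrt_power power_one_over field_simps)
    qed
    then have "summable (\<lambda>n. F (Suc n) x - F n x)"
      by (intro summable_comparison_test'[OF summable_mult[OF summable_geometric[of "1 / sqrt 2"]], of 0]) auto
    moreover have "(\<Sum>i<n. F (Suc i) x - F i x) = F n x - F 0 x" for n
      by (rule sum_lessThan_telescope)
    ultimately show "convergent (\<lambda>n. F n x)"
      using convergent_add[OF _ convergent_const[of "F 0 x"], of "\<lambda>n. F n x - F 0 x"]
      by (simp add: summable_iff_convergent)
  qed
qed

lemma le_one_plus_square: "(a::real) \<le> 1 + a\<^sup>2"
  using zero_le_power2[of "a - 1/2"] by (simp add: power2_eq_square algebra_simps)

lemma square_integrable_truncation:
  assumes "square_integrable f"
  shows "integrable lborel (\<lambda>x. indicator (ball 0 R) x *\<^sub>R f x)"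
proof (rule Bochner_Integration.integrable_bound)
  have [measurable]: "f \<in> borel_measurable borel" using assms by (simp add: square_integrable_def)
  show "integrable lborel (\<lambda>x. indicator (ball 0 R) x + (norm (f x))\<^sup>2)"
    using assms by (intro Bochner_Integration.integrable_add integrable_real_indicator)
      (auto simp: square_integrable_def intro: emeasure_bounded_finite[unfolded infinity_ennreal_def])
  have "norm (f x) \<le> 1 + (norm (f x))\<^sup>2" for x
    by (rule le_one_plus_square)
  then show "AE x in lborel. norm (indicator (ball 0 R) x *\<^sub>R f x) \<le> norm (indicator (ball 0 R) x + (norm (f x))\<^sup>2)"
    by (auto simp: indicator_def)
  show "(\<lambda>x. indicator (ball 0 R) x *\<^sub>R f x) \<in> borel_measurable lborel"
    by (intro borel_measurable_scaleR borel_measurable_indicator) simp_all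
qed

lemma fourier_diff:
  assumes "integrable lborel h" "integrable lborel u"
  shows "fourier (\<lambda>x. h x - u x) \<xi> = fourier h \<xi> - fourier u \<xi>"
  unfolding fourier_def left_diff_distrib
  by (rule Bochner_Integration.integral_diff) (intro integrable_fourier_integrand assms)+

text \<open>\<open>L2_fourier\<close> is defined by choice, so a witness must be produced. This is
  the Riesz-Fischer argument: by Plancherel the transforms of truncations differ by at most the mass
  \<open>tail\<close> outside the smaller ball, a fast sequence of radii converges almost
  everywhere, and Fatou's lemma extends the error bound to every radius.\<close>

theorem is_L2_fourier_L2_fourier:
  fixes f :: "real^'d \<Rightarrow> complex"
  assumes f: "square_integrable f"
  shows "is_L2_fourier f (L2_fourier f)"
proof -
  have [measurable]: "f \<in> borel_measurable borel" and f2: "integrable lborel (\<lambda>x. (norm (f x))\<^sup>2)"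
    using f by (auto simp: square_integrable_def)
  define tr where "tr R x = indicator (ball 0 R) x *\<^sub>R f x" for R x
  have tr: "integrable lborel (tr R)" for R
    unfolding tr_def[abs_def] by (rule square_integrable_truncation[OF f])
  have [measurable]: "tr R \<in> borel_measurable borel" for R using tr[of R] by auto
  define tail where "tail R = (2 * pi) ^ CARD('d) * (LINT x|lborel. indicator (- ball 0 R) x * (norm (f x))\<^sup>2)" for R
  have tail0: "tail R \<ge> 0" for R
    by (simp add: tail_def integral_nonneg_AE)
  have int: "integrable lborel (\<lambda>x. indicator (- ball 0 R) x * (norm (f x))\<^sup>2)" for R
    by (rule Bochner_Integration.integrable_bound[OF f2]) (auto simp: indicator_def)
  have D1: "(\<integral>\<^sup>+\<xi>. ennreal ((norm (fourier (tr S) \<xi> - fourier (tr R) \<xi>))\<^sup>2) \<partial>lborel) \<le> ennreal (tail R)"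
    if "R \<le> S" for R S
  proof -
    have "(\<integral>\<^sup>+\<xi>. ennreal ((norm (fourier (tr S) \<xi> - fourier (tr R) \<xi>))\<^sup>2) \<partial>lborel)
      \<le> ennreal ((2 * pi) ^ CARD('d)) * (\<integral>\<^sup>+x. ennreal ((norm (tr S x - tr R x))\<^sup>2) \<partial>lborel)"
      unfolding fourier_diff[OF tr tr, symmetric] by (rule plancherel_le) (intro Bochner_Integration.integrable_diff tr)
    also have "\<dots> \<le> ennreal ((2 * pi) ^ CARD('d)) * (\<integral>\<^sup>+x. ennreal (indicator (- ball 0 R) x * (norm (f x))\<^sup>2) \<partial>lborel)"
      using that by (intro mult_left_mono nn_integral_mono) (auto simp: tr_def indicator_def)
    also have "\<dots> = ennreal (tail R)"
      by (subst nn_integral_eq_integral[OF int]) (auto simp: tail_def ennreal_mult integral_nonneg_AE)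
    finally show ?thesis .
  qed
  have "((\<lambda>R. LINT x|lborel. indicator (- ball 0 R) x * (norm (f x))\<^sup>2) \<longlongrightarrow> (LINT x::real^'d|lborel. 0)) at_top"
  proof (rule integral_dominated_convergence_at_top[OF _ _ f2])
    show "AE x in lborel. ((\<lambda>R. indicator (- ball 0 R) x * (norm (f x))\<^sup>2) \<longlongrightarrow> 0) at_top"
    proof (rule AE_I2)
      fix x :: "real^'d"
      have "eventually (\<lambda>R. indicator (- ball 0 R) x * (norm (f x))\<^sup>2 = 0) at_top"
        using eventually_gt_at_top[of "norm x"] by eventually_elim auto
      then show "((\<lambda>R. indicator (- ball 0 R) x * (norm (f x))\<^sup>2) \<longlongrightarrow> 0) at_top"
        by (rule tendsto_eventually)
    qed
  qed (auto simp: indicator_def)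
  from tendsto_mult[OF tendsto_const[of "(2 * pi) ^ CARD('d)"] this]
  have tail_lim: "(tail \<longlongrightarrow> 0) at_top" by (simp add: tail_def[abs_def])
  have tail_mono: "tail S \<le> tail R" if "R \<le> S" for R S
    unfolding tail_def using that
    by (intro mult_left_mono integral_mono int) (auto simp: indicator_def)
  have "\<exists>m::nat. tail (real m) \<le> (1/4) ^ n" for n
  proof -
    have "eventually (\<lambda>R. tail R < (1/4) ^ n) at_top"
      by (rule order_tendstoD(2)[OF tail_lim]) simp
    then obtain R where R: "tail R < (1/4) ^ n" by (metis eventually_happens' trivial_limit_at_top_linorder)
    obtain m :: nat where "R \<le> real m" using real_arch_simple by blast
    then show ?thesis using R tail_mono[of R "real m"] by (intro exI[of _ m]) auto
  qed
  then obtain m :: "nat \<Rightarrow> nat" where m: "tail (real (m n)) \<le> (1/4) ^ n" for n by metis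
  \<comment> \<open>Cumulative sums make the radii monotone and at least \<open>m n\<close>; the
    added 1 makes them unbounded.\<close>
  define T where "T n = real (\<Sum>i\<le>n. m i + 1)" for n
  have T_Suc: "T n \<le> T (Suc n)" for n by (simp add: T_def)
  have T_ge: "T n \<ge> real n" for n
  proof -
    have "real (\<Sum>i\<le>n. 1) \<le> T n" unfolding T_def by (intro of_nat_mono sum_mono) auto
    then show ?thesis by simp
  qed
  have T_tail: "tail (T n) \<le> (1/4) ^ n" for n
  proof -
    have "m n \<le> (\<Sum>i\<le>n. m i + 1)"
      using member_le_sum[of n "{..n}" "\<lambda>i. m i + 1"] by simp
    then have "tail (T n) \<le> tail (real (m n))" unfolding T_def by (intro tail_mono) linarith
    then show ?thesis using m[of n] by linarith
  qed
  define F where "F \<xi> = lim (\<lambda>n. fourier (tr (T n)) \<xi>)" for \<xi>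
  have F_meas [measurable]: "F \<in> borel_measurable borel"
    unfolding F_def[abs_def] by (rule borel_measurable_lim_metric) measurable
  have "AE \<xi> in lborel. convergent (\<lambda>n. fourier (tr (T n)) \<xi>)"
    by (rule AE_convergent_of_rapid_L2)
      (auto intro!: order_trans[OF D1[OF T_Suc] ennreal_leI[OF T_tail]])
  then have conv: "AE \<xi> in lborel. (\<lambda>n. fourier (tr (T n)) \<xi>) \<longlonglongrightarrow> F \<xi>"
    by eventually_elim (simp add: F_def convergent_LIMSEQ_iff)
  have bound: "(\<integral>\<^sup>+\<xi>. ennreal ((norm (F \<xi> - fourier (tr S) \<xi>))\<^sup>2) \<partial>lborel) \<le> ennreal (tail S)" for S
  proof -
    let ?w = "\<lambda>n \<xi>. ennreal ((norm (fourier (tr (T n)) \<xi> - fourier (tr S) \<xi>))\<^sup>2)"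
    have "(\<integral>\<^sup>+\<xi>. ennreal ((norm (F \<xi> - fourier (tr S) \<xi>))\<^sup>2) \<partial>lborel) = (\<integral>\<^sup>+\<xi>. liminf (\<lambda>n. ?w n \<xi>) \<partial>lborel)"
    proof (rule nn_integral_cong_AE, use conv in eventually_elim)
      fix \<xi> assume "(\<lambda>n. fourier (tr (T n)) \<xi>) \<longlonglongrightarrow> F \<xi>"
      then have "(\<lambda>n. ?w n \<xi>) \<longlonglongrightarrow> ennreal ((norm (F \<xi> - fourier (tr S) \<xi>))\<^sup>2)"
        by (intro tendsto_intros)
      then show "ennreal ((norm (F \<xi> - fourier (tr S) \<xi>))\<^sup>2) = liminf (\<lambda>n. ?w n \<xi>)"
        by (metis lim_imp_Liminf sequentially_bot)
    qed
    also have "\<dots> \<le> liminf (\<lambda>n. \<integral>\<^sup>+\<xi>. ?w n \<xi> \<partial>lborel)"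
      by (rule nn_integral_liminf) measurable
    also have "\<dots> \<le> liminf (\<lambda>n::nat. ennreal (tail S))"
    proof (rule Liminf_mono)
      have "eventually (\<lambda>n. S \<le> real n) sequentially"
        by (meson eventually_sequentiallyI nat_ceiling_le_eq)
      then show "eventually (\<lambda>n. (\<integral>\<^sup>+\<xi>. ?w n \<xi> \<partial>lborel) \<le> ennreal (tail S)) sequentially"
        by eventually_elim (rule D1, use T_ge order_trans in blast)
    qed
    also have "\<dots> = ennreal (tail S)"
      by (rule Liminf_const) simp
    finally show ?thesis .
  qed
  have "is_L2_fourier f F"
    unfolding is_L2_fourier_def square_integrable_def
  proof (intro conjI)
    show "F \<in> borel_measurable lborel" using F_meas by simp
    \<comment> \<open>The ball of radius 0 is empty, so the error bound at radius 0 is the bound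
      that makes \<open>F\<close> square integrable.\<close>
    have "tr 0 = (\<lambda>_. 0)" by (auto simp: tr_def)
    then have "fourier (tr 0) \<xi> = 0" for \<xi> by (simp add: fourier_def)
    then have "(\<integral>\<^sup>+\<xi>. ennreal ((norm (F \<xi>))\<^sup>2) \<partial>lborel) \<le> ennreal (tail 0)"
      using bound[of 0] by simp
    also have "\<dots> < \<infinity>"
      by simp
    finally show "integrable lborel (\<lambda>\<xi>. (norm (F \<xi>))\<^sup>2)"
      by (intro integrableI_bounded) auto
    show "((\<lambda>R. \<integral>\<^sup>+\<xi>. ennreal ((norm (F \<xi> - fourier (\<lambda>x. indicator (ball 0 R) x *\<^sub>R f x) \<xi>))\<^sup>2) \<partial>lborel) \<longlongrightarrow> 0) at_top"
    proof (rule tendsto_sandwich[OF _ _ tendsto_const])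
      show "((\<lambda>R. ennreal (tail R)) \<longlongrightarrow> 0) at_top"
        using tendsto_ennrealI[OF tail_lim] by simp
    qed (use bound in \<open>auto simp: tr_def[abs_def]\<close>)
  qed
  then show ?thesis unfolding L2_fourier_def by (rule someI[of "is_L2_fourier f"])
qed

section \<open>Fourier inversion for continuous square integrable functions\<close>

text \<open>Away from the origin two bounds are needed. The uniform one is integrated against the
  square of \<open>norm (f y)\<close>; the other is integrated against a constant, so it must remain
  integrable: half of the exponent supplies the decay in \<tau> and the other half is a Gaussian
  that is wider by \<open>sqrt 2\<close>.\<close>

lemma gauss_kernel_far_le:
  fixes z :: "real^'d"
  assumes \<tau>: "\<tau> > 0" and z: "norm z \<ge> \<delta>" and \<delta>: "\<delta> > 0"
  shows "gauss_kernel \<tau> z \<le> (1 / \<tau>) ^ CARD('d) * exp (- \<delta>\<^sup>2 / (2 * \<tau>\<^sup>2))"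
    and "gauss_kernel \<tau> z \<le> sqrt 2 ^ CARD('d) * exp (- \<delta>\<^sup>2 / (4 * \<tau>\<^sup>2)) * gauss_kernel (sqrt 2 * \<tau>) z"
proof -
  have nz: "\<delta>\<^sup>2 \<le> (norm z)\<^sup>2"
    using z \<delta> by (intro power_mono) auto
  have "1 * \<tau> \<le> sqrt (2 * pi) * \<tau>"
    using \<tau> pi_gt3 by (intro mult_right_mono) auto
  then have "1 / sqrt (2 * pi * \<tau>\<^sup>2) \<le> 1 / \<tau>"
    using \<tau> by (simp add: real_sqrt_mult field_simps)
  then show "gauss_kernel \<tau> z \<le> (1 / \<tau>) ^ CARD('d) * exp (- \<delta>\<^sup>2 / (2 * \<tau>\<^sup>2))"
    unfolding gauss_kernel_eq[OF \<tau>] using \<tau> nz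
    by (intro mult_mono power_mono) (auto simp: divide_right_mono)
  have s2: "sqrt 2 * \<tau> > 0" using \<tau> by simp
  have "gauss_kernel \<tau> z = sqrt 2 ^ CARD('d) * exp (- (norm z)\<^sup>2 / (4 * \<tau>\<^sup>2)) * gauss_kernel (sqrt 2 * \<tau>) z"
  proof -
    have "exp (- (norm z)\<^sup>2 / (2 * \<tau>\<^sup>2)) = exp (- (norm z)\<^sup>2 / (4 * \<tau>\<^sup>2)) * exp (- (norm z)\<^sup>2 / (2 * (sqrt 2 * \<tau>)\<^sup>2))"
      unfolding exp_add[symmetric] using \<tau> by (simp add: power_mult_distrib field_simps)
    moreover have "1 / sqrt (2 * pi * \<tau>\<^sup>2) = sqrt 2 * (1 / sqrt (2 * pi * (sqrt 2 * \<tau>)\<^sup>2))"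
      using \<tau> by (simp add: power_mult_distrib real_sqrt_mult field_simps)
    ultimately show ?thesis
      unfolding gauss_kernel_eq[OF \<tau>] gauss_kernel_eq[OF s2] by (simp only: power_mult_distrib mult_ac)
  qed
  also have "\<dots> \<le> sqrt 2 ^ CARD('d) * exp (- \<delta>\<^sup>2 / (4 * \<tau>\<^sup>2)) * gauss_kernel (sqrt 2 * \<tau>) z"
    using \<tau> nz by (intro mult_right_mono mult_left_mono) (auto simp: divide_right_mono)
  finally show "gauss_kernel \<tau> z \<le> \<dots>" .
qed

text \<open>Far from x the function may be unbounded and non-integrable, but the norm of
  \<open>f y - f x\<close> is at most \<open>(norm (f y))\<^sup>2 + (1 + norm (f x))\<close>; these
  two summands are matched with the two bounds of the preceding lemma. Near x, continuity and total
  mass 1 suffice.\<close>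

lemma tendsto_gauss_approximation:
  fixes f :: "real^'d \<Rightarrow> complex"
  assumes f: "square_integrable f" and cont: "isCont f x"
  shows "(\<lambda>n. LINT y|lborel. f y * of_real (gauss_kernel (1 / real (Suc n)) (x - y))) \<longlonglongrightarrow> f x"
proof (rule LIMSEQ_I)
  have [measurable]: "f \<in> borel_measurable borel" and f2: "integrable lborel (\<lambda>x. (norm (f x))\<^sup>2)"
    using f by (auto simp: square_integrable_def)
  fix \<eta> :: real assume \<eta>: "\<eta> > 0"
  obtain \<delta> where \<delta>: "\<delta> > 0" "\<And>y. norm (y - x) < \<delta> \<Longrightarrow> norm (f y - f x) < \<eta> / 2"
    using cont \<eta> by (auto simp: continuous_at_eps_delta dist_norm dest!: spec[of _ "\<eta> / 2"])
  define t where "t n = 1 / real (Suc n)" for n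
  have t: "t n > 0" "sqrt 2 * t n > 0" for n by (auto simp: t_def)
  define A where "A n = (1 / t n) ^ CARD('d) * exp (- \<delta>\<^sup>2 / (2 * (t n)\<^sup>2))" for n
  define B where "B n = sqrt 2 ^ CARD('d) * exp (- \<delta>\<^sup>2 / (4 * (t n)\<^sup>2))" for n
  let ?E = "\<lambda>n. A n * (LINT y|lborel. (norm (f y))\<^sup>2) + (1 + norm (f x)) * B n"
  have "A \<longlonglongrightarrow> 0"
  proof -
    have "(\<lambda>n. (real n + 1) ^ CARD('d) * exp (- \<delta>\<^sup>2 * (real n + 1)\<^sup>2 / 2)) \<longlonglongrightarrow> 0"
      using \<delta>(1) by real_asymp
    then show ?thesis by (simp add: A_def[abs_def] t_def field_simps)
  qed
  moreover have "B \<longlonglongrightarrow> 0"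
  proof -
    have "(\<lambda>n. exp (- \<delta>\<^sup>2 * (real n + 1)\<^sup>2 / 4)) \<longlonglongrightarrow> 0"
      using \<delta>(1) by real_asymp
    from tendsto_mult[OF tendsto_const[of "sqrt 2 ^ CARD('d)"] this]
    show ?thesis by (simp add: B_def[abs_def] t_def field_simps)
  qed
  ultimately have "?E \<longlonglongrightarrow> 0 * (LINT y|lborel. (norm (f y))\<^sup>2) + (1 + norm (f x)) * 0"
    by (intro tendsto_intros)
  then have "eventually (\<lambda>n. ?E n < \<eta> / 2) sequentially"
    using \<eta> by (intro order_tendstoD(2)) auto
  then obtain n0 where n0: "\<And>n. n \<ge> n0 \<Longrightarrow> ?E n < \<eta> / 2"
    by (auto simp: eventually_sequentially)
  show "\<exists>n0. \<forall>n\<ge>n0. norm ((LINT y|lborel. f y * of_real (gauss_kernel (1 / real (Suc n)) (x - y))) - f x) < \<eta>"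
  proof (intro exI allI impI)
    fix n assume n: "n \<ge> n0"
    let ?k = "\<lambda>y. gauss_kernel (t n) (x - y)" and ?k2 = "\<lambda>y. gauss_kernel (sqrt 2 * t n) (x - y)"
    let ?b = "\<lambda>y. \<eta> / 2 * ?k y + A n * (norm (f y))\<^sup>2 + (1 + norm (f x)) * B n * ?k2 y"
    have A0: "A n \<ge> 0" and B0: "B n \<ge> 0"
      using t[of n] by (auto simp: A_def B_def)
    have ptw: "norm ((f y - f x) * of_real (?k y)) \<le> ?b y" for y
    proof (cases "norm (y - x) < \<delta>")
      case True
      have "norm ((f y - f x) * of_real (?k y)) = norm (f y - f x) * ?k y"
        by (simp add: norm_mult)
      also have "\<dots> \<le> \<eta> / 2 * ?k y"
        using \<delta>(2)[OF True] by (intro mult_right_mono) auto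
      finally show ?thesis
        using A0 B0 by (simp add: add_increasing2)
    next
      case False
      then have far: "norm (x - y) \<ge> \<delta>" by (simp add: norm_minus_commute)
      have "norm (f y) \<le> 1 + (norm (f y))\<^sup>2"
        by (rule le_one_plus_square)
      then have "norm (f y - f x) \<le> (norm (f y))\<^sup>2 + (1 + norm (f x))"
        using norm_triangle_ineq4[of "f y" "f x"] by linarith
      then have "norm ((f y - f x) * of_real (?k y)) \<le> ((norm (f y))\<^sup>2 + (1 + norm (f x))) * ?k y"
        by (auto simp: norm_mult intro: mult_right_mono)
      also have "\<dots> = (norm (f y))\<^sup>2 * ?k y + (1 + norm (f x)) * ?k y"
        by (rule distrib_right)
      also have "\<dots> \<le> (norm (f y))\<^sup>2 * A n + (1 + norm (f x)) * (B n * ?k2 y)"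
        using gauss_kernel_far_le[OF t(1) far \<delta>(1), of n]
        by (intro add_mono mult_left_mono) (auto simp: A_def B_def)
      also have "\<dots> = A n * (norm (f y))\<^sup>2 + (1 + norm (f x)) * B n * ?k2 y"
        by simp
      moreover have "0 \<le> \<eta> / 2 * ?k y"
        using \<eta> by simp
      ultimately show ?thesis by linarith
    qed
    have ik: "integrable lborel ?k" "integrable lborel ?k2"
      by (rule integrable_gauss_kernel_shift; rule t)+
    have ikc: "integrable lborel (\<lambda>y. complex_of_real (?k y))"
      using ik(1) by simp
    have ib: "integrable lborel ?b"
      by (intro Bochner_Integration.integrable_add integrable_mult_right ik f2)
    have id: "integrable lborel (\<lambda>y. (f y - f x) * of_real (?k y))"
      by (rule Bochner_Integration.integrable_bound[OF ib])
        (use ptw in \<open>auto intro: order_trans[OF _ abs_ge_self]\<close>)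
    have "(LINT y|lborel. f y * of_real (?k y)) = (LINT y|lborel. (f y - f x) * of_real (?k y) + f x * of_real (?k y))"
      by (simp add: algebra_simps)
    also have "\<dots> = (LINT y|lborel. (f y - f x) * of_real (?k y)) + (LINT y|lborel. f x * of_real (?k y))"
      by (intro Bochner_Integration.integral_add id integrable_mult_right ikc)
    also have "(LINT y|lborel. f x * of_real (?k y)) = f x"
      using integral_gauss_kernel_shift[OF t(1), of n x]
      by (simp add: integral_complex_of_real)
    finally have "norm ((LINT y|lborel. f y * of_real (?k y)) - f x) = norm (LINT y|lborel. (f y - f x) * of_real (?k y))"
      by simp
    also have "\<dots> \<le> (LINT y|lborel. ?b y)"
      by (rule order_trans[OF integral_norm_bound integral_mono[OF integrable_norm[OF id] ib ptw]])
    also have "\<dots> = \<eta> / 2 + ?E n"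
      using ik f2 integral_gauss_kernel_shift[OF t(1), of n x] integral_gauss_kernel_shift[OF t(2), of n x]
      by (simp add: Bochner_Integration.integral_add)
    also have "\<dots> < \<eta>" using n0[OF n] by linarith
    finally show "norm ((LINT y|lborel. f y * of_real (gauss_kernel (1 / real (Suc n)) (x - y))) - f x) < \<eta>"
      by (simp only: t_def)
  qed
qed

text \<open>Cauchy-Schwarz with the square integrable weight bounds the square of the integral.
  Convergence of that square to 0 is then turned into convergence of the integral itself by
  monotonicity of squaring, without roots in \<open>ennreal\<close>.\<close>

lemma integral_mult_gauss_tendsto_0:
  fixes D :: "real \<Rightarrow> real^'d \<Rightarrow> complex"
  assumes \<tau>: "\<tau> > 0" and [measurable]: "\<And>R. D R \<in> borel_measurable borel"
    and lim: "((\<lambda>R. \<integral>\<^sup>+\<xi>. ennreal ((norm (D R \<xi>))\<^sup>2) \<partial>lborel) \<longlongrightarrow> 0) at_top"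
  shows "((\<lambda>R. \<integral>\<^sup>+\<xi>. ennreal (norm (D R \<xi>) * gauss_weight \<tau> \<xi>) \<partial>lborel) \<longlongrightarrow> 0) at_top"
proof -
  let ?J = "\<lambda>R. \<integral>\<^sup>+\<xi>. ennreal (norm (D R \<xi>) * gauss_weight \<tau> \<xi>) \<partial>lborel"
  let ?W = "\<integral>\<^sup>+(\<xi>::real^'d). ennreal ((gauss_weight \<tau> \<xi>)\<^sup>2) \<partial>lborel"
  have "?W \<le> (\<integral>\<^sup>+(\<xi>::real^'d). ennreal (gauss_weight \<tau> \<xi>) \<partial>lborel)"
    by (intro nn_integral_mono ennreal_leI) (simp add: power2_eq_square mult_left_le gauss_weight_le_1)
  also have "\<dots> < \<infinity>"
    using integrable_gauss_weight[OF \<tau>, where 'd='d]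
    by (simp add: nn_integral_eq_integral)
  finally have W: "?W < \<infinity>" .
  have sq: "(?J R)\<^sup>2 \<le> (\<integral>\<^sup>+\<xi>. ennreal ((norm (D R \<xi>))\<^sup>2) \<partial>lborel) * ?W" for R
    using Cauchy_Schwarz_nn_integral[of "\<lambda>\<xi>. ennreal (norm (D R \<xi>))" lborel "\<lambda>\<xi>. ennreal (gauss_weight \<tau> \<xi>)"]
    by (simp add: ennreal_mult ennreal_power)
  have "((\<lambda>R. (\<integral>\<^sup>+\<xi>. ennreal ((norm (D R \<xi>))\<^sup>2) \<partial>lborel) * ?W) \<longlongrightarrow> 0 * ?W) at_top"
    using lim W by (intro tendsto_mult_ennreal tendsto_const) auto
  then have lim1: "((\<lambda>R. (\<integral>\<^sup>+\<xi>. ennreal ((norm (D R \<xi>))\<^sup>2) \<partial>lborel) * ?W) \<longlongrightarrow> 0) at_top"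
    by (simp only: mult_zero_left)
  have lim2: "((\<lambda>R. (?J R)\<^sup>2) \<longlongrightarrow> 0) at_top"
    by (rule tendsto_sandwich[OF _ _ tendsto_const lim1]) (intro always_eventually allI zero_le sq)+
  show ?thesis
  proof (rule order_tendstoI)
    fix a :: ennreal assume "0 < a"
    from dense[OF this] obtain e where e: "0 < e" "e < a" by blast
    have "0 < e\<^sup>2"
      using e(1) by (simp add: power2_eq_square ennreal_zero_less_mult_iff)
    then have "eventually (\<lambda>R. (?J R)\<^sup>2 < e\<^sup>2) at_top"
      by (rule order_tendstoD(2)[OF lim2])
    then show "eventually (\<lambda>R. ?J R < a) at_top"
    proof eventually_elim
      fix R assume "(?J R)\<^sup>2 < e\<^sup>2"
      then have "?J R < e" by (metis not_le power_mono zero_le)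
      then show "?J R < a" using e(2) by (rule order_less_trans)
    qed
  qed auto
qed

text \<open>The fact \<open>reg\<close> is inversion with a Gaussian weight: it holds for
  truncations, and both sides converge as the radius grows, the left by the preceding lemma and the
  right by domination. As \<tau> -> 0 the left side is dominated by \<open>norm (F \<xi>)\<close>,
  and the right side tends to \<open>f x\<close> by continuity.\<close>

theorem sobolev_fourier_inversion:
  fixes f F :: "real^'d \<Rightarrow> complex"
  assumes f: "square_integrable f" and cont: "isCont f x"
    and F: "is_L2_fourier f F" and F1: "integrable lborel F"
  shows "(LINT \<xi>|lborel. F \<xi> * exp (\<i> * of_real (x \<bullet> \<xi>))) = (2 * pi) ^ CARD('d) * f x"
proof -
  have [measurable]: "f \<in> borel_measurable borel" and f2: "integrable lborel (\<lambda>x. (norm (f x))\<^sup>2)"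
    using f by (auto simp: square_integrable_def)
  have [measurable]: "F \<in> borel_measurable borel" using F1 by auto
  define tr where "tr R x = indicator (ball 0 R) x *\<^sub>R f x" for R x
  have tr: "integrable lborel (tr R)" for R
    unfolding tr_def[abs_def] by (rule square_integrable_truncation[OF f])
  have [measurable]: "tr R \<in> borel_measurable borel" for R using tr[of R] by auto
  have lim: "((\<lambda>R. \<integral>\<^sup>+\<xi>. ennreal ((norm (F \<xi> - fourier (tr R) \<xi>))\<^sup>2) \<partial>lborel) \<longlongrightarrow> 0) at_top"
    using F by (simp add: is_L2_fourier_def tr_def[abs_def])
  have reg: "(LINT \<xi>|lborel. F \<xi> * (of_real (gauss_weight \<tau> \<xi>) * exp (\<i> * of_real (x \<bullet> \<xi>))))
      = (2 * pi) ^ CARD('d) * (LINT y|lborel. f y * of_real (gauss_kernel \<tau> (x - y)))" if \<tau>: "\<tau> > 0" for \<tau>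
  proof -
    let ?w = "\<lambda>\<xi>. of_real (gauss_weight \<tau> \<xi>) * exp (\<i> * of_real (x \<bullet> \<xi>)) :: complex"
    have iF: "integrable lborel (\<lambda>\<xi>. F \<xi> * ?w \<xi>)"
      by (rule Bochner_Integration.integrable_bound[OF F1])
        (auto simp: norm_mult gauss_weight_le_1 intro!: mult_left_le)
    have iR: "integrable lborel (\<lambda>\<xi>. fourier (tr R) \<xi> * ?w \<xi>)" for R
    proof (rule Bochner_Integration.integrable_bound)
      let ?B = "LINT x|lborel. norm (tr R x)"
      show "integrable lborel (\<lambda>\<xi>::real^'d. ?B * gauss_weight \<tau> \<xi>)"
        by (intro integrable_mult_right integrable_gauss_weight \<tau>)
      show "AE \<xi> in lborel. norm (fourier (tr R) \<xi> * ?w \<xi>) \<le> norm (?B * gauss_weight \<tau> \<xi>)"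
        by (auto simp: norm_mult norm_fourier_le)
    qed measurable
    have "((\<lambda>R. ennreal (norm ((LINT \<xi>|lborel. F \<xi> * ?w \<xi>) - (LINT \<xi>|lborel. fourier (tr R) \<xi> * ?w \<xi>)))) \<longlongrightarrow> 0) at_top"
    proof (rule tendsto_sandwich[OF _ _ tendsto_const integral_mult_gauss_tendsto_0[OF \<tau> _ lim]])
      have "ennreal (norm ((LINT \<xi>|lborel. F \<xi> * ?w \<xi>) - (LINT \<xi>|lborel. fourier (tr R) \<xi> * ?w \<xi>)))
        \<le> (\<integral>\<^sup>+\<xi>. ennreal (norm (F \<xi> - fourier (tr R) \<xi>) * gauss_weight \<tau> \<xi>) \<partial>lborel)" for R
      proof -
        have eq: "(LINT \<xi>|lborel. F \<xi> * ?w \<xi>) - (LINT \<xi>|lborel. fourier (tr R) \<xi> * ?w \<xi>)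
            = (LINT \<xi>|lborel. F \<xi> * ?w \<xi> - fourier (tr R) \<xi> * ?w \<xi>)"
          by (rule Bochner_Integration.integral_diff[symmetric]; fact iF iR)
        have "norm (F \<xi> * ?w \<xi> - fourier (tr R) \<xi> * ?w \<xi>) = norm (F \<xi> - fourier (tr R) \<xi>) * gauss_weight \<tau> \<xi>" for \<xi>
          unfolding left_diff_distrib[symmetric] by (simp add: norm_mult)
        then show ?thesis
          unfolding eq
          using integral_norm_bound_ennreal[OF Bochner_Integration.integrable_diff[OF iF iR[of R]]] by simp
      qed
      then show "eventually (\<lambda>R. ennreal (norm ((LINT \<xi>|lborel. F \<xi> * ?w \<xi>) - (LINT \<xi>|lborel. fourier (tr R) \<xi> * ?w \<xi>)))
        \<le> (\<integral>\<^sup>+\<xi>. ennreal (norm (F \<xi> - fourier (tr R) \<xi>) * gauss_weight \<tau> \<xi>) \<partial>lborel)) at_top"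
        by simp
    qed auto
    then have "((\<lambda>R. norm ((LINT \<xi>|lborel. F \<xi> * ?w \<xi>) - (LINT \<xi>|lborel. fourier (tr R) \<xi> * ?w \<xi>))) \<longlongrightarrow> 0) at_top"
      by (subst (asm) ennreal_0[symmetric], subst (asm) tendsto_ennreal_iff) auto
    then have "((\<lambda>R. (LINT \<xi>|lborel. F \<xi> * ?w \<xi>) - (LINT \<xi>|lborel. fourier (tr R) \<xi> * ?w \<xi>)) \<longlongrightarrow> 0) at_top"
      by (rule tendsto_norm_zero_cancel)
    from tendsto_diff[OF tendsto_const[of "LINT \<xi>|lborel. F \<xi> * ?w \<xi>"] this]
    have L: "((\<lambda>R. LINT \<xi>|lborel. fourier (tr R) \<xi> * ?w \<xi>) \<longlongrightarrow> (LINT \<xi>|lborel. F \<xi> * ?w \<xi>)) at_top"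
      by simp
    let ?K = "(1 / sqrt (2 * pi * \<tau>\<^sup>2)) ^ CARD('d)"
    have conv: "((\<lambda>R. LINT y|lborel. tr R y * of_real (gauss_kernel \<tau> (x - y))) \<longlongrightarrow>
        (LINT y|lborel. f y * of_real (gauss_kernel \<tau> (x - y)))) at_top"
    proof (rule integral_dominated_convergence_at_top)
      show "integrable lborel (\<lambda>y. gauss_kernel \<tau> (x - y) + (norm (f y))\<^sup>2 * ?K)"
        by (intro Bochner_Integration.integrable_add integrable_mult_left f2 integrable_gauss_kernel_shift \<tau>)
      have "norm (tr R y * of_real (gauss_kernel \<tau> (x - y))) \<le> gauss_kernel \<tau> (x - y) + (norm (f y))\<^sup>2 * ?K" for R y
      proof -
        have "norm (tr R y * of_real (gauss_kernel \<tau> (x - y))) \<le> (1 + (norm (f y))\<^sup>2) * gauss_kernel \<tau> (x - y)"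
          unfolding norm_mult norm_of_real abs_of_nonneg[OF gauss_kernel_nonneg]
          using le_one_plus_square[of "norm (f y)"]
          by (intro mult_right_mono) (auto simp: tr_def indicator_def)
        also have "\<dots> = gauss_kernel \<tau> (x - y) + (norm (f y))\<^sup>2 * gauss_kernel \<tau> (x - y)"
          by (simp add: algebra_simps)
        also have "\<dots> \<le> gauss_kernel \<tau> (x - y) + (norm (f y))\<^sup>2 * ?K"
          by (intro add_left_mono mult_left_mono gauss_kernel_le \<tau>) auto
        finally show ?thesis .
      qed
      then show "eventually (\<lambda>R. AE y in lborel. norm (tr R y * of_real (gauss_kernel \<tau> (x - y))) \<le> gauss_kernel \<tau> (x - y) + (norm (f y))\<^sup>2 * ?K) at_top"
        by simp
      show "AE y in lborel. ((\<lambda>R. tr R y * of_real (gauss_kernel \<tau> (x - y))) \<longlongrightarrow> f y * of_real (gauss_kernel \<tau> (x - y))) at_top"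
      proof (rule AE_I2)
        fix y :: "real^'d"
        have "eventually (\<lambda>R. tr R y * of_real (gauss_kernel \<tau> (x - y)) = f y * of_real (gauss_kernel \<tau> (x - y))) at_top"
          using eventually_gt_at_top[of "norm y"] by eventually_elim (auto simp: tr_def)
        then show "((\<lambda>R. tr R y * of_real (gauss_kernel \<tau> (x - y))) \<longlongrightarrow> f y * of_real (gauss_kernel \<tau> (x - y))) at_top"
          by (rule tendsto_eventually)
      qed
    qed measurable
    have "((\<lambda>R. LINT \<xi>|lborel. fourier (tr R) \<xi> * ?w \<xi>) \<longlongrightarrow>
        (2 * pi) ^ CARD('d) * (LINT y|lborel. f y * of_real (gauss_kernel \<tau> (x - y)))) at_top"
      unfolding fourier_gauss_inversion[OF tr \<tau>] by (intro tendsto_mult_left conv)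
    from tendsto_unique[OF _ L this] show ?thesis by simp
  qed
  let ?e = "\<lambda>\<xi>. exp (\<i> * of_real (x \<bullet> \<xi>)) :: complex"
  have "(\<lambda>n. LINT \<xi>|lborel. F \<xi> * (of_real (gauss_weight (1 / real (Suc n)) \<xi>) * ?e \<xi>))
      \<longlonglongrightarrow> (LINT \<xi>|lborel. F \<xi> * ?e \<xi>)"
  proof (rule integral_dominated_convergence[OF _ _ integrable_norm[OF F1]])
    show "AE \<xi> in lborel. (\<lambda>n. F \<xi> * (of_real (gauss_weight (1 / real (Suc n)) \<xi>) * ?e \<xi>)) \<longlonglongrightarrow> F \<xi> * ?e \<xi>"
    proof (rule AE_I2)
      fix \<xi> :: "real^'d"
      have "(\<lambda>n. F \<xi> * (of_real (gauss_weight (1 / real (Suc n)) \<xi>) * ?e \<xi>)) \<longlonglongrightarrow> F \<xi> * (of_real 1 * ?e \<xi>)"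
        by (intro tendsto_intros tendsto_gauss_weight)
      then show "(\<lambda>n. F \<xi> * (of_real (gauss_weight (1 / real (Suc n)) \<xi>) * ?e \<xi>)) \<longlonglongrightarrow> F \<xi> * ?e \<xi>"
        by simp
    qed
    show "AE \<xi> in lborel. norm (F \<xi> * (of_real (gauss_weight (1 / real (Suc n)) \<xi>) * ?e \<xi>)) \<le> norm (F \<xi>)" for n
      by (auto simp: norm_mult gauss_weight_le_1 intro!: mult_left_le)
  qed measurable
  moreover have "(\<lambda>n. LINT \<xi>|lborel. F \<xi> * (of_real (gauss_weight (1 / real (Suc n)) \<xi>) * ?e \<xi>))
      \<longlonglongrightarrow> (2 * pi) ^ CARD('d) * f x"
  proof -
    have pos: "1 / real (Suc n) > 0" for n by simp
    show ?thesis
      unfolding reg[OF pos]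
      by (intro tendsto_mult tendsto_const tendsto_gauss_approximation f cont)
  qed
  ultimately show ?thesis by (rule LIMSEQ_unique)
qed

section \<open>Hoelder continuity of Sobolev functions\<close>

lemma integrable_one_plus_square_powr:
  fixes q :: real
  assumes q: "q > 1 / 2"
  shows "integrable lborel (\<lambda>t::real. (1 + t\<^sup>2) powr (- q))"
proof -
  let ?h = "\<lambda>t::real. indicator {1..} t * t powr (- 2 * q)"
  have "(\<lambda>t. t powr (- 2 * q)) integrable_on {1::real..}"
    using has_integral_powr_to_inf[of "- 2 * q" 1] q by (auto simp: integrable_on_def)
  then have "(\<lambda>t. t powr (- 2 * q)) absolutely_integrable_on {1::real..}"
    by (rule nonnegative_absolutely_integrable_1) auto
  then have "integrable lebesgue ?h"
    by (simp add: set_integrable_def)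
  then have h: "integrable lborel ?h"
    by (subst (asm) integrable_completion) auto
  then have h': "integrable lborel (\<lambda>t. ?h (- t))"
    using lborel_integrable_real_affine[of ?h "-1" 0] by simp
  have i: "integrable lborel (indicator {-1..1::real} :: real \<Rightarrow> real)"
    by (rule integrable_real_indicator) auto
  have "norm ((1 + t\<^sup>2) powr (- q)) \<le> norm (indicator {-1..1} t + ?h t + ?h (- t))" for t :: real
  proof (cases "\<bar>t\<bar> \<le> 1")
    case True
    have "(1 + t\<^sup>2) powr (- q) \<le> 1 powr (- q)"
      using q by (intro powr_mono2') auto
    moreover have "indicator {-1..1} t = (1::real)" using True by (simp add: indicator_def abs_le_iff)
    moreover have "?h t \<ge> 0" "?h (- t) \<ge> 0" by auto
    ultimately show ?thesis
      unfolding real_norm_def powr_one_eq_one using powr_ge_zero[of "1 + t\<^sup>2" "- q"] by linarith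
  next
    case False
    have "(1 + t\<^sup>2) powr (- q) \<le> (t\<^sup>2) powr (- q)"
      using q False by (intro powr_mono2') auto
    also have "(t\<^sup>2) powr (- q) = \<bar>t\<bar> powr (- 2 * q)"
    proof -
      have "t\<^sup>2 = \<bar>t\<bar> powr 2" using False by (simp add: powr_numeral)
      then show ?thesis by (simp only: powr_powr) simp
    qed
    also have "\<dots> \<le> ?h t + ?h (- t)"
      using False by (auto simp: indicator_def abs_real_def)
    finally show ?thesis using False by (auto simp: indicator_def abs_real_def)
  qed
  then show ?thesis
    by (intro Bochner_Integration.integrable_bound[OF Bochner_Integration.integrable_add[OF Bochner_Integration.integrable_add[OF i h] h']]) auto
qed

text \<open>No polar coordinates: \<open>1 + (norm \<xi>)\<^sup>2\<close> dominates
  \<open>1 + (\<xi> $ l)\<^sup>2\<close> for every coordinate, so giving each coordinate the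
  exponent p / d bounds the weight by a product of one-variable functions, integrable because p / d
  > 1/2.\<close>

lemma integrable_sobolev_weight:
  fixes p :: real
  assumes p: "p > real CARD('d) / 2"
  shows "integrable lborel (\<lambda>\<xi>::real^'d. (1 + (norm \<xi>)\<^sup>2) powr (- p))"
proof -
  let ?d = "real CARD('d)"
  have d: "?d > 0" by simp
  let ?q = "p / ?d"
  have q: "?q > 1 / 2" using p d by (simp add: field_simps)
  have int: "integrable lborel (\<lambda>\<xi>::real^'d. \<Prod>l\<in>UNIV. (1 + (\<xi> $ l)\<^sup>2) powr (- ?q))"
    by (rule integrable_prod_components) (rule integrable_one_plus_square_powr[OF q])
  have "norm ((1 + (norm \<xi>)\<^sup>2) powr (- p)) \<le> norm (\<Prod>l\<in>UNIV. (1 + (\<xi> $ l)\<^sup>2) powr (- ?q))" for \<xi> :: "real^'d"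
  proof -
    have "(1 + (norm \<xi>)\<^sup>2) powr (- p) = (\<Prod>l\<in>(UNIV::'d set). (1 + (norm \<xi>)\<^sup>2) powr (- ?q))"
    proof -
      have "1 + (norm \<xi>)\<^sup>2 > 0" by (simp add: add_pos_nonneg)
      then show ?thesis using d by (simp add: powr_realpow[symmetric] powr_powr)
    qed
    also have "\<dots> \<le> (\<Prod>l\<in>UNIV. (1 + (\<xi> $ l)\<^sup>2) powr (- ?q))"
    proof (intro prod_mono conjI powr_mono2')
      fix l
      have "\<bar>\<xi> $ l\<bar>\<^sup>2 \<le> (norm \<xi>)\<^sup>2"
        by (intro power_mono component_le_norm_cart) auto
      then show "1 + (\<xi> $ l)\<^sup>2 \<le> 1 + (norm \<xi>)\<^sup>2" by simp
      show "1 + (\<xi> $ l)\<^sup>2 > 0" by (simp add: add_pos_nonneg)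
    qed (use q in auto)
    finally show ?thesis by (simp add: prod_nonneg)
  qed
  then show ?thesis
    by (intro Bochner_Integration.integrable_bound[OF int]) auto
qed

text \<open>Cauchy-Schwarz after splitting the exponent r/2 as \<sigma>/2 - (\<sigma> - r)/2. The
  case r = 0 gives integrability of the transform and the supremum bound; r = \<zeta> gives the
  Hoelder bound.\<close>

lemma
  fixes F :: "real^'d \<Rightarrow> complex"
  assumes [measurable]: "F \<in> borel_measurable borel"
    and I: "integrable lborel (\<lambda>\<xi>. (norm (F \<xi>))\<^sup>2 * (1 + (norm \<xi>)\<^sup>2) powr \<sigma>)"
    and r: "\<sigma> - r > real CARD('d) / 2"
  shows integrable_sobolev_L1: "integrable lborel (\<lambda>\<xi>. norm (F \<xi>) * (1 + (norm \<xi>)\<^sup>2) powr (r / 2))"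
    and integral_sobolev_L1_le: "(LINT \<xi>|lborel. norm (F \<xi>) * (1 + (norm \<xi>)\<^sup>2) powr (r / 2))
      \<le> sqrt (LINT \<xi>|lborel. (norm (F \<xi>))\<^sup>2 * (1 + (norm \<xi>)\<^sup>2) powr \<sigma>)
        * sqrt (LINT \<xi>|(lborel::(real^'d) measure). (1 + (norm \<xi>)\<^sup>2) powr (- (\<sigma> - r)))"
proof -
  let ?a = "\<lambda>\<xi>. norm (F \<xi>) * (1 + (norm \<xi>)\<^sup>2) powr (\<sigma> / 2)"
  let ?b = "\<lambda>\<xi>::real^'d. (1 + (norm \<xi>)\<^sup>2) powr (- (\<sigma> - r) / 2)"
  let ?I = "LINT \<xi>|lborel. (norm (F \<xi>))\<^sup>2 * (1 + (norm \<xi>)\<^sup>2) powr \<sigma>"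
  let ?W = "LINT \<xi>|(lborel::(real^'d) measure). (1 + (norm \<xi>)\<^sup>2) powr (- (\<sigma> - r))"
  have W: "integrable lborel (\<lambda>\<xi>::real^'d. (1 + (norm \<xi>)\<^sup>2) powr (- (\<sigma> - r)))"
    by (rule integrable_sobolev_weight[OF r])
  have pw: "norm (F \<xi>) * (1 + (norm \<xi>)\<^sup>2) powr (r / 2) = ?a \<xi> * ?b \<xi>" for \<xi>
    by (simp add: powr_add[symmetric] mult.assoc add_divide_distrib[symmetric])
  have sqp: "((1 + (norm \<xi>)\<^sup>2) powr (u / 2))\<^sup>2 = (1 + (norm \<xi>)\<^sup>2) powr u" for u and \<xi> :: "real^'d"
    by (simp add: powr_power add_pos_nonneg less_imp_neq[symmetric])
  have a2: "(?a \<xi>)\<^sup>2 = (norm (F \<xi>))\<^sup>2 * (1 + (norm \<xi>)\<^sup>2) powr \<sigma>" for \<xi>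
    by (simp add: power_mult_distrib sqp)
  have b2: "(?b \<xi>)\<^sup>2 = (1 + (norm \<xi>)\<^sup>2) powr (- (\<sigma> - r))" for \<xi>
    by (rule sqp)
  have "norm (?a \<xi> * ?b \<xi>) \<le> norm ((norm (F \<xi>))\<^sup>2 * (1 + (norm \<xi>)\<^sup>2) powr \<sigma> + (1 + (norm \<xi>)\<^sup>2) powr (- (\<sigma> - r)))" for \<xi>
  proof -
    have "0 \<le> ?a \<xi> * ?b \<xi>" by simp
    moreover have "2 * ?a \<xi> * ?b \<xi> \<le> (?a \<xi>)\<^sup>2 + (?b \<xi>)\<^sup>2" by (rule sum_squares_bound)
    ultimately show ?thesis unfolding a2 b2 real_norm_def by linarith
  qed
  then show int: "integrable lborel (\<lambda>\<xi>. norm (F \<xi>) * (1 + (norm \<xi>)\<^sup>2) powr (r / 2))"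
    unfolding pw by (intro Bochner_Integration.integrable_bound[OF Bochner_Integration.integrable_add[OF I W]]) auto
  let ?L = "LINT \<xi>|lborel. norm (F \<xi>) * (1 + (norm \<xi>)\<^sup>2) powr (r / 2)"
  have L0: "?L \<ge> 0" and I0: "?I \<ge> 0" and W0: "?W \<ge> 0" by (auto intro!: integral_nonneg_AE)
  have "(\<integral>\<^sup>+\<xi>. ennreal (?a \<xi>) * ennreal (?b \<xi>) \<partial>lborel) = ennreal ?L"
    using nn_integral_eq_integral[OF int] by (simp add: pw ennreal_mult)
  moreover have "(\<integral>\<^sup>+\<xi>. (ennreal (?a \<xi>))\<^sup>2 \<partial>lborel) = ennreal ?I"
    using nn_integral_eq_integral[OF I] by (subst ennreal_power) (simp_all only: a2, auto)
  moreover have "(\<integral>\<^sup>+\<xi>. (ennreal (?b \<xi>))\<^sup>2 \<partial>lborel) = ennreal ?W"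
    using nn_integral_eq_integral[OF W] by (subst ennreal_power) (simp_all only: b2, auto)
  ultimately have "(ennreal ?L)\<^sup>2 \<le> ennreal ?I * ennreal ?W"
    using Cauchy_Schwarz_nn_integral[of "\<lambda>\<xi>. ennreal (?a \<xi>)" lborel "\<lambda>\<xi>. ennreal (?b \<xi>)"] by simp
  then have "?L\<^sup>2 \<le> ?I * ?W"
    using L0 I0 W0 by (simp only: ennreal_power ennreal_mult[symmetric] ennreal_le_iff mult_nonneg_nonneg)
  then show "?L \<le> sqrt ?I * sqrt ?W"
    unfolding real_sqrt_mult[symmetric] by (rule real_le_rsqrt)
qed

lemma in_sobolev_mono:
  fixes f :: "real^'d \<Rightarrow> complex"
  assumes f: "in_sobolev t f" and "\<sigma> \<le> t"
  shows "in_sobolev \<sigma> f"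
proof -
  have "is_L2_fourier f (L2_fourier f)"
    using f by (intro is_L2_fourier_L2_fourier) (simp add: in_sobolev_def)
  then have [measurable]: "L2_fourier f \<in> borel_measurable borel"
    by (simp add: is_L2_fourier_def square_integrable_def)
  have I: "integrable lborel (\<lambda>\<xi>. (norm (L2_fourier f \<xi>))\<^sup>2 * (1 + (norm \<xi>)\<^sup>2) powr t)"
    using f by (simp add: in_sobolev_def)
  have "integrable lborel (\<lambda>\<xi>. (norm (L2_fourier f \<xi>))\<^sup>2 * (1 + (norm \<xi>)\<^sup>2) powr \<sigma>)"
    by (rule Bochner_Integration.integrable_bound[OF I])
      (use \<open>\<sigma> \<le> t\<close> in \<open>auto intro!: mult_left_mono powr_mono\<close>)
  then show ?thesis using f by (simp add: in_sobolev_def)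
qed

text \<open>The supremum only yields some exponent above \<sigma>; monotonicity of the Sobolev scale
  brings it down to \<sigma>.\<close>

lemma in_sobolev_of_nu2:
  assumes "nu2 f > ereal \<sigma>"
  shows "in_sobolev \<sigma> f"
proof -
  obtain t where "in_sobolev t f" "ereal \<sigma> < ereal t"
    using assms by (auto simp: nu2_def less_SUP_iff)
  then show ?thesis using in_sobolev_mono[of t f \<sigma>] by simp
qed

text \<open>Interpolation between the two trivial bounds: the difference of the angles, used when it
  is at most 1, and the constant 2, used otherwise.\<close>

lemma norm_iexp_diff_le:
  fixes \<theta> \<psi> \<zeta> :: real
  assumes "0 < \<zeta>" "\<zeta> \<le> 1"
  shows "norm (exp (\<i> * of_real \<theta>) - exp (\<i> * of_real \<psi>)) \<le> 2 * \<bar>\<theta> - \<psi>\<bar> powr \<zeta>"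
proof -
  let ?t = "\<theta> - \<psi>"
  have "exp (\<i> * of_real \<theta>) - exp (\<i> * of_real \<psi>) = exp (\<i> * of_real \<psi>) * (iexp ?t - 1)"
    by (simp add: right_diff_distrib exp_add[symmetric])
  then have eq: "norm (exp (\<i> * of_real \<theta>) - exp (\<i> * of_real \<psi>)) = norm (iexp ?t - 1)"
    by (simp add: norm_mult)
  show ?thesis
  proof (cases "\<bar>?t\<bar> \<le> 1")
    case True
    have "norm (iexp ?t - 1) \<le> \<bar>?t\<bar>"
      using iexp_approx1[of ?t 0] by simp
    also have "\<bar>?t\<bar> \<le> \<bar>?t\<bar> powr \<zeta>"
      using powr_mono'[of \<zeta> 1 "\<bar>?t\<bar>"] True assms by (cases "?t = 0") auto
    finally show ?thesis unfolding eq
      using powr_ge_zero[of "\<bar>?t\<bar>" \<zeta>] by linarith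
  next
    case False
    have "norm (iexp ?t - 1) \<le> 2"
      using norm_triangle_ineq4[of "iexp ?t" 1] by simp
    moreover have "1 \<le> \<bar>?t\<bar> powr \<zeta>"
      using False assms by (intro ge_one_powr_ge_zero) auto
    ultimately show ?thesis unfolding eq by linarith
  qed
qed

text \<open>Inversion bounds f and its differences by weighted integrals of the transform. The
  choice of \<zeta> balances two demands: \<zeta> at most 1 for the estimate of the exponentials,
  and \<sigma> - \<zeta> at least s, hence above d/2, for the integrability of the remaining
  weight.\<close>

theorem sobolev_holder:
  fixes s \<sigma> :: real
  assumes s: "s > real CARD('d) / 2" and \<sigma>: "\<sigma> > s"
  shows "\<exists>H>0. \<forall>f::real^'d \<Rightarrow> complex. in_sobolev \<sigma> f \<and> continuous_on UNIV f \<longrightarrow>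
    (\<forall>x. norm (f x) \<le> H * sobolev_norm \<sigma> f) \<and>
    (\<forall>x y. norm (f x - f y) \<le> H * sobolev_norm \<sigma> f * norm (x - y) powr min 1 (\<sigma> - s))"
proof -
  define \<zeta> where "\<zeta> = min 1 (\<sigma> - s)"
  have \<zeta>: "0 < \<zeta>" "\<zeta> \<le> 1" "\<sigma> - \<zeta> > real CARD('d) / 2" "\<sigma> - 0 > real CARD('d) / 2"
    using s \<sigma> by (auto simp: \<zeta>_def min_def)
  define P where "P = (2 * pi) ^ CARD('d)"
  have P: "P > 0" by (simp add: P_def)
  define W where "W r = sqrt (LINT \<xi>|(lborel::(real^'d) measure). (1 + (norm \<xi>)\<^sup>2) powr (- (\<sigma> - r)))" for r
  have W0: "W r \<ge> 0" for r by (auto simp: W_def intro!: integral_nonneg_AE)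
  define c where "c = (2 * pi) powr (- real CARD('d) / 2)"
  have c: "c > 0" by (simp add: c_def)
  \<comment> \<open>\<open>P\<close> is the factor in the inversion formula and \<open>c\<close> the
    one in \<open>sobolev_norm\<close>. The 2 comes from \<open>norm_iexp_diff_le\<close>, and the
    leading 1 makes \<open>H\<close> positive.\<close>
  define H where "H = 1 + (W 0 + 2 * W \<zeta>) / (P * c)"
  have H: "H > 0" using P c W0[of 0] W0[of \<zeta>] by (auto simp: H_def intro!: add_pos_nonneg)
  have "norm (f x) \<le> H * sobolev_norm \<sigma> f \<and>
      norm (f x - f y) \<le> H * sobolev_norm \<sigma> f * norm (x - y) powr \<zeta>"
    if f: "in_sobolev \<sigma> f" and cont: "continuous_on UNIV f" for f :: "real^'d \<Rightarrow> complex" and x y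
  proof -
    define F where "F = L2_fourier f"
    have sq: "square_integrable f" using f by (simp add: in_sobolev_def)
    have F: "is_L2_fourier f F" unfolding F_def by (rule is_L2_fourier_L2_fourier[OF sq])
    have [measurable]: "F \<in> borel_measurable borel"
      using F by (simp add: is_L2_fourier_def square_integrable_def)
    have I: "integrable lborel (\<lambda>\<xi>. (norm (F \<xi>))\<^sup>2 * (1 + (norm \<xi>)\<^sup>2) powr \<sigma>)"
      using f by (simp add: in_sobolev_def F_def)
    define q where "q = sqrt (LINT \<xi>|lborel. (norm (F \<xi>))\<^sup>2 * (1 + (norm \<xi>)\<^sup>2) powr \<sigma>)"
    have q0: "q \<ge> 0" by (auto simp: q_def intro!: integral_nonneg_AE)
    have sn: "sobolev_norm \<sigma> f = c * q" by (simp add: sobolev_norm_def c_def q_def F_def)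
    note L1 = integrable_sobolev_L1[OF _ I] integral_sobolev_L1_le[OF _ I, folded q_def]
    have i0: "integrable lborel (\<lambda>\<xi>. norm (F \<xi>))"
      using L1(1)[OF _ \<zeta>(4)] by (simp add: powr_zero_eq_one add_pos_nonneg less_imp_neq[symmetric])
    then have F1: "integrable lborel F" by (subst (asm) integrable_norm_iff) auto
    have l0: "(LINT \<xi>|lborel. norm (F \<xi>)) \<le> q * W 0"
      using L1(2)[OF _ \<zeta>(4)] by (simp add: W_def powr_zero_eq_one add_pos_nonneg less_imp_neq[symmetric])
    have i1: "integrable lborel (\<lambda>\<xi>. norm (F \<xi>) * (1 + (norm \<xi>)\<^sup>2) powr (\<zeta> / 2))"
      and l1: "(LINT \<xi>|lborel. norm (F \<xi>) * (1 + (norm \<xi>)\<^sup>2) powr (\<zeta> / 2)) \<le> q * W \<zeta>"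
      using L1[OF _ \<zeta>(3)] by (simp_all add: W_def)
    let ?e = "\<lambda>x \<xi>. exp (\<i> * of_real (x \<bullet> \<xi>)) :: complex"
    have inv: "(LINT \<xi>|lborel. F \<xi> * ?e x \<xi>) = of_real P * f x" for x
      using sobolev_fourier_inversion[OF sq _ F F1, of x] cont
      by (simp add: P_def continuous_on_eq_continuous_at)
    have ie: "integrable lborel (\<lambda>\<xi>. F \<xi> * ?e x \<xi>)" for x
      by (rule Bochner_Integration.integrable_bound[OF F1]) (auto simp: norm_mult)
    have "P * norm (f x) = norm (LINT \<xi>|lborel. F \<xi> * ?e x \<xi>)"
      unfolding inv using P by (simp add: norm_mult)
    also have "\<dots> \<le> (LINT \<xi>|lborel. norm (F \<xi>))"
      by (rule order_trans[OF integral_norm_bound]) (simp add: norm_mult)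
    also note l0
    finally have b0: "norm (f x) \<le> W 0 / (P * c) * sobolev_norm \<sigma> f"
      using P c by (simp add: sn field_simps)
    have ptw: "norm (F \<xi> * ?e x \<xi> - F \<xi> * ?e y \<xi>) \<le>
        2 * norm (x - y) powr \<zeta> * (norm (F \<xi>) * (1 + (norm \<xi>)\<^sup>2) powr (\<zeta> / 2))" for \<xi>
    proof -
      have "norm (?e x \<xi> - ?e y \<xi>) \<le> 2 * \<bar>x \<bullet> \<xi> - y \<bullet> \<xi>\<bar> powr \<zeta>"
        by (rule norm_iexp_diff_le[OF \<zeta>(1,2)])
      also have "\<bar>x \<bullet> \<xi> - y \<bullet> \<xi>\<bar> powr \<zeta> \<le> (norm (x - y) * norm \<xi>) powr \<zeta>"
        using \<zeta> Cauchy_Schwarz_ineq2[of "x - y" \<xi>] by (intro powr_mono2) (auto simp: inner_diff_left)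
      also have "\<dots> = norm (x - y) powr \<zeta> * norm \<xi> powr \<zeta>"
        by (rule powr_mult)
      also have "norm \<xi> powr \<zeta> \<le> (1 + (norm \<xi>)\<^sup>2) powr (\<zeta> / 2)"
      proof -
        have "norm \<xi> powr \<zeta> \<le> (sqrt (1 + (norm \<xi>)\<^sup>2)) powr \<zeta>"
          using \<zeta> by (intro powr_mono2 real_le_rsqrt) auto
        also have "\<dots> = (1 + (norm \<xi>)\<^sup>2) powr (\<zeta> / 2)"
          by (simp add: powr_half_sqrt[symmetric] powr_powr)
        finally show ?thesis .
      qed
      finally have "norm (?e x \<xi> - ?e y \<xi>) \<le> 2 * (norm (x - y) powr \<zeta> * (1 + (norm \<xi>)\<^sup>2) powr (\<zeta> / 2))"
        by (simp add: mult_left_mono)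
      from mult_left_mono[OF this norm_ge_zero[of "F \<xi>"]] show ?thesis
        unfolding right_diff_distrib[symmetric] norm_mult by (simp only: mult_ac)
    qed
    have "P * norm (f x - f y) = norm (of_real P * f x - of_real P * f y)"
      unfolding right_diff_distrib[symmetric] using P by (simp add: norm_mult)
    also have "\<dots> = norm (LINT \<xi>|lborel. F \<xi> * ?e x \<xi> - F \<xi> * ?e y \<xi>)"
      unfolding inv[symmetric] by (subst Bochner_Integration.integral_diff[OF ie ie]) simp
    also have "\<dots> \<le> (LINT \<xi>|lborel. 2 * norm (x - y) powr \<zeta> * (norm (F \<xi>) * (1 + (norm \<xi>)\<^sup>2) powr (\<zeta> / 2)))"
      by (rule order_trans[OF integral_norm_bound integral_mono])
        (intro integrable_norm Bochner_Integration.integrable_diff ie integrable_mult_right i1 ptw)+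
    also have "\<dots> = 2 * norm (x - y) powr \<zeta> * (LINT \<xi>|lborel. norm (F \<xi>) * (1 + (norm \<xi>)\<^sup>2) powr (\<zeta> / 2))"
      by simp
    also have "\<dots> \<le> 2 * norm (x - y) powr \<zeta> * (q * W \<zeta>)"
      by (intro mult_left_mono l1) auto
    finally have b1: "norm (f x - f y) \<le> 2 * W \<zeta> / (P * c) * sobolev_norm \<sigma> f * norm (x - y) powr \<zeta>"
      using P c by (simp add: sn field_simps)
    have sn0: "sobolev_norm \<sigma> f \<ge> 0" using c q0 by (simp add: sn)
    have "W 0 / (P * c) \<le> H" "2 * W \<zeta> / (P * c) \<le> H"
      using P c W0[of 0] W0[of \<zeta>] by (auto simp: H_def add_divide_distrib intro!: add_increasing add_increasing2)
    then show ?thesis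
      by (intro conjI order_trans[OF b0] order_trans[OF b1] mult_right_mono sn0) auto
  qed
  then show ?thesis using H unfolding \<zeta>_def by blast
qed

section \<open>The Fourier transform of a refinable function on the lattice\<close>

lemma of_lattice_nth [simp]: "of_lattice k $ l = real_of_int (k $ l)"
  by (simp add: of_lattice_def)

lemma of_lattice_add: "of_lattice (j + k) = of_lattice j + of_lattice k"
  and of_lattice_diff: "of_lattice (j - k) = of_lattice j - of_lattice k"
  and of_lattice_0 [simp]: "of_lattice 0 = 0"
  and of_lattice_axis: "of_lattice (axis l m) = axis l (real_of_int m)"
  by (simp_all add: vec_eq_iff axis_def)

lemma finite_lattice_box:
  fixes a b :: "'d::finite \<Rightarrow> real"
  shows "finite {k::int^'d. \<forall>l. a l \<le> real_of_int (k $ l) \<and> real_of_int (k $ l) \<le> b l}"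
proof -
  let ?S = "{k::int^'d. \<forall>l. a l \<le> real_of_int (k $ l) \<and> real_of_int (k $ l) \<le> b l}"
  let ?P = "Pi\<^sub>E (UNIV::'d set) (\<lambda>l. {\<lceil>a l\<rceil>..\<lfloor>b l\<rfloor>})"
  have "vec_nth ` ?S \<subseteq> ?P"
    by (auto simp: PiE_def extensional_def le_floor_iff ceiling_le_iff)
  moreover have "finite ?P" by (rule finite_PiE) auto
  ultimately have "finite (vec_nth ` ?S)" by (rule finite_subset)
  then show ?thesis by (rule finite_imageD) (simp add: inj_on_def vec_nth_inject)
qed

lemma finite_bounded_lattice:
  assumes "bounded S"
  shows "finite {k::int^'d. of_lattice k \<in> S}"
proof -
  obtain B where B: "\<And>x. x \<in> S \<Longrightarrow> norm x \<le> B"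
    using assms by (auto simp: bounded_iff)
  have "- B \<le> real_of_int (k $ l) \<and> real_of_int (k $ l) \<le> B" if "of_lattice k \<in> S" for k :: "int^'d" and l
    using order_trans[OF component_le_norm_cart B[OF that], of l] by auto
  then show ?thesis
    by (intro finite_subset[OF _ finite_lattice_box[of "\<lambda>_. - B" "\<lambda>_. B"]]) auto
qed

lemma half_lattice_notin_lattice:
  assumes "odd (k $ l)"
  shows "(1/2) *\<^sub>R of_lattice k \<notin> range of_lattice"
proof
  assume "(1/2) *\<^sub>R of_lattice k \<in> range of_lattice"
  then obtain j where "(1/2) *\<^sub>R of_lattice k = of_lattice j" by auto
  from arg_cong[OF this, of "\<lambda>x. x $ l"]
  have "real_of_int (k $ l) = real_of_int (2 * (j $ l))" by simp
  then have "k $ l = 2 * (j $ l)" by (simp only: of_int_eq_iff)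
  with assms show False by simp
qed

lemma tendsto_fourier_sequentially:
  fixes \<phi> :: "real^'d \<Rightarrow> complex"
  assumes \<phi>: "integrable lborel \<phi>" and X: "X \<longlonglongrightarrow> \<xi>"
  shows "(\<lambda>n. fourier \<phi> (X n)) \<longlonglongrightarrow> fourier \<phi> \<xi>"
  unfolding fourier_def
proof (rule integral_dominated_convergence[OF _ _ integrable_norm[OF \<phi>]])
  have [measurable]: "\<phi> \<in> borel_measurable borel" using \<phi> by auto
  show "(\<lambda>x. \<phi> x * exp (- \<i> * of_real (x \<bullet> \<xi>))) \<in> borel_measurable lborel"
    "(\<lambda>x. \<phi> x * exp (- \<i> * of_real (x \<bullet> X n))) \<in> borel_measurable lborel" for n
    by measurable
  show "AE x in lborel. (\<lambda>n. \<phi> x * exp (- \<i> * of_real (x \<bullet> X n))) \<longlonglongrightarrow> \<phi> x * exp (- \<i> * of_real (x \<bullet> \<xi>))"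
    by (intro AE_I2 tendsto_intros X)
  show "AE x in lborel. norm (\<phi> x * exp (- \<i> * of_real (x \<bullet> X n))) \<le> norm (\<phi> x)" for n
    by (simp add: norm_mult)
qed

text \<open>The point is twice \<open>2 * pi\<close> times the half-lattice vector k/2, whose coset
  is nonzero because a component of k is odd. The sum rules control the mask only at punctured
  neighbourhoods of that vector, so the refinement equation is used along a sequence of nonzero
  \<open>X n\<close> tending to 0, and continuity of \<open>fourier \<phi>\<close> gives the value
  in the limit.\<close>

lemma fourier_odd_lattice_eq_0:
  fixes \<phi> ahat :: "real^'d \<Rightarrow> complex"
  assumes \<phi>: "integrable lborel \<phi>" and ref: "refinable ahat \<phi>" and sr: "has_sum_rules (Suc m) ahat"
    and odd: "odd (k $ l)"
  shows "fourier \<phi> ((2 * pi) *\<^sub>R of_lattice k) = 0"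
proof -
  let ?\<gamma> = "(1/2) *\<^sub>R of_lattice k :: real^'d"
  have "?\<gamma> \<in> range (\<lambda>k. (1/2) *\<^sub>R of_lattice k) - range of_lattice"
    using half_lattice_notin_lattice[OF odd] by blast
  then have "(\<lambda>\<xi>. norm (ahat (\<xi> + (2 * pi) *\<^sub>R ?\<gamma>))) \<in> O[at 0](\<lambda>\<xi>. norm \<xi> ^ Suc m)"
    using sr unfolding has_sum_rules_def by blast
  then obtain c where c: "eventually (\<lambda>\<xi>. norm (norm (ahat (\<xi> + (2 * pi) *\<^sub>R ?\<gamma>))) \<le> c * norm (norm \<xi> ^ Suc m)) (at 0)"
    by (elim landau_o.bigE)
  let ?v = "axis l 1 :: real^'d"
  define X where "X n = (1 / real (Suc n)) *\<^sub>R ?v" for n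
  have "X \<longlonglongrightarrow> 0 *\<^sub>R ?v"
    unfolding X_def by (intro tendsto_intros LIMSEQ_Suc[OF lim_1_over_n])
  then have X0: "X \<longlonglongrightarrow> 0" by simp
  have "filterlim X (at 0) sequentially"
    using X0 by (auto simp: filterlim_at X_def axis_eq_0_iff)
  from eventually_compose_filterlim[OF c this]
  have ev: "eventually (\<lambda>n. norm (ahat (X n + (2 * pi) *\<^sub>R ?\<gamma>)) \<le> c * norm (X n) ^ Suc m) sequentially"
    by simp
  let ?B = "LINT x|lborel. norm (\<phi> x)"
  have eq: "fourier \<phi> (2 *\<^sub>R (X n + (2 * pi) *\<^sub>R ?\<gamma>)) = ahat (X n + (2 * pi) *\<^sub>R ?\<gamma>) * fourier \<phi> (X n + (2 * pi) *\<^sub>R ?\<gamma>)" for n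
    using ref by (simp add: refinable_def)
  have "(\<lambda>n. c * norm (X n) ^ Suc m * ?B) \<longlonglongrightarrow> c * norm (0::real^'d) ^ Suc m * ?B"
    by (intro tendsto_intros X0)
  then have lim0: "(\<lambda>n. c * norm (X n) ^ Suc m * ?B) \<longlonglongrightarrow> 0" by simp
  have "(\<lambda>n. fourier \<phi> (2 *\<^sub>R (X n + (2 * pi) *\<^sub>R ?\<gamma>))) \<longlonglongrightarrow> 0"
  proof (rule Lim_null_comparison[OF _ lim0])
    show "eventually (\<lambda>n. norm (fourier \<phi> (2 *\<^sub>R (X n + (2 * pi) *\<^sub>R ?\<gamma>))) \<le> c * norm (X n) ^ Suc m * ?B) sequentially"
      using ev
    proof eventually_elim
      fix n assume "norm (ahat (X n + (2 * pi) *\<^sub>R ?\<gamma>)) \<le> c * norm (X n) ^ Suc m"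
      then show "norm (fourier \<phi> (2 *\<^sub>R (X n + (2 * pi) *\<^sub>R ?\<gamma>))) \<le> c * norm (X n) ^ Suc m * ?B"
        unfolding eq norm_mult
        by (intro mult_mono norm_fourier_le) (auto intro: order_trans[OF norm_ge_zero])
    qed
  qed
  moreover have "(\<lambda>n. fourier \<phi> (2 *\<^sub>R (X n + (2 * pi) *\<^sub>R ?\<gamma>))) \<longlonglongrightarrow> fourier \<phi> (2 *\<^sub>R (0 + (2 * pi) *\<^sub>R ?\<gamma>))"
    by (intro tendsto_fourier_sequentially[OF \<phi>] tendsto_intros X0)
  ultimately have "fourier \<phi> (2 *\<^sub>R (0 + (2 * pi) *\<^sub>R ?\<gamma>)) = 0"
    by (metis LIMSEQ_unique)
  then show ?thesis by simp
qed

text \<open>Descent by halving: if all components of k are even, the refinement equation at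
  \<open>2 * pi\<close> times k/2 passes the zero from k/2 to k, and since k is nonzero the halving
  must reach a vector with an odd component.\<close>

lemma fourier_lattice_eq_0:
  fixes \<phi> ahat :: "real^'d \<Rightarrow> complex"
  assumes \<phi>: "integrable lborel \<phi>" and ref: "refinable ahat \<phi>" and sr: "has_sum_rules (Suc m) ahat"
  shows "k \<noteq> 0 \<Longrightarrow> fourier \<phi> ((2 * pi) *\<^sub>R of_lattice k) = 0"
proof (induction "\<Sum>l\<in>UNIV. nat \<bar>k $ l\<bar>" arbitrary: k rule: less_induct)
  case less
  show ?case
  proof (cases "\<exists>l. odd (k $ l)")
    case True
    then show ?thesis using fourier_odd_lattice_eq_0[OF \<phi> ref sr] by blast
  next
    case False
    define j where "j = (\<chi> l. k $ l div 2)"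
    have kj: "k $ l = 2 * (j $ l)" for l using False by (simp add: j_def)
    obtain l0 where l0: "k $ l0 \<noteq> 0" using less.prems by (auto simp: vec_eq_iff)
    have "(\<Sum>l\<in>UNIV. nat \<bar>j $ l\<bar>) < (\<Sum>l\<in>UNIV. nat \<bar>k $ l\<bar>)"
      by (rule sum_strict_mono_ex1) (use l0 in \<open>auto simp: kj intro!: bexI[of _ l0]\<close>)
    moreover have "j \<noteq> 0" using l0 by (auto simp: kj)
    ultimately have "fourier \<phi> ((2 * pi) *\<^sub>R of_lattice j) = 0" by (rule less.hyps)
    moreover have eq: "(2 * pi) *\<^sub>R of_lattice k = 2 *\<^sub>R ((2 * pi) *\<^sub>R of_lattice j :: real^'d)"
      by (simp add: vec_eq_iff kj)
    moreover have "fourier \<phi> (2 *\<^sub>R z) = ahat z * fourier \<phi> z" for z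
      using ref by (simp add: refinable_def)
    ultimately show ?thesis by (simp only: eq mult_zero_right)
  qed
qed

section \<open>A concentrating trigonometric kernel and functions orthogonal to all integer
  frequencies\<close>

definition cos_factor :: "real \<Rightarrow> real" where
  "cos_factor t = (1 + cos (2 * pi * t)) / 2"

text \<open>Each factor is the square of the cosine of pi times the coordinate: nonnegative,
  1-periodic, equal to 1 only at the integers, and with frequencies -1, 0, 1 only. Powers of the
  product concentrate on the lattice and remain trigonometric polynomials.\<close>

definition cos_kernel :: "real^'d \<Rightarrow> real" where
  "cos_kernel x = (\<Prod>l\<in>UNIV. cos_factor (x $ l))"

lemma cos_factor_bounds: "0 \<le> cos_factor t" "cos_factor t \<le> 1"
proof -
  have "0 \<le> (1 + c) / 2 \<and> (1 + c) / 2 \<le> 1" if "- 1 \<le> c" "c \<le> 1" for c :: real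
    using that by simp
  from this[OF cos_ge_minus_one cos_le_one]
  show "0 \<le> cos_factor t" "cos_factor t \<le> 1"
    by (simp_all only: cos_factor_def)
qed

lemma cos_kernel_bounds: "0 \<le> cos_kernel x" "cos_kernel x \<le> 1"
  unfolding cos_kernel_def by (auto intro!: prod_nonneg prod_le_1 cos_factor_bounds)

lemma continuous_on_cos_kernel [continuous_intros]: "continuous_on S cos_kernel"
  unfolding cos_kernel_def[abs_def] cos_factor_def by (intro continuous_intros) auto

lemma cos_kernel_shift: "cos_kernel (x + of_lattice k) = cos_kernel x"
proof -
  have "cos (2 * pi * (t + real_of_int m)) = cos (2 * pi * t)" for t m
    using cos_add[of "2 * pi * t" "2 * pi * real_of_int m"] 
    by (simp add: distrib_left cos_int_2pin sin_int_2pin)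
  then show ?thesis by (simp add: cos_kernel_def cos_factor_def)
qed

lemma cos_kernel_0 [simp]: "cos_kernel 0 = 1"
  by (simp add: cos_kernel_def cos_factor_def)

lemma cos_kernel_less_1:
  assumes x: "\<And>l. \<bar>x $ l\<bar> \<le> 1 / 2" and "x \<noteq> 0"
  shows "cos_kernel x < 1"
proof -
  obtain l where l: "x $ l \<noteq> 0" using \<open>x \<noteq> 0\<close> by (auto simp: vec_eq_iff)
  have "cos \<bar>2 * pi * x $ l\<bar> < cos 0"
    using l x[of l] by (intro cos_monotone_0_pi) (auto simp: abs_mult)
  then have "cos_factor (x $ l) < 1" by (simp add: cos_factor_def)
  moreover have "cos_kernel x = cos_factor (x $ l) * (\<Prod>l\<in>UNIV - {l}. cos_factor (x $ l))"
    unfolding cos_kernel_def by (rule prod.remove) auto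
  moreover have "(\<Prod>l\<in>UNIV - {l}. cos_factor (x $ l)) \<le> 1"
    by (auto intro!: prod_le_1 cos_factor_bounds)
  ultimately show ?thesis
    using cos_factor_bounds[of "x $ l"] by (metis le_less_trans mult_left_le)
qed

lemma borel_measurable_cos_kernel [measurable]: "cos_kernel \<in> borel_measurable borel"
  by (intro borel_measurable_continuous_onI continuous_on_cos_kernel)

text \<open>Equivalently, the 1-periodisation of \<open>w\<close> has vanishing Fourier
  coefficients.\<close>

definition annihilates_characters :: "(real^'d \<Rightarrow> complex) \<Rightarrow> bool" where
  "annihilates_characters w \<longleftrightarrow> integrable lborel w \<and> (\<forall>k. fourier w ((2 * pi) *\<^sub>R of_lattice k) = 0)"

text \<open>By Euler's formula the factor is a combination of the frequencies 0 and plus or minus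
  the l-th unit vector, with weights 1/2 and 1/4, 1/4. Multiplication only shifts k within the
  lattice, where every integral vanishes.\<close>

lemma annihilates_characters_mult_cos_factor:
  fixes w :: "real^'d \<Rightarrow> complex"
  assumes w: "annihilates_characters w"
  shows "annihilates_characters (\<lambda>x. w x * of_real (cos_factor (x $ l)))"
  unfolding annihilates_characters_def
proof (intro conjI allI)
  have int: "integrable lborel w" and z: "fourier w ((2 * pi) *\<^sub>R of_lattice k) = 0" for k
    using w by (auto simp: annihilates_characters_def)
  have [measurable]: "w \<in> borel_measurable borel" using int by auto
  have [measurable]: "(\<lambda>x::real^'d. cos_factor (x $ l)) \<in> borel_measurable borel"
    unfolding cos_factor_def by measurable
  show "integrable lborel (\<lambda>x. w x * of_real (cos_factor (x $ l)))"
    by (rule Bochner_Integration.integrable_bound[OF int])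
      (auto simp: norm_mult cos_factor_bounds intro!: mult_left_le)
  fix k :: "int^'d"
  let ?E = "\<lambda>k x. w x * exp (- \<i> * of_real (x \<bullet> ((2 * pi) *\<^sub>R of_lattice k)))"
  let ?j = "axis l 1 :: int^'d"
  have ptw: "w x * of_real (cos_factor (x $ l)) * exp (- \<i> * of_real (x \<bullet> ((2 * pi) *\<^sub>R of_lattice k)))
      = 1/2 * ?E k x + (1/4 * ?E (k - ?j) x + 1/4 * ?E (k + ?j) x)" for x
  proof -
    have "x \<bullet> of_lattice ?j = x $ l"
      by (simp add: of_lattice_axis inner_axis)
    then have e: "x \<bullet> ((2 * pi) *\<^sub>R of_lattice (k - ?j)) = x \<bullet> ((2 * pi) *\<^sub>R of_lattice k) - 2 * pi * x $ l"
      "x \<bullet> ((2 * pi) *\<^sub>R of_lattice (k + ?j)) = x \<bullet> ((2 * pi) *\<^sub>R of_lattice k) + 2 * pi * x $ l"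
      by (simp_all add: of_lattice_diff of_lattice_add algebra_simps)
    have m: "?E (k - ?j) x = ?E k x * iexp (2 * pi * x $ l)"
      and p: "?E (k + ?j) x = ?E k x * exp (- (\<i> * of_real (2 * pi * x $ l)))"
      unfolding e mult.assoc exp_add[symmetric] by (simp_all add: algebra_simps)
    have f: "complex_of_real (cos_factor (x $ l)) = 1/2 + (iexp (2 * pi * x $ l) + exp (- (\<i> * of_real (2 * pi * x $ l)))) / 4"
      by (simp add: cos_factor_def cos_of_real[symmetric] cos_exp_eq field_simps)
    have "u * v * E = 1/2 * (u * E) + (1/4 * M + 1/4 * P)"
      if "M = u * E * a" "P = u * E * b" "v = 1/2 + (a + b) / 4" for u v E M P a b :: complex
      by (simp add: that algebra_simps)
    from this[OF m p f] show ?thesis .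
  qed
  have E: "integrable lborel (?E k)" "(LINT x|lborel. ?E k x) = 0" for k
    using integrable_fourier_integrand[OF int, of "(2 * pi) *\<^sub>R of_lattice k"] z[of k]
    by (simp_all add: fourier_def)
  have cE: "integrable lborel (\<lambda>x. c * ?E k x)" for c k
    by (intro integrable_mult_right E)
  show "fourier (\<lambda>x. w x * of_real (cos_factor (x $ l))) ((2 * pi) *\<^sub>R of_lattice k) = 0"
    unfolding fourier_def ptw
      Bochner_Integration.integral_add[OF cE Bochner_Integration.integrable_add[OF cE cE]]
      Bochner_Integration.integral_add[OF cE cE]
      Bochner_Integration.integral_mult_right_zero E
    by simp
qed

text \<open>Each further power multiplies by one cosine factor per coordinate; the inner induction
  inserts them one at a time.\<close>

lemma annihilates_characters_mult_cos_kernel_power: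
  fixes w :: "real^'d \<Rightarrow> complex"
  assumes w: "annihilates_characters w"
  shows "annihilates_characters (\<lambda>x. w x * of_real (cos_kernel x ^ n))"
proof (induction n)
  case (Suc n)
  have "annihilates_characters (\<lambda>x. w x * of_real (cos_kernel x ^ n) * of_real (\<Prod>l\<in>L. cos_factor (x $ l)))"
    if "finite L" for L :: "'d set"
    using that
  proof (induction L rule: finite_induct)
    case (insert l L)
    from annihilates_characters_mult_cos_factor[OF insert.IH, of l] insert.hyps
    show ?case by (simp add: mult_ac)
  qed (use Suc.IH in simp)
  from this[of UNIV] show ?case by (simp add: cos_kernel_def mult_ac)
qed (use w in simp)

lemma integral_annihilating_cos_kernel_power:
  assumes "annihilates_characters w"
  shows "(LINT x|lborel. w x * of_real (cos_kernel x ^ n)) = 0"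
proof -
  have "fourier (\<lambda>x. w x * of_real (cos_kernel x ^ n)) ((2 * pi) *\<^sub>R of_lattice 0) = 0"
    using annihilates_characters_mult_cos_kernel_power[OF assms, of n] unfolding annihilates_characters_def by blast
  then show ?thesis by (simp add: fourier_def)
qed

section \<open>Partition of unity\<close>

text \<open>Half-open, so that its integer translates tile space without overlap; centred at 0, so
  that 0 is an interior point and the only one where \<open>cos_kernel\<close> reaches 1.\<close>

definition unit_cube :: "(real^'d) set" where
  "unit_cube = {x. \<forall>l. - 1/2 \<le> x $ l \<and> x $ l < 1/2}"

lemma sets_unit_cube [measurable]: "unit_cube \<in> sets borel"
  unfolding unit_cube_def by measurable

lemma unit_cube_subset_cbox: "unit_cube \<subseteq> cbox (\<chi> l. - 1/2) ((\<chi> l. 1/2) :: real^'d)"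
  by (auto simp: unit_cube_def mem_box_cart less_imp_le)

lemma bounded_unit_cube: "bounded (unit_cube :: (real^'d) set)"
  by (rule bounded_subset[OF bounded_cbox unit_cube_subset_cbox])

lemma integrable_indicator_bounded:
  assumes "S \<in> sets borel" "bounded (S :: (real^'d) set)"
  shows "integrable lborel (indicator S :: _ \<Rightarrow> real)"
  using assms emeasure_bounded_finite[of S] by (intro integrable_real_indicator) auto

lemma indicator_unit_cube:
  "indicator unit_cube x = (\<Prod>l\<in>UNIV. indicator {- 1/2..<1/2} (x $ l) :: 'a::{comm_semiring_1})"
proof (cases "x \<in> unit_cube")
  case False
  then obtain l where "x $ l \<notin> {- 1/2..<1/2}" by (auto simp: unit_cube_def)
  then have "\<exists>l\<in>UNIV. (indicator {- 1/2..<1/2} (x $ l) :: 'a) = 0"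
    by (intro bexI[of _ l]) (simp_all only: indicator_simps UNIV_I not_False_eq_True)
  from prod_zero[OF finite this] show ?thesis using False by simp
qed (auto simp: unit_cube_def)

lemma integral_character_interval:
  fixes m :: int
  shows "(LINT t|lborel. indicator {- 1/2..<1/2} t * exp (- \<i> * of_real (2 * pi * real_of_int m * t)) :: complex)
    = (if m = 0 then 1 else 0)"
proof (cases "m = 0")
  case True
  have "(LINT t|lborel. complex_of_real (indicator {- 1/2..<1/2::real} t)) = 1"
    unfolding integral_complex_of_real by simp
  then show ?thesis using True by (simp add: of_real_indicator)
next
  case False
  define c where "c = - \<i> * of_real (2 * pi * real_of_int m)"
  have c: "c \<noteq> 0" using False by (simp add: c_def)
  have "(LINT t|lborel. indicator {- 1/2..1/2} t *\<^sub>R exp (c * of_real t)) = exp (c * of_real (1/2)) / c - exp (c * of_real (- 1/2)) / c"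
  proof (rule integral_FTC_atLeastAtMost)
    fix t :: real
    have "((\<lambda>z. exp (c * z) / c) has_field_derivative exp (c * of_real t)) (at (of_real t))"
      using c by (auto intro!: derivative_eq_intros)
    from has_vector_derivative_real_field[OF this]
    show "((\<lambda>t. exp (c * of_real t) / c) has_vector_derivative exp (c * of_real t)) (at t within {- 1/2..1/2})"
      by (rule has_vector_derivative_at_within)
  qed (auto intro!: continuous_intros)
  also have "\<dots> = (exp (c * of_real (1/2)) - exp (c * of_real (- 1/2))) / c"
    by (simp add: diff_divide_distrib)
  also have "exp (c * of_real (1/2)) = exp (c * of_real (- 1/2)) * exp c"
    by (simp add: exp_add[symmetric] field_simps)
  also have "exp c = 1"
  proof -
    have "exp c = exp (of_int (- m) * (2 * of_real pi * \<i>))"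
      by (simp add: c_def mult_ac)
    also have "\<dots> = 1" by (auto simp: exp_eq_1 intro!: exI[of _ "- m"])
    finally show ?thesis .
  qed
  finally have z: "(LINT t|lborel. indicator {- 1/2..1/2} t *\<^sub>R exp (c * of_real t)) = 0" by simp
  have "(LINT t|lborel. indicator {- 1/2..<1/2} t * exp (- \<i> * of_real (2 * pi * real_of_int m * t)) :: complex)
      = (LINT t|lborel. indicator {- 1/2..1/2} t *\<^sub>R exp (c * of_real t))"
  proof (rule integral_cong_AE)
    have "AE t in lborel. t \<noteq> (1/2::real)" by (rule AE_lborel_singleton)
    then show "AE t in lborel. indicator {- 1/2..<1/2} t * exp (- \<i> * of_real (2 * pi * real_of_int m * t))
        = indicator {- 1/2..1/2} t *\<^sub>R exp (c * of_real t)"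
      by eventually_elim (auto simp: indicator_def c_def mult_ac)
  qed measurable
  then show ?thesis using z False by simp
qed

text \<open>The indicator is the model partition of unity: its transform takes the same lattice
  values as that of the function \<psi> treated below, so the difference annihilates all
  characters.\<close>

lemma fourier_unit_cube:
  "fourier (indicator unit_cube :: real^'d \<Rightarrow> complex) ((2 * pi) *\<^sub>R of_lattice k) = (if k = 0 then 1 else 0)"
proof -
  let ?h = "\<lambda>l t. indicator {- 1/2..<1/2} t * exp (- \<i> * of_real (2 * pi * real_of_int (k $ l) * t)) :: complex"
  have "indicator unit_cube x * exp (- \<i> * of_real (x \<bullet> ((2 * pi) *\<^sub>R of_lattice k))) = (\<Prod>l\<in>UNIV. ?h l (x $ l))" for x :: "real^'d"
    by (simp add: indicator_unit_cube inner_vec_def prod.distrib exp_sum[symmetric] sum_negf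
        sum_distrib_left mult_ac)
  then have "fourier (indicator unit_cube) ((2 * pi) *\<^sub>R of_lattice k) = (LINT x|lborel. (\<Prod>l\<in>UNIV. ?h l ((x::real^'d) $ l)))"
    by (simp only: fourier_def)
  also have "\<dots> = (\<Prod>l\<in>UNIV. (LINT t|lborel. ?h l t))"
  proof (rule integral_prod_components)
    fix l
    have "integrable lborel (indicator {- 1/2..<1/2} :: real \<Rightarrow> real)"
      by (rule integrable_real_indicator) auto
    then show "integrable lborel (?h l)"
      by (rule Bochner_Integration.integrable_bound) (auto simp: norm_mult indicator_def)
  qed
  also have "\<dots> = (if k = 0 then 1 else 0)"
    unfolding integral_character_interval by (auto simp: vec_eq_iff)
  finally show ?thesis .
qed

text \<open>Laplace's method. If \<open>q 0\<close> were positive, a small ball around 0 would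
  contribute at least a multiple of \<open>\<rho> ^ n\<close>, while the possibly negative
  contribution away from 0 is at most a multiple of \<open>r ^ n\<close> with r < \<rho>, so the
  integral could not vanish for large n.\<close>

lemma cos_kernel_concentration:
  fixes q :: "real^'d \<Rightarrow> real"
  assumes cont: "continuous_on UNIV q"
    and zero: "\<And>n. (LINT x|lborel. indicator unit_cube x * q x * cos_kernel x ^ n) = 0"
  shows "q 0 \<le> 0"
proof (rule ccontr)
  assume "\<not> q 0 \<le> 0"
  then have q0: "q 0 > 0" by simp
  let ?c = "cbox (\<chi> l. - 1/2) ((\<chi> l. 1/2) :: real^'d)"
  have [measurable]: "q \<in> borel_measurable borel"
    by (rule borel_measurable_continuous_onI[OF cont])
  obtain B where B: "\<And>x. x \<in> ?c \<Longrightarrow> \<bar>q x\<bar> \<le> B" "B > 0"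
  proof -
    have "bounded (q ` ?c)"
      by (intro compact_imp_bounded compact_continuous_image continuous_on_subset[OF cont]) auto
    then show ?thesis using that by (auto simp: bounded_pos)
  qed
  have "isCont q 0" using cont by (simp add: continuous_on_eq_continuous_at)
  then have "\<exists>\<delta>>0. \<forall>x. dist x 0 < \<delta> \<longrightarrow> dist (q x) (q 0) < q 0 / 2"
    using q0 unfolding continuous_at_eps_delta by (metis half_gt_zero)
  then obtain \<delta> where \<delta>: "\<delta> > 0" "\<And>x. norm x < \<delta> \<Longrightarrow> \<bar>q x - q 0\<bar> < q 0 / 2"
    by (auto simp: dist_norm)
  obtain r where r: "0 \<le> r" "r < 1" "\<And>x. x \<in> ?c \<Longrightarrow> norm x \<ge> \<delta> \<Longrightarrow> cos_kernel x \<le> r"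
  proof (cases "?c - ball 0 \<delta> = {}")
    case True
    then show ?thesis using that[of 0] by fastforce
  next
    case False
    have "compact (?c - ball 0 \<delta>)" by (intro compact_diff) auto
    from continuous_attains_sup[OF this False continuous_on_cos_kernel]
    obtain x where x: "x \<in> ?c - ball 0 \<delta>" "\<And>y. y \<in> ?c - ball 0 \<delta> \<Longrightarrow> cos_kernel y \<le> cos_kernel x" by blast
    have "cos_kernel x < 1"
    proof (rule cos_kernel_less_1)
      show "\<bar>x $ l\<bar> \<le> 1 / 2" for l
      proof -
        have "- 1 / 2 \<le> x $ l \<and> x $ l \<le> 1 / 2" using x(1) by (simp add: mem_box_cart)
        then show ?thesis by linarith
      qed
      show "x \<noteq> 0" using x(1) \<delta>(1) by auto
    qed
    then show ?thesis using that[of "cos_kernel x"] x(2) cos_kernel_bounds[of x] by auto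
  qed
  \<comment> \<open>Any value strictly between r and 1 would serve. The ball of radius \<eta> chosen
    below is one on which \<open>cos_kernel\<close> exceeds \<rho> and \<open>q\<close> exceeds half
    of \<open>q 0\<close>.\<close>
  define \<rho> where "\<rho> = (1 + r) / 2"
  have \<rho>: "r < \<rho>" "\<rho> < 1" "\<rho> > 0" using r by (auto simp: \<rho>_def)
  have "isCont (cos_kernel :: real^'d \<Rightarrow> real) 0"
    using continuous_on_cos_kernel[of "UNIV :: (real^'d) set"] by (simp add: continuous_on_eq_continuous_at)
  from this[unfolded continuous_at_eps_delta, rule_format, of "1 - \<rho>"]
  have "\<exists>\<eta>>0. \<forall>x::real^'d. dist x 0 < \<eta> \<longrightarrow> dist (cos_kernel x) (cos_kernel 0) < 1 - \<rho>"
    using \<rho> by simp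
  then obtain \<eta>0 where \<eta>0: "\<eta>0 > 0" "\<And>x::real^'d. norm x < \<eta>0 \<Longrightarrow> \<bar>cos_kernel x - 1\<bar> < 1 - \<rho>"
    by (auto simp: dist_norm)
  define \<eta> where "\<eta> = min (1/2) (min \<delta> \<eta>0)"
  have \<eta>: "\<eta> > 0" "\<eta> \<le> 1/2" "\<eta> \<le> \<delta>" "\<eta> \<le> \<eta>0" using \<delta> \<eta>0 by (auto simp: \<eta>_def)
  let ?U = "ball (0::real^'d) \<eta>"
  have U: "?U \<subseteq> unit_cube"
  proof
    fix x assume "x \<in> ?U"
    then have "norm x < 1/2" using \<eta>(2) by simp
    then have "- 1/2 \<le> x $ l \<and> x $ l < 1/2" for l
      using component_le_norm_cart[of x l] by linarith
    then show "x \<in> unit_cube" unfolding unit_cube_def by blast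
  qed
  define a b where "a = q 0 / 2 * measure lborel ?U" and "b = B * measure lborel (unit_cube::(real^'d) set)"
  have "measure lborel ?U > 0"
    using content_ball_pos[OF \<eta>(1), of 0] by simp
  then have a: "a > 0" using q0 by (simp add: a_def)
  have b: "b \<ge> 0" using B(2) by (simp add: b_def)
  have iU: "integrable lborel (indicator ?U :: real^'d \<Rightarrow> real)"
    and iC: "integrable lborel (indicator unit_cube :: real^'d \<Rightarrow> real)"
    by (rule integrable_indicator_bounded; simp add: bounded_unit_cube)+
  have key: "a * \<rho> ^ n \<le> b * r ^ n" for n
  proof -
    have iq: "integrable lborel (\<lambda>x::real^'d. indicator unit_cube x * q x * cos_kernel x ^ n)"
    proof (rule Bochner_Integration.integrable_bound)
      show "integrable lborel (\<lambda>x::real^'d. indicator unit_cube x * B)"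
        by (intro integrable_mult_left iC)
      have "\<bar>q x\<bar> * cos_kernel x ^ n \<le> B" if "x \<in> unit_cube" for x
      proof -
        have "\<bar>q x\<bar> * cos_kernel x ^ n \<le> B * 1"
          using that B(1)[of x] unit_cube_subset_cbox cos_kernel_bounds[of x]
          by (intro mult_mono power_le_one) auto
        then show ?thesis by simp
      qed
      then show "AE x::real^'d in lborel. norm (indicator unit_cube x * q x * cos_kernel x ^ n) \<le> norm (indicator unit_cube x * B)"
        using B(2) by (intro AE_I2) (auto simp: indicator_def abs_mult cos_kernel_bounds abs_of_nonneg)
    qed measurable
    \<comment> \<open>Three regions: on \<open>?U\<close> both factors are bounded below, between
      \<open>?U\<close> and radius \<delta> the integrand is nonnegative, and beyond \<delta> its
      size is at most \<open>B * r ^ n\<close>.\<close>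
    have "indicator ?U x * (q 0 / 2 * \<rho> ^ n) - indicator unit_cube x * (B * r ^ n)
        \<le> indicator unit_cube x * q x * cos_kernel x ^ n" for x :: "real^'d"
    proof (cases "x \<in> unit_cube")
      case True
      note f0 = cos_kernel_bounds(1)[of x]
      have Br: "B * r ^ n \<ge> 0" using B(2) r(1) by simp
      show ?thesis
      proof (cases "norm x < \<delta>")
        case near: True
        have q: "q x \<ge> q 0 / 2" using \<delta>(2)[OF near] q0 by linarith
        have "indicator ?U x * (q 0 / 2 * \<rho> ^ n) \<le> q x * cos_kernel x ^ n"
        proof (cases "x \<in> ?U")
          case True
          then have "\<rho> \<le> cos_kernel x" using \<eta>0(2)[of x] \<eta>(4) by (auto simp: abs_less_iff)
          then have "q 0 / 2 * \<rho> ^ n \<le> q x * cos_kernel x ^ n"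
            using q q0 \<rho>(3) by (intro mult_mono power_mono) auto
          then show ?thesis using True by simp
        next
          case False
          then show ?thesis using q q0 f0 by simp
        qed
        then show ?thesis using True Br by simp
      next
        case far: False
        have xc: "x \<in> ?c" using True unit_cube_subset_cbox by blast
        have "\<bar>q x\<bar> * cos_kernel x ^ n \<le> B * r ^ n"
          using B(1)[OF xc] r(3)[OF xc] far f0 B(2) by (intro mult_mono power_mono) auto
        moreover have "- (\<bar>q x\<bar> * cos_kernel x ^ n) \<le> q x * cos_kernel x ^ n"
          using mult_right_mono[of "- \<bar>q x\<bar>" "q x" "cos_kernel x ^ n"] f0 by simp
        moreover have "x \<notin> ?U" using far \<eta>(3) by simp
        ultimately show ?thesis using True by simp
      qed
    next
      case False
      then have "x \<notin> ?U" using U by blast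
      then show ?thesis using False by simp
    qed
    then have "(LINT x|lborel. indicator ?U x * (q 0 / 2 * \<rho> ^ n) - indicator unit_cube x * (B * r ^ n))
        \<le> (LINT x|lborel. indicator unit_cube x * q x * cos_kernel x ^ n)"
      by (intro integral_mono iq Bochner_Integration.integrable_diff integrable_mult_left iU iC)
    also have "\<dots> = 0" by (rule zero)
    finally show ?thesis
      using iU iC by (simp add: a_def b_def mult_ac)
  qed
  have "(\<lambda>n. b * (r / \<rho>) ^ n) \<longlonglongrightarrow> b * 0"
    using r \<rho> by (intro tendsto_intros LIMSEQ_power_zero) simp
  then have "eventually (\<lambda>n. b * (r / \<rho>) ^ n < a) sequentially"
    using a by (intro order_tendstoD(2)) auto
  then obtain n where "b * (r / \<rho>) ^ n < a" by (metis eventually_happens' sequentially_bot)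
  then have "b * r ^ n < a * \<rho> ^ n"
    using \<rho>(3) by (simp add: power_divide field_simps)
  with key[of n] show False by simp
qed

text \<open>Ties are rounded up, in agreement with the half-open \<open>unit_cube\<close>: this is
  the index of the translated cube containing x.\<close>

definition lattice_round :: "real^'d \<Rightarrow> int^'d" where
  "lattice_round x = (\<chi> l. \<lfloor>x $ l + 1/2\<rfloor>)"

lemma diff_lattice_in_unit_cube_iff: "x - of_lattice k \<in> unit_cube \<longleftrightarrow> k = lattice_round x"
proof -
  have "(- 1/2 \<le> t - real_of_int m \<and> t - real_of_int m < 1/2) \<longleftrightarrow> m = \<lfloor>t + 1/2\<rfloor>" for t m
    by (auto simp: eq_commute[of m] floor_eq_iff)
  then show ?thesis by (auto simp: unit_cube_def lattice_round_def vec_eq_iff)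
qed

text \<open>A pointwise substitute for Poisson summation. Folding the integral over space into the
  unit cube replaces \<psi> by its periodisation \<open>Q\<close>, so \<open>Q - 1\<close> is
  orthogonal to all powers of \<open>cos_kernel\<close> on the cube, and concentration at 0 yields
  \<open>Q 0 = 1\<close>. The set \<open>K\<close> may be any finite set containing the contributing
  shifts.\<close>

lemma sum_lattice_shifts_eq_1:
  fixes \<psi> :: "real^'d \<Rightarrow> complex"
  assumes cont: "continuous_on UNIV \<psi>" and supp: "bounded {x. \<psi> x \<noteq> 0}"
    and fourier: "\<And>k. fourier \<psi> ((2 * pi) *\<^sub>R of_lattice k) = (if k = 0 then 1 else 0)"
    and int: "integrable lborel \<psi>"
    and K: "finite K" "{k. \<psi> (of_lattice k) \<noteq> 0} \<subseteq> K"
  shows "(\<Sum>k\<in>K. \<psi> (of_lattice k)) = 1"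
proof -
  have [measurable]: "\<psi> \<in> borel_measurable borel" by (rule borel_measurable_continuous_onI[OF cont])
  \<comment> \<open>The indices of the cubes that meet the support of \<psi>. The finite sum
    \<open>Q\<close> over them agrees with the full periodisation at every point of
    \<open>unit_cube\<close>, the only place where \<open>Q\<close> is integrated or evaluated at
    0.\<close>
  define J where "J = lattice_round ` {x. \<psi> x \<noteq> 0}"
  have "finite J"
  proof -
    have "of_lattice k \<in> (\<lambda>(x, y). x - y) ` ({x. \<psi> x \<noteq> 0} \<times> unit_cube)" if kJ: "k \<in> J" for k
    proof -
      obtain x where x: "\<psi> x \<noteq> 0" "k = lattice_round x" using kJ unfolding J_def by blast
      then have "x - of_lattice k \<in> unit_cube" by (simp add: diff_lattice_in_unit_cube_iff)
      then show ?thesis using x(1) by (force intro!: image_eqI[of _ _ "(x, x - of_lattice k)"])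
    qed
    then show ?thesis
      by (intro finite_subset[OF _ finite_bounded_lattice[OF bounded_minus[OF supp bounded_unit_cube]]])
        (auto simp: image_iff)
  qed
  define Q where "Q x = (\<Sum>k\<in>J. \<psi> (x + of_lattice k))" for x
  have contQ: "continuous_on UNIV Q"
    unfolding Q_def[abs_def]
    by (intro continuous_intros continuous_on_compose2[OF cont]) auto
  have [measurable]: "Q \<in> borel_measurable borel" by (rule borel_measurable_continuous_onI[OF contQ])
  have iC: "integrable lborel (indicator unit_cube :: real^'d \<Rightarrow> complex)"
  proof -
    have "integrable lborel (\<lambda>x::real^'d. complex_of_real (indicator unit_cube x))"
      by (intro integrable_of_real integrable_indicator_bounded sets_unit_cube bounded_unit_cube)
    then show ?thesis by (simp only: of_real_indicator)
  qed
  have "annihilates_characters (\<lambda>x. \<psi> x - indicator unit_cube x)"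
    unfolding annihilates_characters_def
    by (auto simp: fourier_diff[OF int iC] fourier fourier_unit_cube intro!: Bochner_Integration.integrable_diff int iC)
  from integral_annihilating_cos_kernel_power[OF this]
  have ann: "(LINT x|lborel. (\<psi> x - indicator unit_cube x) * of_real (cos_kernel x ^ n)) = 0" for n .
  have bd: "integrable lborel (\<lambda>x. w x * of_real (cos_kernel x ^ n))" if "integrable lborel w" for w :: "real^'d \<Rightarrow> complex" and n
  proof (rule Bochner_Integration.integrable_bound[OF that])
    show "(\<lambda>x. w x * of_real (cos_kernel x ^ n)) \<in> borel_measurable lborel" using that by measurable
    show "AE x in lborel. norm (w x * of_real (cos_kernel x ^ n)) \<le> norm (w x)"
      by (intro AE_I2) (auto simp: norm_mult norm_power cos_kernel_bounds abs_of_nonneg intro!: mult_left_le power_le_one)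
  qed
  \<comment> \<open>Cut the integral into the cubes indexed by \<open>J\<close> and translate each
    back to \<open>unit_cube\<close>; periodicity leaves \<open>cos_kernel\<close>
    unchanged.\<close>
  have unfold: "(LINT x|lborel. \<psi> x * of_real (cos_kernel x ^ n)) = (LINT x|lborel. indicator unit_cube x * Q x * of_real (cos_kernel x ^ n))"
    and iQ: "integrable lborel (\<lambda>x. indicator unit_cube x * Q x * of_real (cos_kernel x ^ n))" for n
  proof -
    let ?g = "\<lambda>k x. indicator unit_cube (x - of_lattice k) * (\<psi> x * of_real (cos_kernel x ^ n))"
    let ?h = "\<lambda>k x. indicator unit_cube x * (\<psi> (x + of_lattice k) * of_real (cos_kernel x ^ n))"
    have eq: "?g k (of_lattice k + x) = ?h k x" for k x
      by (simp add: add.commute[of "of_lattice k"] cos_kernel_shift)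
    have g: "integrable lborel (?g k)" for k
    proof (rule Bochner_Integration.integrable_bound[OF bd[OF int, of n]])
      show "?g k \<in> borel_measurable lborel" by measurable
      show "AE x in lborel. norm (?g k x) \<le> norm (\<psi> x * of_real (cos_kernel x ^ n))"
        by (auto simp: indicator_def norm_mult)
    qed
    have h: "integrable lborel (?h k)" for k
      using integrable_lborel_shift[OF g[of k], of "of_lattice k"] unfolding eq .
    have gh: "(LINT x|lborel. ?g k x) = (LINT x|lborel. ?h k x)" for k
      using integral_lborel_shift[of "?g k" "of_lattice k"] g[of k] unfolding eq by auto
    have "(\<Sum>k\<in>J. ?g k x) = \<psi> x * of_real (cos_kernel x ^ n)" for x
    proof (cases "\<psi> x = 0")
      case False
      then have r: "lattice_round x \<in> J" by (auto simp: J_def)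
      have "(\<Sum>k\<in>J. ?g k x) = (\<Sum>k\<in>J. if k = lattice_round x then \<psi> x * of_real (cos_kernel x ^ n) else 0)"
        by (intro sum.cong) (auto simp: indicator_def diff_lattice_in_unit_cube_iff)
      then show ?thesis using r \<open>finite J\<close> by simp
    qed simp
    then have "(LINT x|lborel. \<psi> x * of_real (cos_kernel x ^ n)) = (LINT x|lborel. (\<Sum>k\<in>J. ?g k x))" by simp
    also have "\<dots> = (\<Sum>k\<in>J. (LINT x|lborel. ?g k x))"
      by (rule Bochner_Integration.integral_sum) (rule g)
    also have "\<dots> = (\<Sum>k\<in>J. (LINT x|lborel. ?h k x))" by (simp only: gh)
    also have "\<dots> = (LINT x|lborel. (\<Sum>k\<in>J. ?h k x))"
      by (rule Bochner_Integration.integral_sum[symmetric]) (rule h)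
    finally have 1: "(LINT x|lborel. \<psi> x * of_real (cos_kernel x ^ n)) = (LINT x|lborel. (\<Sum>k\<in>J. ?h k x))" .
    have 2: "(\<lambda>x. indicator unit_cube x * Q x * of_real (cos_kernel x ^ n)) = (\<lambda>x. \<Sum>k\<in>J. ?h k x)"
      by (simp add: Q_def sum_distrib_left sum_distrib_right mult_ac)
    show "(LINT x|lborel. \<psi> x * of_real (cos_kernel x ^ n)) = (LINT x|lborel. indicator unit_cube x * Q x * of_real (cos_kernel x ^ n))"
      unfolding 2 by (rule 1)
    show "integrable lborel (\<lambda>x. indicator unit_cube x * Q x * of_real (cos_kernel x ^ n))"
      unfolding 2 by (rule Bochner_Integration.integrable_sum) (rule h)
  qed
  have zero: "(LINT x|lborel. indicator unit_cube x * (Q x - 1) * of_real (cos_kernel x ^ n)) = 0" for n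
  proof -
    have "(LINT x|lborel. indicator unit_cube x * (Q x - 1) * of_real (cos_kernel x ^ n))
      = (LINT x|lborel. indicator unit_cube x * Q x * of_real (cos_kernel x ^ n) - indicator unit_cube x * of_real (cos_kernel x ^ n))"
      by (simp add: algebra_simps)
    also have "\<dots> = (LINT x|lborel. \<psi> x * of_real (cos_kernel x ^ n)) - (LINT x|(lborel::(real^'d) measure). indicator unit_cube x * of_real (cos_kernel x ^ n))"
      unfolding unfold by (rule Bochner_Integration.integral_diff[OF iQ bd[OF iC]])
    also have "\<dots> = (LINT x|lborel. \<psi> x * of_real (cos_kernel x ^ n) - indicator unit_cube x * of_real (cos_kernel x ^ n))"
      by (rule Bochner_Integration.integral_diff[OF bd[OF int] bd[OF iC], symmetric])
    also have "\<dots> = 0" using ann[of n] by (simp add: left_diff_distrib)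
    finally show ?thesis .
  qed
  \<comment> \<open>The concentration lemma is one-sided and real. Rotating by the conjugate of
    \<open>?z\<close> makes the value of \<open>q\<close> at 0 the squared norm of
    \<open>?z\<close>, so nonpositivity forces it to vanish.\<close>
  let ?z = "Q 0 - 1"
  define q where "q x = Re (cnj ?z * (Q x - 1))" for x
  have "q 0 \<le> 0"
  proof (rule cos_kernel_concentration)
    show "continuous_on UNIV q" unfolding q_def[abs_def] by (intro continuous_intros contQ)
    fix n
    have int1: "integrable lborel (\<lambda>x. indicator unit_cube x * (Q x - 1) * of_real (cos_kernel x ^ n))"
      using Bochner_Integration.integrable_diff[OF iQ bd[OF iC], of n n] by (simp add: algebra_simps)
    have "indicator unit_cube x * q x * cos_kernel x ^ n = Re (cnj ?z * (indicator unit_cube x * (Q x - 1) * of_real (cos_kernel x ^ n)))" for x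
      by (auto simp: q_def indicator_def algebra_simps)
    then have "(LINT x|lborel. indicator unit_cube x * q x * cos_kernel x ^ n)
        = (LINT x|lborel. Re (cnj ?z * (indicator unit_cube x * (Q x - 1) * of_real (cos_kernel x ^ n))))"
      by simp
    also have "\<dots> = Re (LINT x|lborel. cnj ?z * (indicator unit_cube x * (Q x - 1) * of_real (cos_kernel x ^ n)))"
      by (rule integral_Re) (rule integrable_mult_right[OF int1])
    also have "\<dots> = 0" by (simp only: Bochner_Integration.integral_mult_right_zero zero) simp
    finally show "(LINT x|lborel. indicator unit_cube x * q x * cos_kernel x ^ n) = 0" .
  qed
  moreover have "q 0 = (norm ?z)\<^sup>2"
    unfolding q_def cmod_power2 by (simp add: power2_eq_square)
  ultimately have "Q 0 = 1" by simp
  moreover have "{k. \<psi> (of_lattice k) \<noteq> 0} \<subseteq> J"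
  proof
    fix k assume "k \<in> {k. \<psi> (of_lattice k) \<noteq> 0}"
    moreover have "lattice_round (of_lattice k) = k"
      using diff_lattice_in_unit_cube_iff[of "of_lattice k" k] by (simp add: unit_cube_def)
    ultimately show "k \<in> J" unfolding J_def by force
  qed
  then have "(\<Sum>k\<in>K. \<psi> (of_lattice k)) = (\<Sum>k\<in>J. \<psi> (of_lattice k))"
    using K \<open>finite J\<close> by (intro sum.mono_neutral_cong) auto
  ultimately show ?thesis by (simp add: Q_def)
qed

text \<open>The preceding lemma is applied to the translate of \<phi> by y, whose transform differs
  by a phase only: zeros at nonzero lattice frequencies persist and the value at 0 is still 1. The
  images under \<open>uminus\<close> account for the sign of k.\<close>

theorem refinable_partition_of_unity:
  fixes \<phi> ahat :: "real^'d \<Rightarrow> complex"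
  assumes cont: "continuous_on UNIV \<phi>" and supp: "bounded {x. \<phi> x \<noteq> 0}"
    and ref: "refinable ahat \<phi>" and sr: "has_sum_rules (Suc m) ahat"
    and K: "finite K" "{k. \<phi> (y - of_lattice k) \<noteq> 0} \<subseteq> K"
  shows "(\<Sum>k\<in>K. \<phi> (y - of_lattice k)) = 1"
proof -
  have [measurable]: "\<phi> \<in> borel_measurable borel" by (rule borel_measurable_continuous_onI[OF cont])
  obtain r where r: "\<And>x. \<phi> x \<noteq> 0 \<Longrightarrow> norm x \<le> r" using supp by (auto simp: bounded_iff)
  have "integrable lborel (\<lambda>x. indicator (cball 0 r) x *\<^sub>R \<phi> x)"
    using borel_integrable_compact[of "cball 0 r" \<phi>] continuous_on_subset[OF cont] by simp
  also have "(\<lambda>x. indicator (cball 0 r) x *\<^sub>R \<phi> x) = \<phi>"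
    using r by (force simp: indicator_def)
  finally have int: "integrable lborel \<phi>" .
  let ?\<psi> = "\<lambda>x. \<phi> (y + x)"
  have inj: "inj_on uminus (uminus ` K)" by simp
  have "(\<Sum>k\<in>uminus ` K. ?\<psi> (of_lattice k)) = 1"
  proof (rule sum_lattice_shifts_eq_1)
    show "continuous_on UNIV ?\<psi>"
      by (intro continuous_on_compose2[OF cont] continuous_intros) auto
    have "{x. ?\<psi> x \<noteq> 0} \<subseteq> (\<lambda>x. - y + x) ` {x. \<phi> x \<noteq> 0}"
      by (auto simp: image_iff intro!: exI[of _ "y + _"])
    then show "bounded {x. ?\<psi> x \<noteq> 0}"
      using bounded_translation[OF supp, of "- y"] by (rule bounded_subset[rotated])
    show "integrable lborel ?\<psi>" by (rule integrable_lborel_shift[OF int])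
    show "finite (uminus ` K)" using K by simp
    show "{k. ?\<psi> (of_lattice k) \<noteq> 0} \<subseteq> uminus ` K"
    proof
      fix k assume "k \<in> {k. ?\<psi> (of_lattice k) \<noteq> 0}"
      moreover have "of_lattice (- k) = (- of_lattice k :: real^'d)" by (simp add: vec_eq_iff)
      ultimately have "- k \<in> K" using K(2) by auto
      then show "k \<in> uminus ` K" by force
    qed
    fix k :: "int^'d"
    let ?\<omega> = "(2 * pi) *\<^sub>R of_lattice k :: real^'d"
    have shift: "(LINT x|lborel. \<phi> (y + x) * exp (- \<i> * of_real ((y + x) \<bullet> ?\<omega>))) = fourier \<phi> ?\<omega>"
      unfolding fourier_def by (rule integral_lborel_shift[of "\<lambda>x. \<phi> x * exp (- \<i> * of_real (x \<bullet> ?\<omega>))"]) measurable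
    have split: "exp (- \<i> * of_real (x \<bullet> ?\<omega>)) = exp (\<i> * of_real (y \<bullet> ?\<omega>)) * exp (- \<i> * of_real ((y + x) \<bullet> ?\<omega>))" for x
    proof -
      have "exp (- \<i> * of_real b) = exp (\<i> * of_real a) * exp (- \<i> * of_real (a + b))" for a b :: real
        by (simp add: exp_add[symmetric] algebra_simps)
      then show ?thesis unfolding inner_add_left .
    qed
    have "fourier ?\<psi> ?\<omega> = (LINT x|lborel. exp (\<i> * of_real (y \<bullet> ?\<omega>)) * (\<phi> (y + x) * exp (- \<i> * of_real ((y + x) \<bullet> ?\<omega>))))"
      unfolding fourier_def
      by (rule Bochner_Integration.integral_cong[OF refl]) (subst split, rule mult.left_commute)
    also have "\<dots> = exp (\<i> * of_real (y \<bullet> ?\<omega>)) * fourier \<phi> ?\<omega>"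
      by (simp only: Bochner_Integration.integral_mult_right_zero shift)
    finally have "fourier ?\<psi> ?\<omega> = exp (\<i> * of_real (y \<bullet> ?\<omega>)) * fourier \<phi> ?\<omega>" .
    moreover have "fourier \<phi> 0 = 1" using ref by (simp add: refinable_def)
    ultimately show "fourier ?\<psi> ?\<omega> = (if k = 0 then 1 else 0)"
      using fourier_lattice_eq_0[OF int ref sr, of k] by (cases "k = 0") auto
  qed
  moreover have "(\<Sum>k\<in>uminus ` K. ?\<psi> (of_lattice k)) = (\<Sum>k\<in>K. \<phi> (y - of_lattice k))"
  proof -
    have "of_lattice (- k) = (- of_lattice k :: real^'d)" for k by (simp add: vec_eq_iff)
    then show ?thesis by (subst sum.reindex) (auto simp: inj_on_def)
  qed
  ultimately show ?thesis by simp
qed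

section \<open>Reconstruction error\<close>

lemma norm_diff_squares_le:
  fixes u v w :: complex
  shows "\<bar>(norm (u + w))\<^sup>2 - (norm (v + w))\<^sup>2\<bar> \<le> norm (u - v) * (norm u + norm v + 2 * norm w)"
proof -
  have "\<bar>(norm (u + w))\<^sup>2 - (norm (v + w))\<^sup>2\<bar> = \<bar>norm (u + w) - norm (v + w)\<bar> * (norm (u + w) + norm (v + w))"
    by (simp add: power2_eq_square square_diff_square_factored abs_mult mult.commute)
  also have "\<dots> \<le> norm (u - v) * (norm u + norm v + 2 * norm w)"
    using norm_triangle_ineq3[of "u + w" "v + w"] norm_triangle_ineq[of u w] norm_triangle_ineq[of v w]
    by (intro mult_mono) auto
  finally show ?thesis .
qed

text \<open>If \<open>f\<close> took the same value \<open>F\<close> at the three grid points, the linear system would recover \<open>F\<close>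
  exactly, because a plane wave has constant modulus; the errors \<open>E'\<close>, \<open>E''\<close> measure how far the
  intensities are from that situation.\<close>

lemma reconstruction_identity:
  fixes F G G' G'' :: complex and E' E'' :: real
  assumes mod: "norm G' = norm G" "norm G'' = norm G"
    and \<mu>: "\<mu> = - Im ((G - G') * cnj (G - G''))" "\<mu> \<noteq> 0"
    and D: "D' = (norm (F + G))\<^sup>2 - (norm (F + G'))\<^sup>2 + E'" "D'' = (norm (F + G))\<^sup>2 - (norm (F + G''))\<^sup>2 + E''"
  shows "Complex ((Im (G - G'') * D' - Im (G - G') * D'') / (2 * \<mu>))
      ((- Re (G - G'') * D' + Re (G - G') * D'') / (2 * \<mu>))
    = F + of_real (1 / (2 * \<mu>)) * (- \<i> * ((G - G'') * of_real E' - (G - G') * of_real E''))"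
proof -
  have expand: "(norm (F + G))\<^sup>2 - (norm (F + V))\<^sup>2 = 2 * (Re F * Re (G - V) + Im F * Im (G - V))"
    if "norm V = norm G" for V
  proof -
    have "(norm V)\<^sup>2 = (norm G)\<^sup>2" using that by simp
    then show ?thesis unfolding cmod_power2 by (simp add: power2_eq_square algebra_simps)
  qed
  \<comment> \<open>Up to the common factor 2, \<mu> is the determinant of the linear system for the
    real and imaginary parts of \<open>F\<close>.\<close>
  have \<mu>': "\<mu> = Re (G - G') * Im (G - G'') - Im (G - G') * Re (G - G'')"
    using \<mu>(1) by (simp add: algebra_simps)
  have "Im (G - G'') * D' - Im (G - G') * D'' = 2 * \<mu> * Re F + (Im (G - G'') * E' - Im (G - G') * E'')"
    unfolding D expand[OF mod(1)] expand[OF mod(2)] \<mu>' by (simp add: algebra_simps)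
  moreover have "- Re (G - G'') * D' + Re (G - G') * D'' = 2 * \<mu> * Im F + (- Re (G - G'') * E' + Re (G - G') * E'')"
    unfolding D expand[OF mod(1)] expand[OF mod(2)] \<mu>' by (simp add: algebra_simps)
  ultimately show ?thesis
    using \<mu>(2) by (simp add: complex_eq_iff add_divide_distrib)
      (simp add: add_divide_distrib diff_divide_distrib algebra_simps)
qed

text \<open>A vanishing denominator gives the quotient the value infinity, so the finite bound
  yields nondegeneracy along with the estimate.\<close>

lemma adm_quotient_leD:
  assumes "adm_quotient g N (k, k', k'') \<le> ereal \<gamma>"
  defines "p \<equiv> g (grid_point N k) - g (grid_point N k')"
    and "r \<equiv> g (grid_point N k) - g (grid_point N k'')"
  shows "Im (p * cnj r) \<noteq> 0" "max (norm p) (norm r) \<le> \<gamma> * \<bar>Im (p * cnj r)\<bar>"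
proof -
  have *: "(if \<bar>Im (p * cnj r)\<bar> = 0 then \<infinity> else ereal (max (norm p) (norm r) / \<bar>Im (p * cnj r)\<bar>)) \<le> ereal \<gamma>"
    using assms(1)
    unfolding adm_quotient_def Let_def prod.case complex_cnj_diff[symmetric] complex_mod_cnj p_def r_def .
  show nz: "Im (p * cnj r) \<noteq> 0"
    using * by (auto split: if_splits)
  show "max (norm p) (norm r) \<le> \<gamma> * \<bar>Im (p * cnj r)\<bar>"
    using * nz by (simp add: pos_divide_le_eq del: max.bounded_iff)
qed

text \<open>Apply the admissibility bound to r: its norm is at most \<gamma> times
  \<open>norm p * norm r\<close>, and \<open>norm p\<close> is at most 2a; cancel
  \<open>norm r\<close>. This lower bound lets error terms that carry no factor \<gamma> be absorbed
  into one that does.\<close>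

lemma adm_quotient_gamma_ge:
  assumes q: "adm_quotient g N (k, k', k'') \<le> ereal \<gamma>"
    and mod: "\<And>x. norm (g x) = a"
  shows "1 \<le> 2 * \<gamma> * a"
proof -
  let ?p = "g (grid_point N k) - g (grid_point N k')" and ?r = "g (grid_point N k) - g (grid_point N k'')"
  note adm = adm_quotient_leD[OF q]
  have "norm ?p \<le> 2 * a"
    using norm_triangle_ineq4[of "g (grid_point N k)" "g (grid_point N k')"] by (simp add: mod)
  have "max (norm ?p) (norm ?r) \<ge> 0" by (simp add: le_max_iff_disj)
  then have "0 \<le> \<gamma> * \<bar>Im (?p * cnj ?r)\<bar>" using adm(2) by linarith
  then have \<gamma>: "\<gamma> \<ge> 0" using adm(1) by (simp add: zero_le_mult_iff)
  have r: "norm ?r > 0" using adm(1) by auto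
  have "norm ?r \<le> \<gamma> * \<bar>Im (?p * cnj ?r)\<bar>" using adm(2) by simp
  also have "\<dots> \<le> \<gamma> * (norm ?p * norm ?r)"
    using abs_Im_le_cmod[of "?p * cnj ?r", unfolded norm_mult complex_mod_cnj] \<gamma> by (rule mult_left_mono)
  also have "\<dots> \<le> \<gamma> * (2 * a * norm ?r)"
    using \<gamma> \<open>norm ?p \<le> 2 * a\<close> by (intro mult_left_mono mult_right_mono) auto
  finally show ?thesis using r by (simp add: mult_ac) 
qed

text \<open>Each intensity error is at most \<open>\<omega> * (2 * (b + a))\<close>. It is
  multiplied by the norm of p or r divided by \<open>2 * \<bar>\<mu>\<bar>\<close>, which
  admissibility bounds by \<gamma>/2; the two contributions add up to the claim.\<close>

lemma norm_reconstruct_diff_le: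
  assumes q: "adm_quotient g N (k, k', k'') \<le> ereal \<gamma>"
    and mod: "\<And>x. norm (g x) = a"
    and f: "norm (f (grid_point N k)) \<le> b" "norm (f (grid_point N k')) \<le> b" "norm (f (grid_point N k'')) \<le> b"
    and osc: "norm (f (grid_point N k) - f (grid_point N k')) \<le> \<omega>" "norm (f (grid_point N k) - f (grid_point N k'')) \<le> \<omega>"
  shows "norm (reconstruct f g N (k, k', k'') - f (grid_point N k)) \<le> 2 * \<gamma> * \<omega> * (b + a)"
proof -
  let ?F = "f (grid_point N k)" and ?F' = "f (grid_point N k')" and ?F'' = "f (grid_point N k'')"
  let ?G = "g (grid_point N k)" and ?G' = "g (grid_point N k')" and ?G'' = "g (grid_point N k'')"
  let ?p = "?G - ?G'" and ?r = "?G - ?G''"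
  define \<mu> where "\<mu> = - Im (?p * cnj ?r)"
  \<comment> \<open>The change in intensity at a neighbour when the true value of \<open>f\<close>
    there is replaced by its value at the central point.\<close>
  define E' E'' where "E' = (norm (?F + ?G'))\<^sup>2 - (norm (?F' + ?G'))\<^sup>2"
    and "E'' = (norm (?F + ?G''))\<^sup>2 - (norm (?F'' + ?G''))\<^sup>2"
  note adm = adm_quotient_leD[OF q]
  have \<mu>: "\<mu> \<noteq> 0" "max (norm ?p) (norm ?r) \<le> \<gamma> * \<bar>\<mu>\<bar>" 
    unfolding \<mu>_def abs_minus_cancel neg_equal_0_iff_equal by (rule adm)+
  have a: "a \<ge> 0" using mod[of 0] norm_ge_zero by metis
  have E: "\<bar>E'\<bar> \<le> \<omega> * (2 * (b + a))" "\<bar>E''\<bar> \<le> \<omega> * (2 * (b + a))"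
  proof -
    have \<omega>0: "\<omega> \<ge> 0" using osc(1) norm_ge_zero order_trans by blast
    have "\<bar>E'\<bar> \<le> norm (?F - ?F') * (norm ?F + norm ?F' + 2 * norm ?G')"
      unfolding E'_def by (rule norm_diff_squares_le)
    also have "\<dots> \<le> \<omega> * (2 * (b + a))"
      using f a \<omega>0 by (intro mult_mono osc) (auto simp: mod)
    finally show "\<bar>E'\<bar> \<le> \<omega> * (2 * (b + a))" .
    have "\<bar>E''\<bar> \<le> norm (?F - ?F'') * (norm ?F + norm ?F'' + 2 * norm ?G'')"
      unfolding E''_def by (rule norm_diff_squares_le)
    also have "\<dots> \<le> \<omega> * (2 * (b + a))"
      using f a \<omega>0 by (intro mult_mono osc) (auto simp: mod)
    finally show "\<bar>E''\<bar> \<le> \<omega> * (2 * (b + a))" .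
  qed
  have "reconstruct f g N (k, k', k'') = ?F + of_real (1 / (2 * \<mu>)) * (- \<i> * (?r * of_real E' - ?p * of_real E''))"
    unfolding reconstruct_def Let_def prod.case \<mu>_def[symmetric]
    by (rule reconstruction_identity)
      (use \<mu>(1) in \<open>simp_all add: mod \<mu>_def intensity_def E'_def E''_def\<close>)
  then have "norm (reconstruct f g N (k, k', k'') - ?F) = norm (?r * of_real E' - ?p * of_real E'') / (2 * \<bar>\<mu>\<bar>)"
    by (simp add: norm_mult norm_divide)
  also have "\<dots> \<le> (norm ?r * \<bar>E'\<bar> + norm ?p * \<bar>E''\<bar>) / (2 * \<bar>\<mu>\<bar>)"
    using norm_triangle_ineq4[of "?r * of_real E'" "?p * of_real E''"]
    by (intro divide_right_mono) (simp_all add: norm_mult)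
  also have "\<dots> \<le> (\<gamma> * \<bar>\<mu>\<bar> * (\<omega> * (2 * (b + a))) + \<gamma> * \<bar>\<mu>\<bar> * (\<omega> * (2 * (b + a)))) / (2 * \<bar>\<mu>\<bar>)"
  proof -
    have "norm ?r \<le> \<gamma> * \<bar>\<mu>\<bar>" "norm ?p \<le> \<gamma> * \<bar>\<mu>\<bar>" using \<mu>(2) by auto
    moreover from this(1) have "0 \<le> \<gamma> * \<bar>\<mu>\<bar>" using norm_ge_zero order_trans by blast
    ultimately show ?thesis
      by (intro divide_right_mono add_mono mult_mono E) auto
  qed
  also have "\<dots> = 2 * \<gamma> * \<omega> * (b + a)"
    using \<mu>(1) by (simp add: field_simps)
  finally show ?thesis .
qed

section \<open>From sample errors to the \<open>L\<^sup>2\<close> estimate on the region\<close>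

lemma plane_wave_norm_const: "plane_wave g \<Longrightarrow> norm (g x) = norm (g 0)"
  by (auto simp: plane_wave_def norm_mult)

lemma sobolev_norm_nonneg: "sobolev_norm s f \<ge> 0"
  by (auto simp: sobolev_norm_def intro!: mult_nonneg_nonneg integral_nonneg_AE)

lemma finite_Lam: "finite (Lam M \<Omega> N)"
  unfolding Lam_def by (rule finite_lattice_box)

text \<open>Admissibility is a statement about index triples and would be vacuous without one; a
  triple is needed both for the lower bound on \<gamma> and for bounding the moduli of the
  waves.\<close>

lemma Lam_nonempty:
  fixes \<Omega> :: "(real^'d) set"
  assumes "bounded \<Omega>" "lattice_points \<Omega> \<noteq> {}" "\<forall>l. M $ l > 0"
  shows "Lam M \<Omega> N \<noteq> {}"
proof -
  have fin: "finite (lattice_points \<Omega>)"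
    unfolding lattice_points_def by (rule finite_bounded_lattice[OF assms(1)])
  define k where "k = (\<chi> l. 2 ^ N * L_min \<Omega> l)"
  obtain k0 where "k0 \<in> lattice_points \<Omega>" using assms(2) by blast
  then have "L_min \<Omega> l \<le> k0 $ l" "k0 $ l \<le> L_max \<Omega> l" for l
    using fin by (auto simp: L_min_def L_max_def)
  then have "L_min \<Omega> l \<le> L_max \<Omega> l" for l by (rule order_trans)
  then have "k \<in> Lam M \<Omega> N"
    using assms(3) by (auto simp: Lam_def k_def less_imp_le)
  then show ?thesis by blast
qed

text \<open>Since the moduli are constant in space, the bound at grid points bounds them all.
  Without it the real supremum in the final estimate would have no meaning as an upper
  bound.\<close>

lemma uniformly_admissible_bdd:
  assumes adm: "uniformly_admissible \<gamma> g T" and T: "\<And>N. N \<ge> 1 \<Longrightarrow> T N \<noteq> {}"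
    and mod: "\<And>N x. N \<ge> 1 \<Longrightarrow> norm (g N x) = a N"
  shows "bdd_above (a ` {1..})"
proof -
  let ?S = "\<Union>N\<in>{1..}. \<Union>(k, k', k'')\<in>T N.
       {norm (g N (grid_point N k)), norm (g N (grid_point N k')), norm (g N (grid_point N k''))}"
  have "a N \<in> ?S" if N1: "N \<ge> 1" for N
  proof -
    obtain k k' k'' where "(k, k', k'') \<in> T N" using T[OF N1] by auto
    then show ?thesis using N1 by (force simp: mod)
  qed
  then have "a ` {1..} \<subseteq> ?S" by auto
  then show ?thesis
    using adm unfolding uniformly_admissible_def by (meson bdd_above_mono)
qed

lemma L2_norm_on_le:
  fixes \<Omega> :: "(real^'d) set"
  assumes \<Omega>: "bounded \<Omega>" "\<Omega> \<in> sets lebesgue" and neg: "negligible (\<Omega> - X)"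
    and b: "\<And>x. x \<in> \<Omega> \<Longrightarrow> x \<in> X \<Longrightarrow> norm (h x) \<le> b" "b \<ge> 0"
  shows "L2_norm_on \<Omega> h \<le> b * sqrt (measure lebesgue \<Omega>)"
proof -
  have L: "\<Omega> \<in> lmeasurable" by (rule bounded_set_imp_lmeasurable[OF \<Omega>])
  have i: "integrable lebesgue (indicator \<Omega> :: _ \<Rightarrow> real)"
    using L by (intro integrable_real_indicator) (auto simp: fmeasurable_def)
  have ae: "AE x in lebesgue. x \<notin> \<Omega> - X"
    using neg by (intro AE_not_in) (simp add: negligible_iff_null_sets)
  \<comment> \<open>The Bochner integral of a non-integrable function is 0, so domination by a
    nonnegative integrable function covers that case as well.\<close>
  have "(LINT x|lebesgue. indicator \<Omega> x *\<^sub>R (norm (h x))\<^sup>2) \<le> (LINT x|lebesgue. indicator \<Omega> x * b\<^sup>2)"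
  proof (rule integral_mono_AE')
    show "AE x in lebesgue. indicator \<Omega> x *\<^sub>R (norm (h x))\<^sup>2 \<le> indicator \<Omega> x * b\<^sup>2"
      using ae by eventually_elim (use b in \<open>auto simp: indicator_def intro!: power_mono\<close>)
  qed (use i in auto)
  also have "\<dots> = measure lebesgue \<Omega> * b\<^sup>2"
    using L by simp
  finally have "L2_norm_on \<Omega> h \<le> sqrt (measure lebesgue \<Omega> * b\<^sup>2)"
    unfolding L2_norm_on_def set_lebesgue_integral_def by (rule real_sqrt_le_mono)
  also have "\<dots> = b * sqrt (measure lebesgue \<Omega>)"
    using b(2) by (simp add: real_sqrt_mult)
  finally show ?thesis .
qed

text \<open>By nonnegativity the norms of the weights also sum to 1, so the error is a convex
  combination of the individual errors, and only indices with nonzero weight count.\<close>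

lemma norm_partition_of_unity_diff_le:
  fixes \<psi> c :: "'a \<Rightarrow> complex"
  assumes K: "finite K" "(\<Sum>k\<in>K. \<psi> k) = 1" and pos: "\<And>k. \<psi> k \<in> \<real>\<^sub>\<ge>\<^sub>0"
    and b: "\<And>k. k \<in> K \<Longrightarrow> \<psi> k \<noteq> 0 \<Longrightarrow> norm (z - c k) \<le> b"
  shows "norm (z - (\<Sum>k\<in>K. c k * \<psi> k)) \<le> b"
proof -
  have n: "complex_of_real (norm (\<psi> k)) = \<psi> k" for k
    using pos[of k] by (auto elim!: nonneg_Reals_cases)
  have "complex_of_real (\<Sum>k\<in>K. norm (\<psi> k)) = 1"
    using K(2) by (simp add: n)
  then have s: "(\<Sum>k\<in>K. norm (\<psi> k)) = 1" by (simp only: of_real_eq_1_iff)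
  have "z - (\<Sum>k\<in>K. c k * \<psi> k) = (\<Sum>k\<in>K. (z - c k) * \<psi> k)"
    using K(2) by (simp add: left_diff_distrib sum_subtractf sum_distrib_left[symmetric])
  also have "norm \<dots> \<le> (\<Sum>k\<in>K. norm ((z - c k) * \<psi> k))" by (rule norm_sum)
  also have "\<dots> \<le> (\<Sum>k\<in>K. b * norm (\<psi> k))"
  proof (rule sum_mono)
    fix k assume "k \<in> K"
    then show "norm ((z - c k) * \<psi> k) \<le> b * norm (\<psi> k)"
      using b[of k] by (cases "\<psi> k = 0") (auto simp: norm_mult intro: mult_right_mono)
  qed
  also have "\<dots> = b" using s by (simp add: sum_distrib_left[symmetric])
  finally show ?thesis .
qed

theorem theorem4p4:
  fixes \<phi> ahat :: "real^'d \<Rightarrow> complex"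
    and M :: "real^'d"
    and s \<sigma> :: real
    and \<kappa> :: nat
  assumes "s > real CARD('d) / 2" and "\<sigma> > s"
    and "in_sobolev s \<phi>" and "continuous_on UNIV \<phi>"
    and "\<forall>x. \<phi> x \<in> \<real>\<^sub>\<ge>\<^sub>0"
    and "nu2 \<phi> > ereal \<sigma>"
    and "\<forall>l. M $ l > 0"
    and "closure {x. \<phi> x \<noteq> 0} \<subseteq> {x. \<forall>l. 0 \<le> x $ l \<and> x $ l \<le> M $ l}"
    and "refinable ahat \<phi>"
    and "has_sum_rules (\<kappa> + 1) ahat"
    and "real (\<kappa> + 1) > \<sigma>"
  shows "\<exists>C>0. \<forall>\<Omega>::(real^'d) set.
           bounded \<Omega> \<and> \<Omega> \<in> sets lebesgue \<and> lattice_points \<Omega> \<noteq> {} \<and>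
           negligible (\<Omega> - lattice_box \<Omega>) \<longrightarrow>
           (\<exists>C1>0. \<forall>j0 \<gamma> (g :: nat \<Rightarrow> real^'d \<Rightarrow> complex).
              (\<forall>N\<ge>1. plane_wave (g N)) \<and> uniformly_admissible \<gamma> g (Xi M j0 \<Omega>) \<longrightarrow>
              (\<forall>f. in_sobolev s f \<and> continuous_on UNIV f \<and> nu2 f > ereal \<sigma> \<longrightarrow>
                (\<forall>N\<ge>1.
                  L2_norm_on \<Omega> (\<lambda>x. f x -
                      (\<Sum>k\<in>Lam M \<Omega> N. reconstruct f (g N) N (triple_at j0 k) *
                                         \<phi> (2 ^ N *\<^sub>R x - of_lattice k)))
                  \<le> sobolev_norm \<sigma> f *
                     (C * 2 powr (- real N * (\<sigma> - s) / 2) +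
                      \<gamma> * C1 * (sobolev_norm \<sigma> f + (SUP l\<in>{1..}. SUP x\<in>\<Omega>. norm (g l x))) *
                        2 powr (- (real N + 1) * min 1 (\<sigma> - s))))))"
proof -
  define \<zeta> where "\<zeta> = min 1 (\<sigma> - s)"
  have \<zeta>: "\<zeta> > 0" using assms(2) by (simp add: \<zeta>_def)
  obtain H where H: "H > 0"
    and f_le: "\<And>(f :: real^'d \<Rightarrow> complex) x. in_sobolev \<sigma> f \<Longrightarrow> continuous_on UNIV f \<Longrightarrow> norm (f x) \<le> H * sobolev_norm \<sigma> f"
    and f_hol: "\<And>(f :: real^'d \<Rightarrow> complex) x y. in_sobolev \<sigma> f \<Longrightarrow> continuous_on UNIV f \<Longrightarrow>
      norm (f x - f y) \<le> H * sobolev_norm \<sigma> f * norm (x - y) powr \<zeta>"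
    using sobolev_holder[OF assms(1,2)] unfolding \<zeta>_def by blast
  \<comment> \<open>The first summand comes from the oscillation of \<open>f\<close> over the
    support of a shift of \<phi>, after multiplication by
    \<open>2 * \<gamma> * (S + A) \<ge> 1\<close>; the second comes from the reconstruction error,
    with \<open>H * S + a N\<close> bounded by \<open>(H + 1) * (S + A)\<close>.\<close>
  define R where "R = 2 * H * norm M powr \<zeta> + 2 * H * (H + 1)"
  have R: "R \<ge> 0" using H by (simp add: R_def)
  have supp: "0 \<le> z $ l \<and> z $ l \<le> M $ l" if "\<phi> z \<noteq> 0" for z l
    using that assms(8) closure_subset[of "{x. \<phi> x \<noteq> 0}"] by blast
  have bsupp: "bounded {z. \<phi> z \<noteq> 0}"
    using supp by (intro bounded_subset[OF bounded_cbox[of 0 M]]) (auto simp: mem_box_cart)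
  \<comment> \<open>The first constant is simply 1. In the second, \<open>2 powr \<zeta>\<close>
    converts the rate at level N into the rate with N + 1, and the final 1 keeps the constant
    positive when \<Omega> is a null set.\<close>
  have main: "L2_norm_on \<Omega> (\<lambda>x. f x - (\<Sum>k\<in>Lam M \<Omega> N. reconstruct f (g N) N (triple_at j0 k) * \<phi> (2 ^ N *\<^sub>R x - of_lattice k)))
      \<le> sobolev_norm \<sigma> f * (1 * 2 powr (- real N * (\<sigma> - s) / 2) +
         \<gamma> * (2 powr \<zeta> * R * sqrt (measure lebesgue \<Omega>) + 1) * (sobolev_norm \<sigma> f + (SUP l\<in>{1..}. SUP x\<in>\<Omega>. norm (g l x))) *
           2 powr (- (real N + 1) * \<zeta>))"
    if \<Omega>: "bounded \<Omega>" "\<Omega> \<in> sets lebesgue" "lattice_points \<Omega> \<noteq> {}" "negligible (\<Omega> - lattice_box \<Omega>)"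
      and pw: "\<And>N. N \<ge> 1 \<Longrightarrow> plane_wave (g N)" and adm: "uniformly_admissible \<gamma> g (Xi M j0 \<Omega>)"
      and f: "in_sobolev \<sigma> f" "continuous_on UNIV f" and N: "N \<ge> 1"
    for \<Omega> :: "(real^'d) set" and j0 \<gamma> g f N
  proof -
    define a where "a N = norm (g N 0)" for N
    have mod: "norm (g N x) = a N" if "N \<ge> 1" for N x
      unfolding a_def by (rule plane_wave_norm_const[OF pw[OF that]])
    have Lam_ne: "Lam M \<Omega> N \<noteq> {}" for N by (rule Lam_nonempty[OF \<Omega>(1,3) assms(7)])
    define A where "A = (SUP l\<in>{1..}. SUP x\<in>\<Omega>. norm (g l x))"
    have "\<Omega> \<noteq> {}" using \<Omega>(3) by (auto simp: lattice_points_def)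
    then have "A = (SUP l\<in>{1..}. a l)"
      unfolding A_def by (intro SUP_cong) (auto simp: mod)
    \<comment> \<open>Needed for \<open>cSUP_upper\<close>, since a supremum of reals dominates its
      members only when the set is bounded above.\<close>
    moreover have "bdd_above (a ` {1..})"
      using Lam_ne by (intro uniformly_admissible_bdd[OF adm _ mod]) (auto simp: Xi_def)
    ultimately have aA: "a N \<le> A" using N by (auto intro: cSUP_upper)
    have a0: "a N \<ge> 0" by (simp add: a_def)
    have quot: "adm_quotient (g N) N (triple_at j0 k) \<le> ereal \<gamma>" if "k \<in> Lam M \<Omega> N" for k
    proof -
      have "(SUP t\<in>Xi M j0 \<Omega> N. adm_quotient (g N) N t) \<le> ereal \<gamma>"
        using adm N by (simp add: uniformly_admissible_def admissible_def)
      then show ?thesis using that by (auto simp: SUP_le_iff Xi_def)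
    qed
    have \<gamma>: "\<gamma> > 0" using adm N by (auto simp: uniformly_admissible_def admissible_def)
    define S where "S = sobolev_norm \<sigma> f"
    have S: "S \<ge> 0" unfolding S_def by (rule sobolev_norm_nonneg)
    have "1 \<le> 2 * \<gamma> * a N"
    proof -
      obtain k where "k \<in> Lam M \<Omega> N" using Lam_ne by blast
      from adm_quotient_gamma_ge[OF quot[OF this, unfolded triple_at_def] mod[OF N]] show ?thesis .
    qed
    also have "\<dots> \<le> 2 * \<gamma> * (S + A)" using aA S \<gamma> by (intro mult_left_mono) auto
    finally have one_le: "1 \<le> 2 * \<gamma> * (S + A)" .
    define t where "t = 2 powr (- real N * \<zeta>)"
    have t: "t > 0" by (simp add: t_def)
    have scale: "(c / 2 ^ N) powr \<zeta> = c powr \<zeta> * t" if "c \<ge> 0" for c :: real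
    proof -
      have "(2::real) ^ N = 2 powr real N" by (simp add: powr_realpow)
      then show ?thesis using that
        by (simp add: t_def powr_divide powr_powr powr_minus_divide)
    qed
    define b where "b = S * t * (\<gamma> * (S + A)) * R"
    have b0: "b \<ge> 0" using S t \<gamma> R one_le a0 aA by (simp add: b_def)
    have "norm (f x - (\<Sum>k\<in>Lam M \<Omega> N. reconstruct f (g N) N (triple_at j0 k) * \<phi> (2 ^ N *\<^sub>R x - of_lattice k))) \<le> b"
      if x: "x \<in> lattice_box \<Omega>" for x
    proof (rule norm_partition_of_unity_diff_le[OF finite_Lam])
      \<comment> \<open>At a point of the box, every contributing shift lies in \<open>Lam\<close>:
        the margin \<open>M $ l\<close> on the lower side is the width of the support of \<phi> in
        that direction.\<close>
      have "k \<in> Lam M \<Omega> N" if "\<phi> (2 ^ N *\<^sub>R x - of_lattice k) \<noteq> 0" for k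
        unfolding Lam_def
      proof (intro CollectI allI)
        fix l
        have "real_of_int (L_min \<Omega> l) \<le> x $ l" "x $ l \<le> real_of_int (L_max \<Omega> l)"
          using x by (auto simp: lattice_box_def)
        then have "2 ^ N * real_of_int (L_min \<Omega> l) \<le> 2 ^ N * x $ l" "2 ^ N * x $ l \<le> 2 ^ N * real_of_int (L_max \<Omega> l)"
          by auto
        moreover have "0 \<le> 2 ^ N * x $ l - real_of_int (k $ l) \<and> 2 ^ N * x $ l - real_of_int (k $ l) \<le> M $ l"
          using supp[OF that, of l] by simp
        ultimately show "2 ^ N * real_of_int (L_min \<Omega> l) - M $ l \<le> real_of_int (k $ l) \<and>
            real_of_int (k $ l) \<le> 2 ^ N * real_of_int (L_max \<Omega> l)" by linarith
      qed
      then show "(\<Sum>k\<in>Lam M \<Omega> N. \<phi> (2 ^ N *\<^sub>R x - of_lattice k)) = 1"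
        using assms(10) by (intro refinable_partition_of_unity[OF assms(4) bsupp assms(9), of \<kappa>] finite_Lam) auto
      show "\<phi> (2 ^ N *\<^sub>R x - of_lattice k) \<in> \<real>\<^sub>\<ge>\<^sub>0" for k using assms(5) by blast
      fix k assume k: "k \<in> Lam M \<Omega> N" and nz: "\<phi> (2 ^ N *\<^sub>R x - of_lattice k) \<noteq> 0"
      have "norm (x - grid_point N k) = norm (2 ^ N *\<^sub>R x - of_lattice k) / 2 ^ N"
      proof -
        have "x - grid_point N k = (1 / 2 ^ N) *\<^sub>R (2 ^ N *\<^sub>R x - of_lattice k)"
          by (simp add: grid_point_def scaleR_diff_right)
        then show ?thesis by simp
      qed
      also have "\<dots> \<le> norm M / 2 ^ N"
      proof (intro divide_right_mono norm_le_componentwise_cart)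
        show "norm ((2 ^ N *\<^sub>R x - of_lattice k) $ l) \<le> norm (M $ l)" for l
          unfolding real_norm_def using supp[OF nz, of l] by linarith
      qed simp
      finally have "norm (x - grid_point N k) powr \<zeta> \<le> (norm M / 2 ^ N) powr \<zeta>"
        using \<zeta> by (intro powr_mono2) auto
      then have "H * S * norm (x - grid_point N k) powr \<zeta> \<le> H * S * (norm M powr \<zeta> * t)"
        using H S by (intro mult_left_mono) (auto simp: scale)
      then have "norm (f x - f (grid_point N k)) \<le> H * S * (norm M powr \<zeta> * t)"
        using f_hol[OF f, of x "grid_point N k"] by (simp add: S_def)
      \<comment> \<open>The oscillation carries no factor \<gamma>; multiplying by a quantity that
        is at least 1 gives it the form of the reconstruction error.\<close>
      also have "\<dots> \<le> H * S * (norm M powr \<zeta> * t) * (2 * \<gamma> * (S + A))"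
        using mult_left_mono[OF one_le, of "H * S * (norm M powr \<zeta> * t)"] H S t by simp
      finally have e1: "norm (f x - f (grid_point N k)) \<le> H * S * (norm M powr \<zeta> * t) * (2 * \<gamma> * (S + A))" .
      \<comment> \<open>The grid points of a triple are exactly \<open>1 / 2 ^ N\<close> apart; c is
        -1 for the forward neighbour and 1 for the backward one.\<close>
      have osc: "norm (f (grid_point N k) - f (grid_point N k')) \<le> H * S * t"
        if "of_lattice k - of_lattice k' = (axis j0 c :: real^'d)" "\<bar>c\<bar> = 1" for k' c
      proof -
        have "grid_point N k - grid_point N k' = (1 / 2 ^ N) *\<^sub>R (axis j0 c :: real^'d)"
          unfolding that(1)[symmetric] by (simp add: grid_point_def scaleR_diff_right)
        moreover have "norm (axis j0 c :: real^'d) = 1"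
          using that(2) by (simp add: norm_eq_sqrt_inner inner_axis_axis)
        ultimately have "norm (grid_point N k - grid_point N k' :: real^'d) = 1 / 2 ^ N"
          by simp
        then have "norm (grid_point N k - grid_point N k' :: real^'d) powr \<zeta> = t"
          using scale[of 1] by simp
        then show ?thesis
          using f_hol[OF f, of "grid_point N k" "grid_point N k'"] by (simp add: S_def)
      qed
      have "norm (reconstruct f (g N) N (triple_at j0 k) - f (grid_point N k)) \<le> 2 * \<gamma> * (H * S * t) * (H * S + a N)"
        unfolding triple_at_def
      proof (rule norm_reconstruct_diff_le[OF quot[OF k, unfolded triple_at_def] mod[OF N]])
        show "norm (f (grid_point N k) - f (grid_point N (k + axis j0 1))) \<le> H * S * t"
          by (rule osc[of _ "- 1"]) (simp_all add: of_lattice_add of_lattice_axis vec_eq_iff axis_def)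
        show "norm (f (grid_point N k) - f (grid_point N (k - axis j0 1))) \<le> H * S * t"
          by (rule osc[of _ 1]) (simp_all add: of_lattice_diff of_lattice_axis)
      qed (use f_le[OF f] in \<open>auto simp: S_def\<close>)
      also have "\<dots> \<le> 2 * \<gamma> * (H * S * t) * ((H + 1) * (S + A))"
      proof (rule mult_left_mono)
        have "0 \<le> H * A" using H a0 aA by simp
        then show "H * S + a N \<le> (H + 1) * (S + A)"
          using aA S by (simp add: algebra_simps)
      qed (use \<gamma> H S t in auto)
      finally have e2: "norm (reconstruct f (g N) N (triple_at j0 k) - f (grid_point N k)) \<le> 2 * \<gamma> * (H * S * t) * ((H + 1) * (S + A))" .
      have "norm (f x - reconstruct f (g N) N (triple_at j0 k)) \<le>
          norm (f x - f (grid_point N k)) + norm (reconstruct f (g N) N (triple_at j0 k) - f (grid_point N k))"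
        using norm_triangle_ineq4[of "f x - f (grid_point N k)" "reconstruct f (g N) N (triple_at j0 k) - f (grid_point N k)"]
        by simp
      also have "\<dots> \<le> H * S * (norm M powr \<zeta> * t) * (2 * \<gamma> * (S + A)) + 2 * \<gamma> * (H * S * t) * ((H + 1) * (S + A))"
        by (rule add_mono[OF e1 e2])
      also have "\<dots> = b"
        by (simp add: b_def R_def algebra_simps)
      finally show "norm (f x - reconstruct f (g N) N (triple_at j0 k)) \<le> b" .
    qed
    then have "L2_norm_on \<Omega> (\<lambda>x. f x - (\<Sum>k\<in>Lam M \<Omega> N. reconstruct f (g N) N (triple_at j0 k) * \<phi> (2 ^ N *\<^sub>R x - of_lattice k)))
        \<le> b * sqrt (measure lebesgue \<Omega>)"
      by (intro L2_norm_on_le[OF \<Omega>(1,2,4) _ b0])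
    also have "\<dots> = S * (\<gamma> * (2 powr \<zeta> * R * sqrt (measure lebesgue \<Omega>)) * (S + A) * 2 powr (- (real N + 1) * \<zeta>))"
    proof -
      have "t = 2 powr \<zeta> * 2 powr (- (real N + 1) * \<zeta>)"
        unfolding t_def powr_add[symmetric] by (simp add: algebra_simps)
      then show ?thesis by (simp add: b_def mult_ac)
    qed
    also have "\<dots> \<le> S * (1 * 2 powr (- real N * (\<sigma> - s) / 2) +
        \<gamma> * (2 powr \<zeta> * R * sqrt (measure lebesgue \<Omega>) + 1) * (S + A) * 2 powr (- (real N + 1) * \<zeta>))"
    proof (rule mult_left_mono[OF _ S])
      have "\<gamma> * (2 powr \<zeta> * R * sqrt (measure lebesgue \<Omega>)) * (S + A) * 2 powr (- (real N + 1) * \<zeta>)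
          \<le> \<gamma> * (2 powr \<zeta> * R * sqrt (measure lebesgue \<Omega>) + 1) * (S + A) * 2 powr (- (real N + 1) * \<zeta>)"
        using \<gamma> S a0 aA by (intro mult_right_mono mult_left_mono) auto
      then show "\<gamma> * (2 powr \<zeta> * R * sqrt (measure lebesgue \<Omega>)) * (S + A) * 2 powr (- (real N + 1) * \<zeta>)
          \<le> 1 * 2 powr (- real N * (\<sigma> - s) / 2) +
            \<gamma> * (2 powr \<zeta> * R * sqrt (measure lebesgue \<Omega>) + 1) * (S + A) * 2 powr (- (real N + 1) * \<zeta>)"
        using powr_ge_zero[of 2 "- real N * (\<sigma> - s) / 2"] by linarith
    qed
    finally show ?thesis unfolding S_def A_def .
  qed
  have C1: "2 powr \<zeta> * R * sqrt (measure lebesgue \<Omega>) + 1 > 0" for \<Omega> :: "(real^'d) set"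
    using R by (simp add: add_nonneg_pos)
  show ?thesis
    unfolding \<zeta>_def[symmetric]
  proof (rule exI[of _ "1::real"], intro conjI allI impI zero_less_one)
    fix \<Omega> :: "(real^'d) set"
    assume \<Omega>: "bounded \<Omega> \<and> \<Omega> \<in> sets lebesgue \<and> lattice_points \<Omega> \<noteq> {} \<and> negligible (\<Omega> - lattice_box \<Omega>)"
    show "\<exists>C1>0. \<forall>j0 \<gamma> (g :: nat \<Rightarrow> real^'d \<Rightarrow> complex).
              (\<forall>N\<ge>1. plane_wave (g N)) \<and> uniformly_admissible \<gamma> g (Xi M j0 \<Omega>) \<longrightarrow>
              (\<forall>f. in_sobolev s f \<and> continuous_on UNIV f \<and> nu2 f > ereal \<sigma> \<longrightarrow>
                (\<forall>N\<ge>1.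
                  L2_norm_on \<Omega> (\<lambda>x. f x -
                      (\<Sum>k\<in>Lam M \<Omega> N. reconstruct f (g N) N (triple_at j0 k) *
                                         \<phi> (2 ^ N *\<^sub>R x - of_lattice k)))
                  \<le> sobolev_norm \<sigma> f *
                     (1 * 2 powr (- real N * (\<sigma> - s) / 2) +
                      \<gamma> * C1 * (sobolev_norm \<sigma> f + (SUP l\<in>{1..}. SUP x\<in>\<Omega>. norm (g l x))) *
                        2 powr (- (real N + 1) * \<zeta>))))"
      by (rule exI[of _ "2 powr \<zeta> * R * sqrt (measure lebesgue \<Omega>) + 1"], intro conjI C1 allI impI main)
        (use \<Omega> in \<open>auto intro: in_sobolev_of_nu2\<close>)
  qed
qed

end
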